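(* Let $q$ be a prime power that is a square, and let $q+\delta$ be the size of the smallest non-trivial blocking set in $\mathrm{PG}(2,q)$ not containing a Baer subplane. Let $\mathcal{L}$ be a Cameron-Liebler set of generators on the Klein quadric $Q^+(5,q)$ with parameter $x<\delta$. Then $\mathcal{L}$ is the union of point-pencils and of Cameron-Liebler sets of Baer subgeometry type, which are pairwise disjoint.
   Context: The Klein quadric $Q^+(5,q)$ is the hyperbolic quadric in $\mathrm{PG}(5,q)$ with equation $X_0X_5+X_1X_4+X_2X_3=0$. Its generators are the planes of $\mathrm{PG}(5,q)$ contained in it. The Klein correspondence is the bijection from lines of $\mathrm{PG}(3,q)$ to points of $Q^+(5,q)$ sending a line to its Plücker coordinates $(p_{01},p_{02},p_{03},p_{12},p_{31},p_{23})$. The set of all lines through a fixed point of $\mathrm{PG}(3,q)$ is mapped onto a generator, called a Latin plane, and the set of all lines in a fixed plane of $\mathrm{PG}(3,q)$ is mapped onto a generator, called a Greek plane; every generator arises in exactly one of these ways. Let $A$ be the $\{0,1\}$-valued point-generator incidence matrix of $Q^+(5,q)$ (rows indexed by points, columns by generators, entry $1$ iff the point lies in the generator). A set $\mathcal{L}$ of generators is a (degree one) Cameron-Liebler set if its characteristic vector (a real vector indexed by the generators) lies in $\mathrm{Im}(A^T)$ (over the reals); it has parameter $x$ if $|\mathcal{L}|=2x(q+1)$. In $Q^+(5,q)$ the notions of Cameron-Liebler set and degree one Cameron-Liebler set coincide. The point-pencil with vertex $P$, for a point $P$ of $Q^+(5,q)$, is the set of all generators of $Q^+(5,q)$ containing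 $P$. A Baer subgeometry of $\mathrm{PG}(n,q)$, $q$ square, is a subgeometry $\mathrm{PG}(n,\sqrt{q})$ naturally embedded in $\mathrm{PG}(n,q)$ (i.e. the image, under an element of $\mathrm{PGL}(n+1,q)$, of the points with coordinates in $\mathbb{F}_{\sqrt{q}}$); for $n=2$ it is called a Baer subplane. A Cameron-Liebler set of Baer subgeometry type on $Q^+(5,q)$ is the set of generators consisting of the Latin planes corresponding to the points of a Baer subgeometry $\mathrm{PG}(3,\sqrt{q})$ of $\mathrm{PG}(3,q)$, together with the Greek planes corresponding to the planes of that Baer subgeometry (i.e. the planes of $\mathrm{PG}(3,q)$ meeting it in a Baer subplane); it has parameter $\sqrt{q}+1$. A blocking set in $\mathrm{PG}(2,q)$ is a set of points intersecting every line in at least one point; it is non-trivial if it contains no line of $\mathrm{PG}(2,q)$. "Union of point-pencils and of Cameron-Liebler sets of Baer subgeometry type, which are pairwise disjoint" means that $\mathcal{L}$ is a union of pairwise disjoint sets of generators each of which is of one of these two kinds; not both kinds need to occur. *)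

theory Defs
  imports "HOL-Analysis.Analysis"
begin

text \<open>
  A subspace of PG(n,q) of projective dimension d is represented by the linear
  subspace of vector dimension d + 1 of \<open>'a ^ 'n\<close>, where \<open>CARD('n) = n + 1\<close> and
  \<open>'a\<close> is the field with q elements. Incidence is inclusion.
\<close>

definition proj_points :: "('a::field ^ 'n) set set" where
  "proj_points = {U. vec.subspace U \<and> vec.dim U = 1}"

definition proj_lines :: "('a::field ^ 'n) set set" where
  "proj_lines = {U. vec.subspace U \<and> vec.dim U = 2}"

definition proj_planes :: "('a::field ^ 'n) set set" where
  "proj_planes = {U. vec.subspace U \<and> vec.dim U = 3}"


subsection \<open>Baer subgeometries\<close>

definition subfield_set :: "'a::field set \<Rightarrow> bool" where
  "subfield_set K \<longleftrightarrow> 0 \<in> K \<and> 1 \<in> K \<and>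
     (\<forall>a\<in>K. \<forall>b\<in>K. a + b \<in> K \<and> a * b \<in> K) \<and>
     (\<forall>a\<in>K. - a \<in> K \<and> inverse a \<in> K)"

definition points_over :: "'a::field set \<Rightarrow> ('a ^ 'n) set set" where
  "points_over K = {vec.span {v} | v. v \<noteq> 0 \<and> (\<forall>i. v $ i \<in> K)}"

definition baer_subgeometry :: "('a::{field,finite} ^ 'n) set set \<Rightarrow> bool" where
  "baer_subgeometry S \<longleftrightarrow>
     (\<exists>K (M :: 'a ^ 'n ^ 'n). subfield_set K \<and> (card K)\<^sup>2 = CARD('a) \<and> invertible M \<and>
        S = (\<lambda>P. (*v) M ` P) ` points_over K)"

text \<open>
  Baer subplanes of a plane E of a larger projective space: an injective linear map
  with image E identifies PG(2,q) with E.
\<close>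

definition baer_subplane_of :: "('a::{field,finite} ^ 'n) set \<Rightarrow> ('a ^ 'n) set set \<Rightarrow> bool" where
  "baer_subplane_of E S \<longleftrightarrow>
     (\<exists>(M :: 'a ^ 3 ^ 'n) S0. inj ((*v) M) \<and> range ((*v) M) = E \<and>
        baer_subgeometry S0 \<and> S = (\<lambda>P. (*v) M ` P) ` S0)"


subsection \<open>Blocking sets in PG(2,q)\<close>

definition blocking_set :: "('a::field ^ 3) set set \<Rightarrow> bool" where
  "blocking_set B \<longleftrightarrow> B \<subseteq> proj_points \<and> (\<forall>l\<in>proj_lines. \<exists>P\<in>B. P \<subseteq> l)"

definition nontrivial_blocking_set :: "('a::field ^ 3) set set \<Rightarrow> bool" where
  "nontrivial_blocking_set B \<longleftrightarrow>
     blocking_set B \<and> \<not> (\<exists>l\<in>proj_lines. {P \<in> proj_points. P \<subseteq> l} \<subseteq> B)"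

definition contains_baer_subplane :: "('a::{field,finite} ^ 3) set set \<Rightarrow> bool" where
  "contains_baer_subplane B \<longleftrightarrow> (\<exists>S. baer_subgeometry S \<and> S \<subseteq> B)"


subsection \<open>The Klein quadric and the Klein correspondence\<close>

definition klein_quadric :: "('a::field ^ 6) set" where
  "klein_quadric = {X. X $ 0 * X $ 5 + X $ 1 * X $ 4 + X $ 2 * X $ 3 = 0}"

definition klein_points :: "('a::field ^ 6) set set" where
  "klein_points = {P \<in> proj_points. P \<subseteq> klein_quadric}"

definition generators :: "('a::field ^ 6) set set" where
  "generators = {G \<in> proj_planes. G \<subseteq> klein_quadric}"

definition plucker_coord :: "'a::field ^ 4 \<Rightarrow> 'a ^ 4 \<Rightarrow> 4 \<Rightarrow> 4 \<Rightarrow> 'a" where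
  "plucker_coord u v i j = u $ i * v $ j - u $ j * v $ i"

definition plucker :: "'a::field ^ 4 \<Rightarrow> 'a ^ 4 \<Rightarrow> 'a ^ 6" where
  "plucker u v = (\<chi> k.
     if k = 0 then plucker_coord u v 0 1
     else if k = 1 then plucker_coord u v 0 2
     else if k = 2 then plucker_coord u v 0 3
     else if k = 3 then plucker_coord u v 1 2
     else if k = 4 then plucker_coord u v 3 1
     else plucker_coord u v 2 3)"

text \<open>
  The Pluecker vectors of all pairs of vectors of a line are the scalar multiples of the
  Pluecker vector of any one basis, so the span below is a single projective point.
\<close>

definition klein :: "('a::field ^ 4) set \<Rightarrow> ('a ^ 6) set" where
  "klein l = vec.span {plucker u v | u v. u \<in> l \<and> v \<in> l}"

text \<open>
  A generator is represented by a linear subspace, that is, by the union of its points;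
  hence the union over the images of the lines concerned.
\<close>

definition latin_plane :: "('a::field ^ 4) set \<Rightarrow> ('a ^ 6) set" where
  "latin_plane P = \<Union> (klein ` {l \<in> proj_lines. P \<subseteq> l})"

definition greek_plane :: "('a::field ^ 4) set \<Rightarrow> ('a ^ 6) set" where
  "greek_plane E = \<Union> (klein ` {l \<in> proj_lines. l \<subseteq> E})"


subsection \<open>Cameron-Liebler sets of generators\<close>

definition incidence :: "('a::field ^ 6) set \<Rightarrow> ('a ^ 6) set \<Rightarrow> real" where
  "incidence P G = (if P \<subseteq> G then 1 else 0)"

text \<open>The characteristic vector of L equals \<open>A\<^sup>T w\<close> for some real vector w indexed by the points.\<close>

definition cameron_liebler :: "('a::{field,finite} ^ 6) set set \<Rightarrow> bool" where
  "cameron_liebler L \<longleftrightarrow> L \<subseteq> generators \<and>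
     (\<exists>w :: ('a ^ 6) set \<Rightarrow> real. \<forall>G\<in>generators.
        indicator L G = (\<Sum>P\<in>klein_points. incidence P G * w P))"

definition has_parameter :: "('a::{field,finite} ^ 6) set set \<Rightarrow> real \<Rightarrow> bool" where
  "has_parameter L x \<longleftrightarrow> real (card L) = 2 * x * (real CARD('a) + 1)"

definition point_pencil :: "('a::field ^ 6) set \<Rightarrow> ('a ^ 6) set set" where
  "point_pencil P = {G \<in> generators. P \<subseteq> G}"

definition is_point_pencil :: "('a::field ^ 6) set set \<Rightarrow> bool" where
  "is_point_pencil M \<longleftrightarrow> (\<exists>P\<in>klein_points. M = point_pencil P)"

definition baer_type :: "('a::{field,finite} ^ 6) set set \<Rightarrow> bool" where
  "baer_type M \<longleftrightarrow> (\<exists>S :: ('a ^ 4) set set. baer_subgeometry S \<and>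
     M = latin_plane ` S \<union>
         greek_plane ` {E \<in> proj_planes. baer_subplane_of E {P \<in> S. P \<subseteq> E}})"

end

theory Submission imports Defs begin

text \<open>
  Let s be the square root of q. The Klein correspondence turns the generators into the points and
  planes of PG(3,q), so L becomes a set S of points together with a set T of planes. A weight w on
  the points of the quadric with \<open>A\<^sup>T w\<close> the characteristic vector of L is a weight on the
  lines of PG(3,q), and summing it over the points of a plane shows that a plane meets S in x + q
  points if it belongs to T and in x points otherwise (\<open>cl_pair_of_weights\<close>). In particular x is
  an integer. The same holds dually for the planes of T through a point, and a line contains as many points of
  S as it lies on planes of T (\<open>cl_pairI\<close>). Hence every line of a plane E of T
  meets S, and the points of S in E form a blocking set of size x + q, less than the
  minimum in the hypothesis. So it contains a line or a Baer subplane.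

  If S contains a line l, then all planes through l are in T, and l with its planes is a
  point-pencil. Otherwise every plane of T has a Baer subplane of points of S, and by duality the
  planes of T through a point of S contain a Baer subplane of the quotient at that point. A nontrivial blocking
  set of size at most 2q + 1 without Baer subplanes exists (\<open>exists_small_blocking_set\<close>),
  so x is at most q. For a point P of S in a plane E of T, the points of S other than P are distributed over the q + 1
  lines of the pencil of P in E, so the numbers of these points on the lines have sum x + q - 1, less than 2q.
  This excess is too small for any disagreement of the local Baer structures: P is
  rational in E if and only if E is rational at P (\<open>rational_flag\<close>), and then the rational lines
  of the pencil are the same for both structures (\<open>rational_pencils_agree\<close>), because different
  Baer sublines have at most two common points. For the same reason some line l carries a common
  subline of the Baer subplanes of two planes of T (\<open>common_subline\<close>). These two generate a Baer
  subgeometry, and it belongs to S and T (\<open>exists_baer_subgeometry\<close>).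

  Removing the points and planes of a line or of a Baer subgeometry lowers x by 1 or s + 1 and
  preserves all intersection properties (\<open>cl_pair_diff\<close>), so the decomposition follows by
  induction on x.

  Baer subgeometries are handled through their rational vectors: a form over the subfield K of
  order s is the set of K-combinations of a basis, characterised by its span and its size.
  Everything about rational points, lines and planes then follows from counting in additive groups.
\<close>

section \<open>Rational vectors and rational points\<close>

definition kcomb :: "'a::field set \<Rightarrow> ('a ^ 'n) set \<Rightarrow> ('a ^ 'n) set" where
  "kcomb K B = (\<lambda>c. \<Sum>b\<in>B. c b *s b) ` (B \<rightarrow>\<^sub>E K)"

definition ksubspace :: "'a::field set \<Rightarrow> ('a ^ 'n) set \<Rightarrow> bool" where
  "ksubspace K W \<longleftrightarrow> 0 \<in> W \<and> (\<forall>v\<in>W. \<forall>w\<in>W. v + w \<in> W) \<and> (\<forall>c\<in>K. \<forall>v\<in>W. c *s v \<in> W)"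

text \<open>
  A K-form of U is the set of K-combinations of some basis of U. The definition by
  the number of elements avoids the choice of a basis; \<open>kform_eq_kcomb\<close> recovers
  every basis of U that consists of elements of W. The points of a Baer subgeometry are the points spanned by
  the elements of a form over the subfield of order s, where s is the square root of q.
\<close>
definition kform :: "'a::field set \<Rightarrow> ('a ^ 'n) set \<Rightarrow> ('a ^ 'n) set \<Rightarrow> bool" where
  "kform K W U \<longleftrightarrow> ksubspace K W \<and> vec.span W = U \<and> card W = card K ^ vec.dim U"

definition rat_points :: "('a::field ^ 'n) set \<Rightarrow> ('a ^ 'n) set set" where
  "rat_points W = {vec.span {w} | w. w \<in> W \<and> w \<noteq> 0}"

abbreviation pts :: "('a::field ^ 'n) set \<Rightarrow> ('a ^ 'n) set set" where
  "pts U \<equiv> {P \<in> proj_points. P \<subseteq> U}"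

lemma subfield_UNIV: "subfield_set UNIV"
  by (simp add: subfield_set_def)

lemma card_le_fibres:
  assumes "finite G" "\<And>a. a \<in> A \<Longrightarrow> f a \<in> G" "\<And>g. g \<in> G \<Longrightarrow> card {a \<in> A. f a = g} \<le> k" "finite A"
  shows "card A \<le> card G * k"
proof -
  have un: "A = (\<Union>g\<in>G. {a \<in> A. f a = g})" (is "_ = ?U") using assms(2) by auto
  have "card ?U = (\<Sum>g\<in>G. card {a \<in> A. f a = g})"
    by (rule card_UN_disjoint) (use assms(1,4) in auto)
  then have "card A = (\<Sum>g\<in>G. card {a \<in> A. f a = g})" by (simp only: un[symmetric])
  also have "\<dots> \<le> (\<Sum>g\<in>G. k)" by (rule sum_mono) (use assms in auto)
  finally show ?thesis by simp
qed

lemma card_image_kernel: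
  fixes f :: "'v::ab_group_add \<Rightarrow> 'w::ab_group_add"
  assumes fin: "finite A"
    and sub: "\<And>a b. a \<in> A \<Longrightarrow> b \<in> A \<Longrightarrow> a - b \<in> A"
    and add: "\<And>a b. a \<in> A \<Longrightarrow> b \<in> A \<Longrightarrow> f (a - b) = f a - f b"
  shows "card A = card (f ` A) * card {a \<in> A. f a = 0}"
proof -
  have fibre: "card {a \<in> A. f a = f a0} = card {a \<in> A. f a = 0}" if a0: "a0 \<in> A" for a0
  proof (rule bij_betw_same_card[OF bij_betw_byWitness[where f = "\<lambda>a. a - a0" and f' = "\<lambda>a. a + a0"]])
    have "0 \<in> A" using sub[OF a0 a0] by simp
    then have neg: "- a \<in> A" if "a \<in> A" for a using sub[of 0 a] that by simp
    have plus: "a + b \<in> A" if "a \<in> A" "b \<in> A" for a b using sub[of a "- b"] neg[of b] that by simp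
    have "f (a + a0) = f a0" if "a \<in> A" "f a = 0" for a
      using add[OF plus[OF that(1) a0] a0] that by simp
    then show "(\<lambda>a. a + a0) ` {a \<in> A. f a = 0} \<subseteq> {a \<in> A. f a = f a0}"
      using plus a0 by auto
  qed (use a0 sub add in auto)
  have un: "A = (\<Union>g\<in>f ` A. {a \<in> A. f a = g})" (is "_ = ?U") by auto
  have "card ?U = (\<Sum>g\<in>f ` A. card {a \<in> A. f a = g})"
    by (rule card_UN_disjoint) (use fin in auto)
  then have "card A = (\<Sum>g\<in>f ` A. card {a \<in> A. f a = g})" by (simp only: un[symmetric])
  also have "\<dots> = (\<Sum>g\<in>f ` A. card {a \<in> A. f a = 0})" by (rule sum.cong) (use fibre in auto)
  finally show ?thesis by simp
qed

text \<open>
  The map that takes (a, b) to a - b has fibres of size at most the order of the intersection. This count replaces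
  Grassmann's dimension formula for subspaces over K.
\<close>
lemma card_mult_le_Int:
  fixes A B G :: "'v::ab_group_add set"
  assumes fin: "finite A" "finite B" "finite G"
    and A: "\<And>a b. a \<in> A \<Longrightarrow> b \<in> A \<Longrightarrow> a - b \<in> A"
    and B: "\<And>a b. a \<in> B \<Longrightarrow> b \<in> B \<Longrightarrow> a - b \<in> B"
    and G: "\<And>a b. a \<in> A \<Longrightarrow> b \<in> B \<Longrightarrow> a - b \<in> G"
  shows "card A * card B \<le> card G * card (A \<inter> B)"
proof -
  have "card (A \<times> B) \<le> card G * card (A \<inter> B)"
  proof (rule card_le_fibres[where f = "\<lambda>x. fst x - snd x"])
    fix g assume "g \<in> G"
    let ?F = "{x \<in> A \<times> B. fst x - snd x = g}"
    show "card ?F \<le> card (A \<inter> B)"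
    proof (cases "?F = {}")
      case True
      show ?thesis unfolding True by simp
    next
      case False
      then obtain a0 b0 where 0: "a0 \<in> A" "b0 \<in> B" "a0 - b0 = g" by auto
      have inj: "inj_on (\<lambda>x. fst x - a0) ?F" by (auto simp: inj_on_def)
      have "fst x - a0 \<in> A \<inter> B" if "x \<in> ?F" for x
      proof -
        have ab: "fst x \<in> A" "snd x \<in> B" "fst x - snd x = g" using that by auto
        then have "fst x - a0 = snd x - b0" using 0 by (simp add: algebra_simps)
        then show ?thesis using A[OF ab(1) 0(1)] B[OF ab(2) 0(2)] by simp
      qed
      then show ?thesis using fin by (intro card_inj_on_le[OF inj]) auto
    qed
  qed (use fin G in auto)
  then show ?thesis by (simp add: card_cartesian_product)
qed

lemma ksubspace_diff:
  assumes "subfield_set K" "ksubspace K W" "v \<in> W" "w \<in> W"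
  shows "v - w \<in> W"
proof -
  have "- 1 \<in> K" using assms(1) by (auto simp: subfield_set_def)
  then have "(-1) *s w \<in> W" using assms by (auto simp: ksubspace_def)
  then have "v + (-1) *s w \<in> W" using assms by (auto simp: ksubspace_def)
  then show ?thesis by simp
qed

lemma ksubspace_Int: "ksubspace K W \<Longrightarrow> ksubspace K W' \<Longrightarrow> ksubspace K (W \<inter> W')"
  unfolding ksubspace_def by blast

lemma subspace_ksubspace: "vec.subspace X \<Longrightarrow> ksubspace K X"
  by (auto simp: ksubspace_def vec.subspace_0 vec.subspace_add vec.subspace_scale)

lemma ksubspace_sum:
  assumes "ksubspace K W" "finite I" "\<And>i. i \<in> I \<Longrightarrow> g i \<in> W"
  shows "sum g I \<in> W"
  using assms(2,3)
  by (induction I rule: finite_induct) (use assms(1) in \<open>auto simp: ksubspace_def\<close>)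

lemma kcomb_subset:
  assumes "ksubspace K W" "finite B" "B \<subseteq> W"
  shows "kcomb K B \<subseteq> W"
proof
  fix w assume "w \<in> kcomb K B"
  then obtain c where c: "c \<in> B \<rightarrow>\<^sub>E K" "w = (\<Sum>b\<in>B. c b *s b)" unfolding kcomb_def by blast
  have "c b *s b \<in> W" if "b \<in> B" for b
    using assms(1,3) that PiE_mem[OF c(1) that] unfolding ksubspace_def by blast
  then show "w \<in> W" unfolding c(2) using assms by (intro ksubspace_sum)
qed

lemma kcombI:
  assumes "\<And>b. b \<in> B \<Longrightarrow> c b \<in> K"
  shows "(\<Sum>b\<in>B. c b *s b) \<in> kcomb K B"
proof -
  have "(\<Sum>b\<in>B. c b *s b) = (\<Sum>b\<in>B. restrict c B b *s b)" by (rule sum.cong) auto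
  moreover have "restrict c B \<in> B \<rightarrow>\<^sub>E K" using assms by auto
  ultimately show ?thesis unfolding kcomb_def by blast
qed

lemma kcombD: "w \<in> kcomb K B \<Longrightarrow> \<exists>c. (\<forall>b\<in>B. c b \<in> K) \<and> w = (\<Sum>b\<in>B. c b *s b)"
  unfolding kcomb_def by auto

lemma ksubspace_kcomb:
  assumes "subfield_set K"
  shows "ksubspace K (kcomb K B)"
  unfolding ksubspace_def
proof (intro conjI ballI)
  have z: "(\<Sum>b\<in>B. 0 *s b) \<in> kcomb K B"
    by (rule kcombI) (use assms in \<open>auto simp: subfield_set_def\<close>)
  then show "0 \<in> kcomb K B" by simp
next
  fix v w assume "v \<in> kcomb K B" "w \<in> kcomb K B"
  then obtain c d where cd: "\<forall>b\<in>B. c b \<in> K" "v = (\<Sum>b\<in>B. c b *s b)"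
      "\<forall>b\<in>B. d b \<in> K" "w = (\<Sum>b\<in>B. d b *s b)"
    using kcombD[of v K B] kcombD[of w K B] by blast
  have "(\<Sum>b\<in>B. (c b + d b) *s b) \<in> kcomb K B"
    by (rule kcombI) (use assms cd in \<open>auto simp: subfield_set_def\<close>)
  then show "v + w \<in> kcomb K B"
    by (simp add: cd sum.distrib vec.scale_left_distrib)
next
  fix a v assume "a \<in> K" "v \<in> kcomb K B"
  then obtain c where c: "\<forall>b\<in>B. c b \<in> K" "v = (\<Sum>b\<in>B. c b *s b)"
    using kcombD[of v K B] by blast
  have "(\<Sum>b\<in>B. (a * c b) *s b) \<in> kcomb K B"
    by (rule kcombI) (use assms c \<open>a \<in> K\<close> in \<open>auto simp: subfield_set_def\<close>)
  then show "a *s v \<in> kcomb K B"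
    by (simp add: c vec.scale_sum_right)
qed

lemma subset_kcomb:
  assumes "subfield_set K" "finite B"
  shows "B \<subseteq> kcomb K B"
proof
  fix b assume b: "b \<in> B"
  have "(\<Sum>a\<in>B. (if a = b then 1 else 0) *s a) \<in> kcomb K B"
    by (rule kcombI) (use assms in \<open>auto simp: subfield_set_def\<close>)
  moreover have "(\<Sum>a\<in>B. (if a = b then 1 else 0) *s a) = (\<Sum>a\<in>B. if a = b then b else 0)"
    by (rule sum.cong) auto
  ultimately show "b \<in> kcomb K B"
    using b assms by simp
qed

lemma kcomb_UNIV:
  fixes B :: "('a::{field,finite} ^ 'n) set"
  shows "kcomb UNIV B = vec.span B"
proof
  show "kcomb UNIV B \<subseteq> vec.span B"
    by (auto simp: vec.span_finite dest!: kcombD)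
  show "vec.span B \<subseteq> kcomb UNIV B"
    by (auto simp: vec.span_finite intro!: kcombI)
qed

lemma card_kcomb:
  fixes B :: "('a::{field,finite} ^ 'n) set"
  assumes "vec.independent B"
  shows "card (kcomb K B) = card K ^ card B"
proof -
  have "inj_on (\<lambda>c. \<Sum>b\<in>B. c b *s b) (B \<rightarrow>\<^sub>E K)"
  proof (rule inj_onI)
    fix c d assume cd: "c \<in> B \<rightarrow>\<^sub>E K" "d \<in> B \<rightarrow>\<^sub>E K" "(\<Sum>b\<in>B. c b *s b) = (\<Sum>b\<in>B. d b *s b)"
    then have "(\<Sum>b\<in>B. (c b - d b) *s b) = 0"
      by (simp add: vec.scale_left_diff_distrib sum_subtractf)
    then have "\<forall>b\<in>B. c b - d b = 0"
      using vec.independentD[OF assms _ subset_refl, of "\<lambda>b. c b - d b"] by simp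
    then show "c = d" using cd(1,2) by (intro PiE_ext) auto
  qed
  then show ?thesis
    unfolding kcomb_def by (simp add: card_image card_PiE)
qed

lemma card_subspace:
  fixes U :: "('a::{field,finite} ^ 'n) set"
  assumes "vec.subspace U"
  shows "card U = CARD('a) ^ vec.dim U"
proof -
  obtain B where B: "B \<subseteq> U" "vec.independent B" "U \<subseteq> vec.span B" "card B = vec.dim U"
    using vec.basis_exists by blast
  then have "vec.span B = U" using assms vec.span_subspace by blast
  then show ?thesis using card_kcomb[OF B(2), of UNIV] B(4) by (simp add: kcomb_UNIV)
qed

lemma kform_subspace: "kform K W U \<Longrightarrow> vec.subspace U"
  by (auto simp: kform_def)

lemma kform_subset: "kform K W U \<Longrightarrow> W \<subseteq> U"
  by (auto simp: kform_def vec.span_superset intro: vec.span_base)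

lemma kform_kcomb:
  fixes B :: "('a::{field,finite} ^ 'n) set"
  assumes "subfield_set K" "vec.independent B"
  shows "kform K (kcomb K B) (vec.span B)"
  unfolding kform_def
proof (intro conjI)
  show "vec.span (kcomb K B) = vec.span B"
  proof (rule vec.span_subspace)
    show "kcomb K B \<subseteq> vec.span B"
      by (rule kcomb_subset[OF subspace_ksubspace[OF vec.subspace_span]]) (auto intro: vec.span_base)
    show "vec.span B \<subseteq> vec.span (kcomb K B)"
      using subset_kcomb[OF assms(1)] by (intro vec.span_mono) simp
  qed simp
  show "card (kcomb K B) = card K ^ vec.dim (vec.span B)"
    using assms by (simp add: card_kcomb vec.dim_eq_card_independent)
qed (use assms ksubspace_kcomb in auto)

text \<open>
  The K-combinations of a set that is independent over the whole field are distinct, so a basis of U inside W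
  already yields as many elements as W has.
\<close>
lemma kform_eq_kcomb:
  fixes W :: "('a::{field,finite} ^ 'n) set"
  assumes "kform K W U" "B \<subseteq> W" "vec.independent B" "vec.span B = U"
  shows "W = kcomb K B"
proof (rule card_subset_eq[symmetric])
  show "kcomb K B \<subseteq> W" using assms by (intro kcomb_subset) (auto simp: kform_def)
  show "card (kcomb K B) = card W"
    using assms by (auto simp: kform_def card_kcomb vec.dim_eq_card_independent)
qed simp

lemma kform_UNIV:
  fixes U :: "('a::{field,finite} ^ 'n) set"
  shows "vec.subspace U \<Longrightarrow> kform UNIV U U"
  by (auto simp: kform_def subspace_ksubspace card_subspace)

text \<open>
  A basis of the rational vectors in X extends to a rational basis of U; by uniqueness of
  coordinates, a rational vector in X has no coordinate outside the smaller basis.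
\<close>
lemma kform_Int:
  fixes W :: "('a::{field,finite} ^ 'n) set"
  assumes K: "subfield_set K" and W: "kform K W U" and X: "vec.subspace X"
  shows "kform K (W \<inter> X) (vec.span (W \<inter> X))"
proof -
  obtain B0 where B0: "B0 \<subseteq> W \<inter> X" "vec.independent B0" "W \<inter> X \<subseteq> vec.span B0"
    using vec.maximal_independent_subset by blast
  obtain B where B: "B0 \<subseteq> B" "B \<subseteq> W" "vec.independent B" "W \<subseteq> vec.span B"
    using vec.maximal_independent_subset_extend[of B0 W] B0 by blast
  have "vec.span B = vec.span W" using B by (meson vec.span_eq vec.span_superset order_trans)
  then have WB: "W = kcomb K B" using kform_eq_kcomb[OF W B(2,3)] W by (auto simp: kform_def)
  have "W \<inter> X \<subseteq> kcomb K B0"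
  proof
    fix w assume w: "w \<in> W \<inter> X"
    obtain c where c: "\<forall>b\<in>B. c b \<in> K" "w = (\<Sum>b\<in>B. c b *s b)"
      using w WB kcombD[of w K B] by blast
    obtain d where d: "w = (\<Sum>b\<in>B0. d b *s b)"
      using w B0(3) kcomb_UNIV[of B0] kcombD[of w UNIV B0] by blast
    let ?d = "\<lambda>b. if b \<in> B0 then d b else 0"
    have "w = (\<Sum>b\<in>B. ?d b *s b)"
      unfolding d by (rule sum.mono_neutral_cong_left) (use B(1) in auto)
    then have "(\<Sum>b\<in>B. (c b - ?d b) *s b) = 0"
      using c(2) by (simp add: vec.scale_left_diff_distrib sum_subtractf)
    then have cd: "\<forall>b\<in>B. c b - ?d b = 0"
      using vec.independentD[OF B(3) _ subset_refl, of "\<lambda>b. c b - ?d b"] by simp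
    have "w = (\<Sum>b\<in>B0. c b *s b)"
      unfolding d by (rule sum.cong) (use cd B(1) in auto)
    then show "w \<in> kcomb K B0" using c(1) B(1) by (auto intro!: kcombI)
  qed
  moreover have "kcomb K B0 \<subseteq> W \<inter> X"
    using W X B0(1) by (intro kcomb_subset ksubspace_Int) (auto simp: kform_def subspace_ksubspace)
  ultimately have "W \<inter> X = kcomb K B0" by blast
  moreover have "vec.span (W \<inter> X) = vec.span B0"
    using B0 by (meson vec.span_eq vec.span_superset order_trans Int_subset_iff)
  ultimately show ?thesis using kform_kcomb[OF K B0(2)] by simp
qed

lemma proj_pointE:
  assumes "P \<in> proj_points"
  obtains v where "v \<noteq> 0" "P = vec.span {v}"
proof -
  have P: "vec.subspace P" "vec.dim P = 1" using assms by (auto simp: proj_points_def)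
  obtain B where B: "B \<subseteq> P" "vec.independent B" "P \<subseteq> vec.span B" "card B = 1"
    using vec.basis_exists P(2) by metis
  then obtain v where v: "B = {v}" by (meson card_1_singletonE)
  have "P = vec.span {v}" using B v P(1) vec.span_subspace by blast
  moreover have "v \<noteq> 0" using B v by auto
  ultimately show ?thesis using that by blast
qed

lemma proj_point_span: "v \<noteq> 0 \<Longrightarrow> vec.span {v} \<in> proj_points"
  by (simp add: proj_points_def)

lemma proj_point_eq_span:
  assumes "P \<in> proj_points" "v \<in> P" "v \<noteq> 0"
  shows "P = vec.span {v}"
proof (rule vec.subspace_dim_equal[symmetric])
  show "vec.span {v} \<subseteq> P" using assms by (intro vec.span_minimal) (auto simp: proj_points_def)
qed (use assms in \<open>auto simp: proj_points_def\<close>)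

lemma span1_subset_iff: "vec.subspace U \<Longrightarrow> vec.span {v} \<subseteq> U \<longleftrightarrow> v \<in> U"
  by (meson vec.span_base vec.span_minimal singletonI subsetD empty_subsetI insert_subset)

lemma rat_points_subset: "rat_points W \<subseteq> proj_points"
  by (auto simp: rat_points_def proj_points_def)

lemma rat_points_subspace:
  assumes "vec.subspace U" shows "rat_points U = pts U"
proof
  show "rat_points U \<subseteq> pts U"
    using span1_subset_iff[OF assms] proj_point_span unfolding rat_points_def by blast
  show "pts U \<subseteq> rat_points U"
  proof
    fix P assume P: "P \<in> pts U"
    then obtain v where "v \<noteq> 0" "P = vec.span {v}" using proj_pointE by blast
    then show "P \<in> rat_points U" using P span1_subset_iff[OF assms] unfolding rat_points_def by blast
  qed
qed

lemma rat_points_Int: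
  assumes "vec.subspace X"
  shows "rat_points (W \<inter> X) = {P \<in> rat_points W. P \<subseteq> X}"
  unfolding rat_points_def using span1_subset_iff[OF assms] by blast

lemma rat_pointsD:
  assumes "P \<in> rat_points W" obtains w where "w \<in> W" "w \<noteq> 0" "w \<in> P" "P = vec.span {w}"
  using assms vec.span_base[OF singletonI] unfolding rat_points_def by blast

lemma rat_points_ex: "P \<in> rat_points W \<Longrightarrow> \<exists>w\<in>W. w \<noteq> 0 \<and> w \<in> P"
  using vec.span_base[OF singletonI] unfolding rat_points_def by blast

lemma rat_pointsI: "P \<in> proj_points \<Longrightarrow> w \<in> W \<Longrightarrow> w \<noteq> 0 \<Longrightarrow> w \<in> P \<Longrightarrow> P \<in> rat_points W"
  using proj_point_eq_span[of P w] unfolding rat_points_def by blast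

lemma subfield_card_ge_2: "subfield_set K \<Longrightarrow> finite K \<Longrightarrow> 2 \<le> card K"
  using card_mono[of K "{0, 1}"] by (auto simp: subfield_set_def)

text \<open>
  Each rational point contains exactly the K-multiples of one vector of W, because W meets it in a form of dimension one.
\<close>
lemma card_rat_points_mult:
  fixes W :: "('a::{field,finite} ^ 'n) set"
  assumes K: "subfield_set K" and W: "kform K W U"
  shows "card (rat_points W) * (card K - 1) = card K ^ vec.dim U - 1"
proof -
  have fibre: "card (P \<inter> W - {0}) = card K - 1" if P: "P \<in> rat_points W" for P
  proof -
    obtain w where w: "w \<in> W" "w \<noteq> 0" "w \<in> P" "P = vec.span {w}" using rat_pointsD[OF P] .
    have sub: "vec.subspace P" by (subst w(4)) simp
    have "vec.span (W \<inter> P) = P"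
    proof (rule vec.span_subspace)
      show "P \<subseteq> vec.span (W \<inter> P)" by (subst w(4), rule vec.span_mono) (use w(1,3) in blast)
    qed (use sub in auto)
    then have "card (W \<inter> P) = card K ^ vec.dim P"
      using kform_Int[OF K W sub] by (simp add: kform_def)
    moreover have "vec.dim P = 1" by (subst w(4)) (use w(2) in simp)
    moreover have "0 \<in> P \<inter> W" using W sub by (auto simp: kform_def ksubspace_def vec.subspace_0)
    ultimately show ?thesis by (simp add: card_Diff_singleton Int_commute[of W P])
  qed
  have un: "W - {0} = (\<Union>P\<in>rat_points W. P \<inter> W - {0})" (is "_ = ?U")
  proof
    show "W - {0} \<subseteq> ?U"
      using vec.span_base[OF singletonI] unfolding rat_points_def by blast
  qed blast
  have "card ?U = (\<Sum>P\<in>rat_points W. card (P \<inter> W - {0}))"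
  proof (rule card_UN_disjoint)
    show "\<forall>P\<in>rat_points W. \<forall>Q\<in>rat_points W. P \<noteq> Q \<longrightarrow> (P \<inter> W - {0}) \<inter> (Q \<inter> W - {0}) = {}"
    proof (intro ballI impI)
      fix P Q assume PQ: "P \<in> rat_points W" "Q \<in> rat_points W" "P \<noteq> Q"
      then have "P \<in> proj_points" "Q \<in> proj_points" using rat_points_subset[of W] by blast+
      then have "v = 0" if "v \<in> P" "v \<in> Q" for v
        using proj_point_eq_span[of P v] proj_point_eq_span[of Q v] that PQ(3) by blast
      then show "(P \<inter> W - {0}) \<inter> (Q \<inter> W - {0}) = {}" by blast
    qed
  qed simp_all
  also have "\<dots> = card (rat_points W) * (card K - 1)" by (simp add: fibre)
  finally have "card (rat_points W) * (card K - 1) = card (W - {0})" by (simp only: un[symmetric])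
  also have "\<dots> = card W - 1" by (rule card_Diff_singleton) (use W in \<open>simp add: kform_def ksubspace_def\<close>)
  also have "card W = card K ^ vec.dim U" using W by (simp add: kform_def)
  finally show ?thesis .
qed

lemma card_rat_points:
  fixes W :: "('a::{field,finite} ^ 'n) set"
  assumes K: "subfield_set K" and W: "kform K W U"
  shows "vec.dim U = 0 \<Longrightarrow> card (rat_points W) = 0"
    and "vec.dim U = 1 \<Longrightarrow> card (rat_points W) = 1"
    and "vec.dim U = 2 \<Longrightarrow> card (rat_points W) = card K + 1"
    and "vec.dim U = 3 \<Longrightarrow> card (rat_points W) = card K ^ 2 + card K + 1"
    and "vec.dim U = 4 \<Longrightarrow> card (rat_points W) = (card K + 1) * (card K ^ 2 + 1)"
proof -
  obtain n where n: "card K = Suc (Suc n)"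
    using subfield_card_ge_2[OF K] by (metis Suc_le_D numeral_2_eq_2 finite Suc_le_mono)
  have *: "card (rat_points W) * Suc n = Suc (Suc n) ^ vec.dim U - 1"
    using card_rat_points_mult[OF K W] n by simp
  have cancel: "a = b" if "a * Suc n = b * Suc n" for a b :: nat
    using that by (simp only: mult_cancel2) simp
  show "card (rat_points W) = 0" if "vec.dim U = 0"
    by (rule cancel, subst *, subst that) simp
  show "card (rat_points W) = 1" if "vec.dim U = 1"
    by (rule cancel, subst *, subst that) simp
  show "card (rat_points W) = card K + 1" if "vec.dim U = 2"
    by (rule cancel, subst *, subst that) (simp add: n power2_eq_square algebra_simps)
  show "card (rat_points W) = card K ^ 2 + card K + 1" if "vec.dim U = 3"
    by (rule cancel, subst *, subst that) (simp add: n eval_nat_numeral algebra_simps)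
  show "card (rat_points W) = (card K + 1) * (card K ^ 2 + 1)" if "vec.dim U = 4"
    by (rule cancel, subst *, subst that) (simp add: n eval_nat_numeral algebra_simps)
qed

lemma card_pts:
  fixes U :: "('a::{field,finite} ^ 'n) set"
  assumes "vec.subspace U"
  shows "vec.dim U = 2 \<Longrightarrow> card (pts U) = CARD('a) + 1"
    and "vec.dim U = 3 \<Longrightarrow> card (pts U) = CARD('a) ^ 2 + CARD('a) + 1"
    and "vec.dim U = 4 \<Longrightarrow> card (pts U) = (CARD('a) + 1) * (CARD('a) ^ 2 + 1)"
  using card_rat_points[OF subfield_UNIV kform_UNIV[OF assms]] rat_points_subspace[OF assms] by simp_all

text \<open>
  A subspace of codimension c in U has at least \<open>card W / q\<^sup>c\<close> rational
  vectors. Since q is the square of the order of K, each hyperplane condition costs at most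
  two rational dimensions.
\<close>
lemma kform_dim_Int_ge:
  fixes W :: "('a::{field,finite} ^ 'n) set"
  assumes K: "subfield_set K" "(card K)\<^sup>2 = CARD('a)" and W: "kform K W U"
    and X: "vec.subspace X" "X \<subseteq> U"
  shows "2 * vec.dim X \<le> vec.dim U + vec.dim (W \<inter> X)"
proof -
  have sub: "vec.subspace U" using W by (rule kform_subspace)
  have "card W * card X \<le> card U * card (W \<inter> X)"
  proof (rule card_mult_le_Int)
    show "a - b \<in> U" if "a \<in> W" "b \<in> X" for a b
      using that X kform_subset[OF W] sub by (blast intro: vec.subspace_diff)
    show "a - b \<in> W" if "a \<in> W" "b \<in> W" for a b
      using that ksubspace_diff[OF K(1)] W unfolding kform_def by blast
    show "a - b \<in> X" if "a \<in> X" "b \<in> X" for a b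
      using that X(1) by (rule vec.subspace_diff[rotated])
  qed simp_all
  moreover have "card W = card K ^ vec.dim U" using W by (simp add: kform_def)
  moreover have "card X = card K ^ (2 * vec.dim X)" "card U = card K ^ (2 * vec.dim U)"
    using card_subspace[OF X(1)] card_subspace[OF sub] K(2) by (simp_all add: power_mult)
  moreover have "card (W \<inter> X) = card K ^ vec.dim (W \<inter> X)"
    using kform_Int[OF K(1) W X(1)] by (simp add: kform_def)
  ultimately have "card K ^ (vec.dim U + 2 * vec.dim X) \<le> card K ^ (2 * vec.dim U + vec.dim (W \<inter> X))"
    by (simp add: power_add)
  then have "vec.dim U + 2 * vec.dim X \<le> 2 * vec.dim U + vec.dim (W \<inter> X)"
    using subfield_card_ge_2[OF K(1)] by (subst (asm) power_increasing_iff) auto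
  then show ?thesis by simp
qed

text \<open>
  Applied to rational vectors only, the count shows for example that two rational lines of a
  Baer subplane meet in a rational point.
\<close>
lemma kform_grassmann:
  fixes W :: "('a::{field,finite} ^ 'n) set"
  assumes K: "subfield_set K" and W: "kform K W U"
    and X: "vec.subspace X" "vec.subspace Y"
  shows "vec.dim (W \<inter> X) + vec.dim (W \<inter> Y) \<le> vec.dim U + vec.dim (W \<inter> (X \<inter> Y))"
proof -
  have c: "card (W \<inter> X) = card K ^ vec.dim (W \<inter> X)" if "vec.subspace X" for X
    using kform_Int[OF K W that] by (simp add: kform_def)
  have ks: "ksubspace K (W \<inter> X)" if "vec.subspace X" for X
    using kform_Int[OF K W that] by (simp add: kform_def)
  have W': "a - b \<in> W" if "a \<in> W" "b \<in> W" for a b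
    using that ksubspace_diff[OF K] W unfolding kform_def by blast
  have "card (W \<inter> X) * card (W \<inter> Y) \<le> card W * card ((W \<inter> X) \<inter> (W \<inter> Y))"
    by (rule card_mult_le_Int)
      (rule finite | use ksubspace_diff[OF K ks[OF X(1)]] ksubspace_diff[OF K ks[OF X(2)]] W' in blast)+
  moreover have "(W \<inter> X) \<inter> (W \<inter> Y) = W \<inter> (X \<inter> Y)" by blast
  moreover have "card W = card K ^ vec.dim U" using W by (simp add: kform_def)
  ultimately have "card K ^ (vec.dim (W \<inter> X) + vec.dim (W \<inter> Y)) \<le> card K ^ (vec.dim U + vec.dim (W \<inter> (X \<inter> Y)))"
    using c[OF X(1)] c[OF X(2)] c[OF vec.subspace_inter[OF X]] by (simp add: power_add)
  then show ?thesis
    using subfield_card_ge_2[OF K] by (subst (asm) power_increasing_iff) auto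
qed

section \<open>Joins, complements and orthogonal subspaces\<close>

definition join :: "('a::field ^ 'n) set \<Rightarrow> ('a ^ 'n) set \<Rightarrow> ('a ^ 'n) set" where
  "join U Q = vec.span (U \<union> Q)"

lemma subspace_join [simp]: "vec.subspace (join U Q)"
  by (simp add: join_def)

lemma join_upper: "U \<subseteq> join U Q" "Q \<subseteq> join U Q"
  unfolding join_def by (meson vec.span_superset le_sup_iff)+

lemma join_least: "vec.subspace X \<Longrightarrow> U \<subseteq> X \<Longrightarrow> Q \<subseteq> X \<Longrightarrow> join U Q \<subseteq> X"
  unfolding join_def by (intro vec.span_minimal) auto

lemma dim_join:
  assumes "vec.subspace U" "vec.subspace Q"
  shows "vec.dim (join U Q) + vec.dim (U \<inter> Q) = vec.dim U + vec.dim Q"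
proof -
  have "join U Q = {x + y | x y. x \<in> U \<and> y \<in> Q}"
    using assms vec.span_eq_iff[of U] vec.span_eq_iff[of Q] unfolding join_def vec.span_Un by presburger
  then show ?thesis using vec.dim_sums_Int[OF assms] by simp
qed

lemma dim_eq_0_subspace: "vec.subspace U \<Longrightarrow> vec.dim U = 0 \<longleftrightarrow> U = {0}"
  using vec.subspace_0 by (auto simp: vec.dim_eq_0)

lemma subspace_eqI:
  assumes "vec.subspace U" "vec.subspace X" "U \<subseteq> X" "vec.dim X \<le> vec.dim U"
  shows "U = X"
  by (rule vec.subspace_dim_equal[OF assms])

lemma exists_complement:
  assumes "vec.subspace U" "vec.subspace V" "U \<subseteq> V"
  obtains N where "vec.subspace N" "N \<subseteq> V" "U \<inter> N = {0}" "vec.dim U + vec.dim N = vec.dim V"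
proof -
  obtain B0 where B0: "B0 \<subseteq> U" "vec.independent B0" "U \<subseteq> vec.span B0"
    using vec.maximal_independent_subset by blast
  have "B0 \<subseteq> V" using B0(1) assms(3) by blast
  then obtain B where B: "B0 \<subseteq> B" "B \<subseteq> V" "vec.independent B" "V \<subseteq> vec.span B"
    using vec.maximal_independent_subset_extend[of B0 V] B0(2) by blast
  have sU: "vec.span B0 = U" using vec.span_subspace[OF B0(1,3) assms(1)] .
  have sV: "vec.span B = V" using vec.span_subspace[OF B(2,4) assms(2)] .
  have fin: "finite B" using vec.finiteI_independent[OF B(3)] .
  define N where "N = vec.span (B - B0)"
  have N: "vec.subspace N" by (simp add: N_def)
  have ind: "vec.independent (B - B0)" using B(3) by (rule vec.independent_mono) blast
  have "vec.dim U = card B0" using sU vec.dim_span_eq_card_independent[OF B0(2)] by simp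
  moreover have "vec.dim N = card (B - B0)"
    unfolding N_def by (rule vec.dim_span_eq_card_independent[OF ind])
  moreover have "vec.dim V = card B" using sV vec.dim_span_eq_card_independent[OF B(3)] by simp
  moreover have "card B0 \<le> card B" using B(1) fin by (rule card_mono[rotated])
  ultimately have d: "vec.dim U + vec.dim N = vec.dim V"
    using B(1) fin by (simp add: card_Diff_subset finite_subset)
  have NV: "N \<subseteq> V" unfolding N_def using B(2) assms(2) by (intro vec.span_minimal) auto
  have "B \<subseteq> join U N"
    using join_upper(1)[of U N] join_upper(2)[of N U] B0(1) vec.span_superset[of "B - B0"]
    unfolding N_def[symmetric] by blast
  then have "V \<subseteq> join U N" unfolding sV[symmetric] by (intro vec.span_minimal) auto
  then have "vec.dim V \<le> vec.dim (join U N)" by (rule vec.dim_subset)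
  then have "vec.dim (U \<inter> N) = 0" using dim_join[OF assms(1) N] d by linarith
  then have "U \<inter> N = {0}" using dim_eq_0_subspace[OF vec.subspace_inter[OF assms(1) N]] by simp
  then show ?thesis using that N NV d by blast
qed

text \<open>
  For a point P and a plane E these are the lines of the pencil of P in E; for a line
  and the whole space they are the planes through the line.
\<close>
definition covers :: "('a::field ^ 'n) set \<Rightarrow> ('a ^ 'n) set \<Rightarrow> ('a ^ 'n) set set" where
  "covers U V = {X. vec.subspace X \<and> U \<subseteq> X \<and> X \<subseteq> V \<and> vec.dim X = vec.dim U + 1}"

lemma proj_pointsD: "P \<in> proj_points \<Longrightarrow> vec.subspace P" "P \<in> proj_points \<Longrightarrow> vec.dim P = 1"
  by (auto simp: proj_points_def)

text \<open>
  The complement N represents the quotient V / U, so that pencils and stars can be treated as projective spaces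
  of smaller dimension.
\<close>
lemma bij_complement:
  assumes U: "vec.subspace U" and N: "vec.subspace N" and V: "vec.subspace V"
    and UN: "U \<inter> N = {0}" and sub: "U \<subseteq> V" "N \<subseteq> V" and d: "vec.dim U + vec.dim N = vec.dim V"
  shows "bij_betw (join U) (pts N) (covers U V)"
    and "\<And>X. X \<in> covers U V \<Longrightarrow> X \<inter> N \<in> pts N"
    and "\<And>X. X \<in> covers U V \<Longrightarrow> join U (X \<inter> N) = X"
    and "\<And>Q. Q \<in> pts N \<Longrightarrow> join U Q \<inter> N = Q"
proof -
  have dimN: "vec.dim (X \<inter> N) = 1" if X: "X \<in> covers U V" for X
  proof -
    have X': "vec.subspace X" "U \<subseteq> X" "X \<subseteq> V" "vec.dim X = vec.dim U + 1"
      using X by (auto simp: covers_def)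
    have "join U N \<subseteq> join X N"
      using join_upper(1)[of X N] join_upper(2)[of N X] X'(2) by (intro join_least) auto
    then have "vec.dim (join U N) \<le> vec.dim (join X N)" by (rule vec.dim_subset)
    moreover have "vec.dim (join X N) \<le> vec.dim V"
      using X'(3) sub(2) V by (intro vec.dim_subset join_least) auto
    moreover have "vec.dim (U \<inter> N) = 0" using UN by simp
    ultimately show ?thesis
      using dim_join[OF X'(1) N] dim_join[OF U N] X'(4) d by linarith
  qed
  show 1: "X \<inter> N \<in> pts N" if "X \<in> covers U V" for X
    using dimN[OF that] that N by (auto simp: proj_points_def covers_def vec.subspace_inter)
  have dj: "join U Q \<in> covers U V" if Q: "Q \<in> pts N" for Q
  proof -
    have "U \<inter> Q \<subseteq> {0}" using Q UN by blast
    then have "vec.dim (U \<inter> Q) = 0" by simp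
    moreover have "vec.subspace Q" "vec.dim Q = 1" using Q by (auto simp: proj_points_def)
    ultimately have "vec.dim (join U Q) = vec.dim U + 1" using dim_join[OF U, of Q] by linarith
    moreover have "join U Q \<subseteq> V" using Q sub V by (intro join_least) auto
    ultimately show ?thesis using join_upper by (simp add: covers_def)
  qed
  show 2: "join U (X \<inter> N) = X" if X: "X \<in> covers U V" for X
  proof (rule subspace_eqI)
    have X': "vec.subspace X" "U \<subseteq> X" "vec.dim X = vec.dim U + 1" using X by (auto simp: covers_def)
    show "join U (X \<inter> N) \<subseteq> X" using X' by (intro join_least) auto
    show "vec.subspace X" by fact
    show "vec.dim X \<le> vec.dim (join U (X \<inter> N))"
      using dj[OF 1[OF X]] X'(3) by (simp add: covers_def)
  qed simp
  show 3: "join U Q \<inter> N = Q" if Q: "Q \<in> pts N" for Q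
  proof (rule subspace_eqI[symmetric])
    show "Q \<subseteq> join U Q \<inter> N" using Q join_upper by blast
    show "vec.dim (join U Q \<inter> N) \<le> vec.dim Q"
      using dimN[OF dj[OF Q]] Q by (simp add: proj_points_def)
  qed (use Q N in \<open>auto simp: proj_points_def vec.subspace_inter\<close>)
  show "bij_betw (join U) (pts N) (covers U V)"
    by (rule bij_betw_byWitness[where f' = "\<lambda>X. X \<inter> N"]) (use 1 2 3 dj in auto)
qed

lemma card_covers:
  fixes U :: "('a::{field,finite} ^ 'n) set"
  assumes "vec.subspace U" "vec.subspace V" "U \<subseteq> V"
  shows "vec.dim V = vec.dim U + 2 \<Longrightarrow> card (covers U V) = CARD('a) + 1"
    and "vec.dim V = vec.dim U + 3 \<Longrightarrow> card (covers U V) = CARD('a) ^ 2 + CARD('a) + 1"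
proof -
  obtain N where N: "vec.subspace N" "N \<subseteq> V" "U \<inter> N = {0}" "vec.dim U + vec.dim N = vec.dim V"
    using exists_complement[OF assms] .
  have "card (covers U V) = card (pts N)"
    using bij_betw_same_card[OF bij_complement(1)[OF assms(1) N(1) assms(2) N(3) assms(3) N(2,4)]] by simp
  then show "vec.dim V = vec.dim U + 2 \<Longrightarrow> card (covers U V) = CARD('a) + 1"
    and "vec.dim V = vec.dim U + 3 \<Longrightarrow> card (covers U V) = CARD('a) ^ 2 + CARD('a) + 1"
    using card_pts[OF N(1)] N(4) by simp_all
qed

definition dotp :: "'a::field ^ 'n \<Rightarrow> 'a ^ 'n \<Rightarrow> 'a" where
  "dotp u v = (\<Sum>i\<in>UNIV. u $ i * v $ i)"

definition perp :: "('a::field ^ 'n) set \<Rightarrow> ('a ^ 'n) set" where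
  "perp U = {v. \<forall>u\<in>U. dotp u v = 0}"

lemma dotp_commute: "dotp u v = dotp v u"
  by (simp add: dotp_def mult.commute)

lemma dotp_add: "dotp u (v + w) = dotp u v + dotp u w" "dotp (v + w) u = dotp v u + dotp w u"
  by (simp_all add: dotp_def algebra_simps sum.distrib)

lemma dotp_scale: "dotp u (c *s v) = c * dotp u v" "dotp (c *s u) v = c * dotp u v"
  by (simp_all add: dotp_def sum_distrib_left algebra_simps)

lemma dotp_diff: "dotp u (v - w) = dotp u v - dotp u w" "dotp (v - w) u = dotp v u - dotp w u"
  by (simp_all add: dotp_def algebra_simps sum_subtractf)

lemma dotp_0 [simp]: "dotp u 0 = 0" "dotp 0 u = 0"
  by (simp_all add: dotp_def)

lemma dotp_axis: "dotp (axis i 1) v = v $ i"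
proof -
  have "dotp (axis i 1) v = (\<Sum>j\<in>UNIV. if j = i then v $ i else 0)"
    unfolding dotp_def by (rule sum.cong) (auto simp: axis_def)
  then show ?thesis by simp
qed

lemma subspace_perp [simp]: "vec.subspace (perp U)"
  by (auto simp: perp_def vec.subspace_def dotp_add dotp_scale)

lemma perp_mono: "U \<subseteq> X \<Longrightarrow> perp X \<subseteq> perp U"
  by (auto simp: perp_def)

lemma perp_span: "perp (vec.span B) = perp B"
proof
  show "perp B \<subseteq> perp (vec.span B)"
  proof
    fix v assume v: "v \<in> perp B"
    have "vec.subspace {u. dotp u v = 0}" by (auto simp: vec.subspace_def dotp_add dotp_scale)
    then have "vec.span B \<subseteq> {u. dotp u v = 0}"
      using v by (intro vec.span_minimal) (auto simp: perp_def)
    then show "v \<in> perp (vec.span B)" by (auto simp: perp_def)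
  qed
qed (intro perp_mono vec.span_superset)

lemma perp_perp_subset: "U \<subseteq> perp (perp U)"
  by (auto simp: perp_def dotp_commute)

lemma perp_UNIV: "perp UNIV = {0}"
proof -
  have "v = 0" if "\<forall>u. dotp u v = 0" for v :: "'a ^ 'n"
    using that dotp_axis[of _ v] by (simp add: vec_eq_iff)
  then show ?thesis by (auto simp: perp_def)
qed

lemma dim_Int_hyperplane:
  fixes A :: "('a::{field,finite} ^ 'n) set"
  assumes A: "vec.subspace A"
  shows "vec.dim A \<le> vec.dim (A \<inter> perp {b}) + 1"
proof -
  have "card A = card (dotp b ` A) * card {a \<in> A. dotp b a = 0}"
    by (rule card_image_kernel) (use A in \<open>auto simp: dotp_diff vec.subspace_diff\<close>)
  also have "\<dots> \<le> card (UNIV :: 'a set) * card {a \<in> A. dotp b a = 0}"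
    by (intro mult_le_mono card_mono) auto
  finally have "card A \<le> card (UNIV :: 'a set) * card {a \<in> A. dotp b a = 0}" .
  moreover have "{a \<in> A. dotp b a = 0} = A \<inter> perp {b}" by (auto simp: perp_def)
  ultimately have "CARD('a) ^ vec.dim A \<le> CARD('a) ^ (vec.dim (A \<inter> perp {b}) + 1)"
    using card_subspace[OF A] card_subspace[OF vec.subspace_inter[OF A subspace_perp]] by simp
  moreover have "1 < CARD('a)" using subfield_card_ge_2[OF subfield_UNIV] by (metis Suc_1 Suc_le_lessD finite)
  ultimately show ?thesis by (simp only: power_increasing_iff)
qed

text \<open>
  Each linear condition lowers the dimension by at most one, since its values lie in a field with q elements.
\<close>
lemma dim_perp_ge:
  fixes B :: "('a::{field,finite} ^ 'n) set"
  shows "CARD('n) \<le> vec.dim (perp B) + card B"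
proof -
  have "finite B" by simp
  then show ?thesis
  proof (induction B rule: finite_induct)
    case empty
    have "perp {} = (UNIV :: ('a ^ 'n) set)" by (auto simp: perp_def)
    then show ?case by (simp add: card_cart_basis vec.dim_UNIV)
  next
    case (insert b B)
    have "perp (insert b B) = perp B \<inter> perp {b}" by (auto simp: perp_def)
    then show ?case using insert dim_Int_hyperplane[of "perp B" b] by simp
  qed
qed

lemma dim_UNIV_cart: "vec.dim (UNIV :: ('a::field ^ 'n) set) = CARD('n)"
  by (simp add: card_cart_basis vec.dim_UNIV)

text \<open>
  The lower bound holds for U and for a complement N, and the orthogonal spaces of U and N
  meet only in 0, so both bounds are attained.
\<close>
lemma dim_perp:
  fixes U :: "('a::{field,finite} ^ 'n) set"
  assumes U: "vec.subspace U"
  shows "vec.dim U + vec.dim (perp U) = CARD('n)"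
proof -
  have ge: "CARD('n) \<le> vec.dim U + vec.dim (perp U)" if U: "vec.subspace U" for U :: "('a ^ 'n) set"
  proof -
    obtain B where B: "B \<subseteq> U" "vec.independent B" "U \<subseteq> vec.span B" "card B = vec.dim U"
      using vec.basis_exists by blast
    have "perp U = perp B" by (subst vec.span_subspace[OF B(1,3) U, symmetric]) (rule perp_span)
    then show ?thesis using dim_perp_ge[of B] B(4) by simp
  qed
  obtain N where N0: "vec.subspace N" "N \<subseteq> UNIV" "U \<inter> N = {0}"
      "vec.dim U + vec.dim N = vec.dim (UNIV :: ('a ^ 'n) set)"
    using exists_complement[OF U vec.subspace_UNIV subset_UNIV] .
  then have N: "vec.subspace N" "U \<inter> N = {0}" "vec.dim U + vec.dim N = CARD('n)"
    using dim_UNIV_cart[where 'n = 'n and 'a = 'a] by simp_all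
  have "perp U \<inter> perp N \<subseteq> perp (U \<union> N)" by (auto simp: perp_def)
  also have "\<dots> = perp (join U N)" by (simp add: join_def perp_span)
  also have "join U N = UNIV"
  proof (rule subspace_eqI)
    show "vec.dim (UNIV :: ('a ^ 'n) set) \<le> vec.dim (join U N)"
      using dim_join[OF U N(1)] N(2,3) by (simp add: card_cart_basis)
  qed auto
  finally have "perp U \<inter> perp N \<subseteq> {0}" by (simp only: perp_UNIV)
  then have "vec.dim (perp U \<inter> perp N) = 0" by simp
  then have "vec.dim (perp U) + vec.dim (perp N) \<le> CARD('n)"
    using dim_join[of "perp U" "perp N"] vec.dim_subset[OF subset_UNIV, of "join (perp U) (perp N)"]
    unfolding dim_UNIV_cart by (simp del: vec.dim_eq_0)
  then show ?thesis using ge[OF U] ge[OF N(1)] N(3) by linarith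
qed

lemma perp_perp:
  fixes U :: "('a::{field,finite} ^ 'n) set"
  assumes U: "vec.subspace U"
  shows "perp (perp U) = U"
proof (rule subspace_eqI[symmetric])
  show "vec.dim (perp (perp U)) \<le> vec.dim U"
    using dim_perp[OF U] dim_perp[OF subspace_perp[of U]] by simp
qed (use U perp_perp_subset in auto)

lemma perp_subset_iff:
  fixes U :: "('a::{field,finite} ^ 'n) set"
  assumes "vec.subspace U" "vec.subspace X"
  shows "perp U \<subseteq> perp X \<longleftrightarrow> X \<subseteq> U"
  using perp_mono[of X U] perp_mono[of "perp U" "perp X"]
  unfolding perp_perp[OF assms(1)] perp_perp[OF assms(2)] by blast

lemma inj_on_perp: "inj_on perp {U :: ('a::{field,finite} ^ 'n) set. vec.subspace U}"
  by (rule inj_on_inverseI[where g = perp]) (simp add: perp_perp)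


section \<open>Rigidity of rational points\<close>

lemma subfield_power_card:
  fixes K :: "'a::{field,finite} set"
  assumes K: "subfield_set K" and a: "a \<in> K"
  shows "a ^ card K = a"
proof (cases "a = 0")
  case True
  then show ?thesis using subfield_card_ge_2[OF K] by simp
next
  case False
  let ?G = "K - {0}"
  have "(\<Prod>x\<in>?G. x) = (\<Prod>x\<in>?G. a * x)"
  proof (rule prod.reindex_bij_witness[where i = "\<lambda>x. a * x" and j = "\<lambda>x. inverse a * x"])
    fix x assume "x \<in> ?G"
    then show "inverse a * x \<in> ?G" "a * x \<in> ?G"
      using K a False by (auto simp: subfield_set_def)
  qed (use False in auto)
  also have "\<dots> = a ^ card ?G * (\<Prod>x\<in>?G. x)" by (simp add: prod.distrib)
  finally have "a ^ card ?G = 1" by simp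
  moreover have "card K = Suc (card ?G)"
    using K by (intro card.remove) (auto simp: subfield_set_def)
  ultimately show ?thesis by (metis power_Suc mult.right_neutral)
qed

text \<open>
  Both subfields are the set of roots of the polynomial \<open>X\<^sup>s - X\<close>, where s is the order. So all
  Baer subgeometries can be described over the same K.
\<close>
lemma subfield_unique:
  fixes K K' :: "'a::{field,finite} set"
  assumes K: "subfield_set K" "subfield_set K'" and c: "card K = card K'"
  shows "K = K'"
proof -
  let ?p = "monom 1 (card K) - monom 1 1 :: 'a poly"
  have s: "2 \<le> card K" using subfield_card_ge_2[OF K(1)] by simp
  have "coeff ?p (card K) = 1" using s by simp
  then have p: "?p \<noteq> 0" by (metis coeff_0 zero_neq_one)
  have "degree ?p \<le> card K"
    using s by (intro degree_diff_le order_trans[OF degree_monom_le]) auto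
  then have bound: "card {x. poly ?p x = 0} \<le> card K"
    using card_poly_roots_bound[OF p] by (rule le_trans[rotated])
  have "K = {x. poly ?p x = 0}"
    by (rule card_seteq) (use bound subfield_power_card[OF K(1)] in \<open>auto simp: poly_monom\<close>)
  moreover have "K' = {x. poly ?p x = 0}"
    by (rule card_seteq) (use bound subfield_power_card[OF K(2)] c in \<open>auto simp: poly_monom\<close>)
  ultimately show ?thesis by simp
qed

lemma indep2:
  assumes "v \<noteq> 0" "w \<notin> vec.span {v}"
  shows "vec.independent {w, v}" "w \<noteq> v"
  using assms vec.span_base[of v "{v}"] vec.independent_insertI[of w "{v}"] by auto

lemma ksubspace_scale_image: "ksubspace K W \<Longrightarrow> ksubspace K ((*s) c ` W)"
proof -
  assume W: "ksubspace K W"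
  have "c *s u + c *s v \<in> (*s) c ` W" if "u \<in> W" "v \<in> W" for u v
    using W that unfolding vec.scale_right_distrib[symmetric] ksubspace_def by blast
  moreover have "a *s (c *s v) \<in> (*s) c ` W" if "a \<in> K" "v \<in> W" for a v
    using W that unfolding vec.scale_left_commute[of a c] ksubspace_def by blast
  moreover have "0 \<in> (*s) c ` W"
    using W unfolding ksubspace_def by (intro image_eqI[where x = 0]) auto
  ultimately show ?thesis unfolding ksubspace_def by blast
qed

lemma rat_points_scale:
  fixes W :: "('a::field ^ 'n) set"
  assumes "c \<noteq> 0"
  shows "rat_points ((*s) c ` W) = rat_points W"
proof -
  have *: "vec.span {c *s w} = vec.span {w}" for w :: "'a ^ 'n"
    using vec.span_image_scale[of "{w}" "\<lambda>_. c"] assms by simp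
  have "rat_points W = {vec.span {c *s w} | w. w \<in> W \<and> c *s w \<noteq> 0}"
    unfolding * rat_points_def using assms by simp
  then show ?thesis unfolding rat_points_def by blast
qed

lemma kform_scale:
  fixes W :: "('a::{field,finite} ^ 'n) set"
  assumes W: "kform K W U" and c: "c \<noteq> 0"
  shows "kform K ((*s) c ` W) U"
  unfolding kform_def
proof (intro conjI)
  show "ksubspace K ((*s) c ` W)" using W by (auto simp: kform_def ksubspace_scale_image)
  have "vec.span ((*s) c ` W) = vec.span W"
    using vec.span_image_scale[of W "\<lambda>_. c"] c by simp
  then show "vec.span ((*s) c ` W) = U" using W by (simp add: kform_def)
  have "inj_on ((*s) c) W" using c by (auto simp: inj_on_def)
  then show "card ((*s) c ` W) = card K ^ vec.dim U" using W by (simp add: kform_def card_image)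
qed

lemma kform_line_normalise:
  fixes W :: "('a::{field,finite} ^ 'n) set"
  assumes K: "subfield_set K" and W: "kform K W l" and l: "vec.dim l = 2"
    and P: "P1 \<in> rat_points W" "P2 \<in> rat_points W" "P3 \<in> rat_points W" "P1 \<noteq> P2" "P1 \<noteq> P3" "P2 \<noteq> P3"
  obtains u v where "u \<in> W" "v \<in> W" "u \<noteq> 0" "v \<noteq> 0" "u \<in> P1" "v \<in> P2" "u + v \<in> P3"
proof -
  obtain a b c where abc: "a \<in> W" "a \<noteq> 0" "a \<in> P1" "b \<in> W" "b \<noteq> 0" "b \<in> P2" "c \<in> W" "c \<noteq> 0" "c \<in> P3"
    using rat_points_ex[OF P(1)] rat_points_ex[OF P(2)] rat_points_ex[OF P(3)] by blast
  have pp: "P1 \<in> proj_points" "P2 \<in> proj_points" "P3 \<in> proj_points" using P rat_points_subset by blast+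
  then have sp: "P1 = vec.span {a}" "P2 = vec.span {b}" "P3 = vec.span {c}"
    using proj_point_eq_span abc by blast+
  have "a \<notin> vec.span {b}" using proj_point_eq_span[OF pp(2), of a] abc(2) sp P(4) by blast
  then have ind: "vec.independent {a, b}" "a \<noteq> b" using indep2[OF abc(5)] by auto
  have "vec.span {a, b} = l"
  proof (rule subspace_eqI)
    show "vec.subspace l" using W by (rule kform_subspace)
    then show "vec.span {a, b} \<subseteq> l" using kform_subset[OF W] abc by (intro vec.span_minimal) auto
    show "vec.dim l \<le> vec.dim (vec.span {a, b})"
      using l vec.dim_eq_card_independent[OF ind(1)] ind(2) by simp
  qed simp
  then have "W = kcomb K {a, b}" using kform_eq_kcomb[OF W _ ind(1)] abc by blast
  then obtain f where f: "\<forall>x\<in>{a, b}. f x \<in> K" "c = (\<Sum>x\<in>{a, b}. f x *s x)"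
    using abc(7) kcombD[of c K "{a, b}"] by blast
  have ks: "ksubspace K W" using W by (simp add: kform_def)
  let ?u = "f a *s a" and ?v = "f b *s b"
  have c: "c = ?u + ?v" using f(2) ind(2) by simp
  have uP: "?u \<in> P1" "?v \<in> P2" by (simp_all add: sp vec.span_base vec.span_scale)
  have "?u \<noteq> 0" using c uP(2) abc(8) pp(2) sp(3) P(6) proj_point_eq_span[of P2 c] by auto
  moreover have "?v \<noteq> 0" using c uP(1) abc(8) pp(1) sp(3) P(5) proj_point_eq_span[of P1 c] by auto
  moreover have "?u \<in> W" "?v \<in> W" using f(1) ks abc unfolding ksubspace_def by auto
  ultimately show ?thesis using that[of ?u ?v] uP c abc(9) by simp
qed

text \<open>
  After scaling, the first two points are spanned by rational vectors u, v and the third by u + v.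
  A second form does the same with multiples of u and v, and the third point forces
  the two multiples to be equal.
\<close>
lemma kform_line_rigid:
  fixes W W' :: "('a::{field,finite} ^ 'n) set"
  assumes K: "subfield_set K" and W: "kform K W l" and W': "kform K W' l" and l: "vec.dim l = 2"
    and P: "{P1, P2, P3} \<subseteq> rat_points W \<inter> rat_points W'" "P1 \<noteq> P2" "P1 \<noteq> P3" "P2 \<noteq> P3"
  obtains c where "c \<noteq> 0" "W' = (*s) c ` W"
proof -
  obtain u v where uv: "u \<in> W" "v \<in> W" "u \<noteq> 0" "v \<noteq> 0" "u \<in> P1" "v \<in> P2" "u + v \<in> P3"
    using kform_line_normalise[OF K W l, of P1 P2 P3] P by auto
  obtain u' v' where uv': "u' \<in> W'" "v' \<in> W'" "u' \<noteq> 0" "v' \<noteq> 0" "u' \<in> P1" "v' \<in> P2" "u' + v' \<in> P3"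
    using kform_line_normalise[OF K W' l, of P1 P2 P3] P by auto
  have pp: "P1 \<in> proj_points" "P2 \<in> proj_points" "P3 \<in> proj_points" using P rat_points_subset by blast+
  have sp: "P1 = vec.span {u}" "P2 = vec.span {v}"
    using proj_point_eq_span pp uv by blast+
  have unv: "u \<notin> vec.span {v}" using proj_point_eq_span[OF pp(2), of u] uv(3) sp P(2) by blast
  have ind: "vec.independent {u, v}" "u \<noteq> v" using indep2[OF uv(4) unv] by auto
  have "u \<noteq> - v"
    using unv vec.span_neg[OF vec.span_base[of v "{v}"]] by auto
  then have "u + v \<noteq> 0" by (simp add: eq_neg_iff_add_eq_0)
  then have sp3: "P3 = vec.span {u + v}" using proj_point_eq_span pp uv by blast
  obtain a b c where abc: "u' = a *s u" "v' = b *s v" "u' + v' = c *s (u + v)"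
    using uv'(5,6,7) sp sp3 by (auto simp: vec.span_singleton)
  then have "(a - c) *s u + (b - c) *s v = 0" by (simp add: algebra_simps vec.scale_right_distrib vec.scale_left_diff_distrib)
  then have "(\<Sum>x\<in>{u, v}. (if x = u then a - c else b - c) *s x) = 0" using ind(2) by simp
  then have "\<forall>x\<in>{u, v}. (if x = u then a - c else b - c) = 0"
    using vec.independentD[OF ind(1) _ subset_refl, of "\<lambda>x. if x = u then a - c else b - c"] by blast
  then have ac: "a = c" "b = c" using ind(2) by auto
  have c0: "c \<noteq> 0" using uv'(3) abc(1) ac by auto
  have "vec.span {v'} = vec.span {v}" using vec.span_image_scale[of "{v}" "\<lambda>_. c"] c0 abc ac by simp
  moreover have "u \<in> vec.span {v}" if "u' \<in> vec.span {v}"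
    using vec.span_scale[OF that, of "inverse c"] c0 abc ac by simp
  ultimately have unv': "u' \<notin> vec.span {v'}" using unv by blast
  then have ind': "vec.independent {u', v'}" "u' \<noteq> v'" using indep2[OF uv'(4)] by auto
  have sl: "vec.span {u', v'} = l"
  proof (rule subspace_eqI)
    show "vec.subspace l" using W by (rule kform_subspace)
    then show "vec.span {u', v'} \<subseteq> l" using kform_subset[OF W'] uv' by (intro vec.span_minimal) auto
    show "vec.dim l \<le> vec.dim (vec.span {u', v'})"
      using l vec.dim_eq_card_independent[OF ind'(1)] ind'(2) by simp
  qed simp
  have "W' = kcomb K {u', v'}" by (rule kform_eq_kcomb[OF W' _ ind'(1) sl]) (use uv' in auto)
  also have "\<dots> \<subseteq> (*s) c ` W"
    by (rule kcomb_subset) (use W uv abc ac in \<open>auto simp: kform_def ksubspace_scale_image\<close>)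
  finally have "W' \<subseteq> (*s) c ` W" .
  moreover have "card ((*s) c ` W) = card W'"
    using kform_scale[OF W c0] W' by (simp add: kform_def)
  ultimately have "W' = (*s) c ` W" by (intro card_subset_eq) auto
  then show ?thesis using that c0 by blast
qed

section \<open>Baer subgeometries as rational points\<close>

abbreviation rat_vectors :: "'a::field set \<Rightarrow> ('a ^ 'n) set" where
  "rat_vectors K \<equiv> {v. \<forall>i. v $ i \<in> K}"

lemma points_over_eq: "points_over K = rat_points (rat_vectors K)"
  unfolding points_over_def rat_points_def by auto

lemma card_rat_vectors: "card (rat_vectors K :: ('a::{field,finite} ^ 'n) set) = card K ^ CARD('n)"
proof -
  have "rat_vectors K = vec_lambda ` (UNIV \<rightarrow>\<^sub>E K :: ('n \<Rightarrow> 'a) set)"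
  proof
    show "rat_vectors K \<subseteq> vec_lambda ` (UNIV \<rightarrow>\<^sub>E K :: ('n \<Rightarrow> 'a) set)"
    proof
      fix v :: "'a ^ 'n" assume "v \<in> rat_vectors K"
      then have "vec_nth v \<in> UNIV \<rightarrow>\<^sub>E K" "v = vec_lambda (vec_nth v)" by auto
      then show "v \<in> vec_lambda ` (UNIV \<rightarrow>\<^sub>E K)" by blast
    qed
  qed auto
  moreover have "inj_on vec_lambda (UNIV \<rightarrow>\<^sub>E K :: ('n \<Rightarrow> 'a) set)"
    by (rule inj_onI) (metis UNIV_I vec_lambda_inject)
  ultimately show ?thesis by (simp add: card_image card_PiE)
qed

lemma kform_rat_vectors:
  assumes K: "subfield_set K"
  shows "kform K (rat_vectors K) (UNIV :: ('a::{field,finite} ^ 'n) set)"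
  unfolding kform_def
proof (intro conjI)
  show "ksubspace K (rat_vectors K :: ('a ^ 'n) set)"
    using K by (auto simp: ksubspace_def subfield_set_def)
  have "cart_basis \<subseteq> (rat_vectors K :: ('a ^ 'n) set)"
    using K by (auto simp: cart_basis_def axis_def subfield_set_def)
  then show "vec.span (rat_vectors K) = (UNIV :: ('a ^ 'n) set)"
    using vec.span_mono span_cart_basis by blast
  show "card (rat_vectors K :: ('a ^ 'n) set) = card K ^ vec.dim (UNIV :: ('a ^ 'n) set)"
    unfolding dim_UNIV_cart by (rule card_rat_vectors)
qed

context
  fixes M :: "'a::{field,finite} ^ 'm ^ 'n"
  assumes inj: "inj ((*v) M)"
begin

lemma subspace_matrix_image: "vec.subspace U \<Longrightarrow> vec.subspace ((*v) M ` U)"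
  by (rule vec.subspace_image)

lemma dim_matrix_image: "vec.dim ((*v) M ` U) = vec.dim U"
  by (rule vec.dim_image_eq) (use inj in \<open>auto intro: matrix_vector_mul_linear_gen inj_on_subset\<close>)

lemma kform_matrix_image:
  assumes W: "kform K W U"
  shows "kform K ((*v) M ` W) ((*v) M ` U)"
  unfolding kform_def
proof (intro conjI)
  have ks: "ksubspace K W" using W by (simp add: kform_def)
  show "ksubspace K ((*v) M ` W)"
    unfolding ksubspace_def
  proof (intro conjI ballI)
    show "0 \<in> (*v) M ` W"
      using ks vec.zero unfolding ksubspace_def by (intro image_eqI[where x = 0]) auto
  next
    fix u v assume "u \<in> (*v) M ` W" "v \<in> (*v) M ` W"
    then show "u + v \<in> (*v) M ` W"
      using ks unfolding ksubspace_def by (auto simp: vec.add[symmetric])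
  next
    fix c u assume "c \<in> K" "u \<in> (*v) M ` W"
    then show "c *s u \<in> (*v) M ` W"
      using ks unfolding ksubspace_def by (auto simp: vec.scale[symmetric])
  qed
  show "vec.span ((*v) M ` W) = (*v) M ` U"
    using W by (simp add: kform_def vec.span_image)
  have "card ((*v) M ` W) = card W" using inj by (meson card_image inj_on_subset subset_UNIV)
  then show "card ((*v) M ` W) = card K ^ vec.dim ((*v) M ` U)"
    using W by (simp only: dim_matrix_image kform_def)
qed

lemma rat_points_matrix_image: "rat_points ((*v) M ` W) = (\<lambda>P. (*v) M ` P) ` rat_points W"
proof -
  have sp: "(*v) M ` vec.span {w} = vec.span {M *v w}" for w
    using vec.span_image[of M "{w}"] by simp
  have nz: "M *v w = 0 \<longleftrightarrow> w = 0" for w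
    using inj vec.zero by (metis injD)
  show ?thesis unfolding rat_points_def using sp nz by (auto simp: image_iff) blast+
qed

end

text \<open>
  The columns of the matrix are a rational basis of U, so coordinates identify W with the vectors over K.
\<close>
lemma kform_matrix:
  fixes W :: "('a::{field,finite} ^ 'n) set"
  assumes K: "subfield_set K" and W: "kform K W U" and d: "vec.dim U = CARD('m::finite)"
  obtains M :: "'a ^ 'm ^ 'n" where "inj ((*v) M)" "range ((*v) M) = U" "(*v) M ` rat_vectors K = W"
proof -
  obtain B where B: "B \<subseteq> W" "vec.independent B" "W \<subseteq> vec.span B"
    using vec.maximal_independent_subset by blast
  have "vec.span B = vec.span W"
    using vec.span_mono[of B W] vec.span_minimal[of W "vec.span B"] B by blast
  then have sB: "vec.span B = U" using W by (simp add: kform_def)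
  then have cB: "card B = CARD('m)" using vec.dim_span_eq_card_independent[OF B(2)] d by simp
  obtain h where h: "bij_betw h (UNIV :: 'm set) B"
    using cB finite_same_card_bij[of "UNIV :: 'm set" B] by auto
  define M :: "'a ^ 'm ^ 'n" where "M = (\<chi> i j. h j $ i)"
  have Mv: "M *v v = (\<Sum>j\<in>UNIV. v $ j *s h j)" for v
    by (simp add: M_def matrix_vector_mult_def vec_eq_iff mult.commute)
  define g where "g = inv_into UNIV h"
  have hg: "h (g b) = b" if "b \<in> B" for b
    using that h unfolding g_def by (metis bij_betw_inv_into_right)
  have gh: "g (h j) = j" for j
    using h unfolding g_def by (metis bij_betw_inv_into_left UNIV_I)
  have Mv': "M *v v = (\<Sum>b\<in>B. v $ g b *s b)" for v
    unfolding Mv by (rule sum.reindex_bij_witness[where i = g and j = h])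
      (use h hg gh in \<open>auto simp: bij_betw_def\<close>)
  have inj: "inj ((*v) M)"
  proof (rule injI)
    fix u v assume "M *v u = M *v v"
    then have "(\<Sum>b\<in>B. (u $ g b - v $ g b) *s b) = 0"
      unfolding Mv' by (simp add: vec.scale_left_diff_distrib sum_subtractf)
    then have "\<forall>b\<in>B. u $ g b - v $ g b = 0"
      using vec.independentD[OF B(2) _ subset_refl, of "\<lambda>b. u $ g b - v $ g b"] by simp
    moreover have "h j \<in> B" for j using h by (auto simp: bij_betw_def)
    ultimately have "u $ g (h j) - v $ g (h j) = 0" for j by blast
    then have "u $ j = v $ j" for j unfolding gh by simp
    then show "u = v" by (simp add: vec_eq_iff)
  qed
  have img: "(*v) M ` rat_vectors K = W"
  proof (rule card_subset_eq)
    have "\<forall>v\<in>rat_vectors K. M *v v \<in> kcomb K B"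
      unfolding Mv' by (auto intro!: kcombI)
    moreover have "W = kcomb K B" by (rule kform_eq_kcomb[OF W B(1,2) sB])
    ultimately show "(*v) M ` rat_vectors K \<subseteq> W" by blast
    have "card ((*v) M ` rat_vectors K) = card (rat_vectors K :: ('a ^ 'm) set)"
      using inj by (meson card_image inj_on_subset subset_UNIV)
    then show "card ((*v) M ` rat_vectors K) = card W"
      using W d by (simp only: card_rat_vectors kform_def)
  qed simp
  have "range ((*v) M) = U"
    using kform_matrix_image[OF inj kform_rat_vectors[OF K]] W unfolding img kform_def by simp
  then show ?thesis using that inj img by blast
qed

lemma baer_subgeometryD:
  fixes S :: "('a::{field,finite} ^ 'n) set set"
  assumes "baer_subgeometry S"
  obtains K W where "subfield_set K" "(card K)\<^sup>2 = CARD('a)" "kform K W UNIV" "S = rat_points W"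
proof -
  obtain K M where K: "subfield_set K" "(card K)\<^sup>2 = CARD('a)" and M: "invertible (M :: 'a ^ 'n ^ 'n)"
    and S: "S = (\<lambda>P. (*v) M ` P) ` points_over K"
    using assms unfolding baer_subgeometry_def by blast
  have inj: "inj ((*v) M)" using M by (simp add: inj_matrix_vector_mult)
  have "kform K ((*v) M ` rat_vectors K) ((*v) M ` UNIV)"
    by (rule kform_matrix_image[OF inj kform_rat_vectors[OF K(1)]])
  moreover have "(*v) M ` UNIV = UNIV"
    using M inj by (intro subspace_eqI) (auto simp: dim_matrix_image subspace_matrix_image)
  ultimately show ?thesis
    using that K rat_points_matrix_image[OF inj] S unfolding points_over_eq by metis
qed

lemma baer_subgeometryI:
  fixes W :: "('a::{field,finite} ^ 'n) set"
  assumes K: "subfield_set K" "(card K)\<^sup>2 = CARD('a)" and W: "kform K W UNIV"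
  shows "baer_subgeometry (rat_points W)"
proof -
  obtain M :: "'a ^ 'n ^ 'n" where M: "inj ((*v) M)" "(*v) M ` rat_vectors K = W"
    using kform_matrix[OF K(1) W dim_UNIV_cart] by metis
  have "invertible M"
    using M(1) by (simp add: invertible_left_inverse matrix_left_invertible_injective)
  moreover have "rat_points W = (\<lambda>P. (*v) M ` P) ` points_over K"
    unfolding points_over_eq M(2)[symmetric] by (rule rat_points_matrix_image[OF M(1)])
  ultimately show ?thesis using K unfolding baer_subgeometry_def by blast
qed

lemma baer_subplane_ofD:
  fixes S :: "('a::{field,finite} ^ 'n) set set"
  assumes "baer_subplane_of E S"
  obtains K W where "subfield_set K" "(card K)\<^sup>2 = CARD('a)" "kform K W E" "S = rat_points W"
proof -
  obtain M :: "'a ^ 3 ^ 'n" and S0 where M: "inj ((*v) M)" "range ((*v) M) = E"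
    and S0: "baer_subgeometry S0" "S = (\<lambda>P. (*v) M ` P) ` S0"
    using assms unfolding baer_subplane_of_def by blast
  obtain K W0 where K: "subfield_set K" "(card K)\<^sup>2 = CARD('a)" "kform K W0 UNIV" "S0 = rat_points W0"
    using baer_subgeometryD[OF S0(1)] .
  have "kform K ((*v) M ` W0) E" using kform_matrix_image[OF M(1) K(3)] M(2) by simp
  moreover have "S = rat_points ((*v) M ` W0)" using rat_points_matrix_image[OF M(1)] S0(2) K(4) by simp
  ultimately show ?thesis using that K by blast
qed

lemma baer_subplane_ofI:
  fixes W :: "('a::{field,finite} ^ 'n) set"
  assumes K: "subfield_set K" "(card K)\<^sup>2 = CARD('a)" and W: "kform K W E" and d: "vec.dim E = 3"
  shows "baer_subplane_of E (rat_points W)"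
proof -
  have "vec.dim E = CARD(3)" using d by simp
  from kform_matrix[OF K(1) W this]
  obtain M :: "'a ^ 3 ^ 'n" where M: "inj ((*v) M)" "range ((*v) M) = E" "(*v) M ` rat_vectors K = W" .
  have "baer_subgeometry (rat_points (rat_vectors K :: ('a ^ 3) set))"
    by (rule baer_subgeometryI[OF K kform_rat_vectors[OF K(1)]])
  moreover have "rat_points W = (\<lambda>P. (*v) M ` P) ` rat_points (rat_vectors K)"
    unfolding M(3)[symmetric] by (rule rat_points_matrix_image[OF M(1)])
  ultimately show ?thesis using M unfolding baer_subplane_of_def by blast
qed

lemma dim_Int_less:
  assumes "vec.subspace U" "vec.subspace X" "\<not> U \<subseteq> X"
  shows "vec.dim (U \<inter> X) < vec.dim U"
proof (rule ccontr)
  assume "\<not> vec.dim (U \<inter> X) < vec.dim U"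
  then have "U \<inter> X = U" using assms by (intro subspace_eqI vec.subspace_inter) auto
  then show False using assms(3) by blast
qed

section \<open>Small blocking sets\<close>

lemma card_rat_points_le:
  fixes W :: "('a::{field,finite} ^ 'n) set"
  assumes K: "subfield_set K" and W: "kform K W U" and d: "vec.dim U \<le> 2"
  shows "card (rat_points W) \<le> card K + 1"
  using card_rat_points[OF K W] d by (cases "vec.dim U = 0 \<or> vec.dim U = 1") (auto simp del: vec.dim_eq_0)

text \<open>
  The set consists of two lines, each without one point, and one further point on the line
  joining the two deleted points. A line that misses the first two parts contains both deleted points, hence
  the third. A Baer subplane has at most 2s + 1 points on the two lines, because it contains
  their common point if it has s + 1 points on each; so it would have at most 2s + 2 points in
  the set, fewer than \<open>s\<^sup>2 + s + 1\<close>.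
\<close>
lemma exists_small_blocking_set:
  assumes "CARD('a::{field,finite}) = r\<^sup>2"
  shows "\<exists>B :: ('a ^ 3) set set. nontrivial_blocking_set B \<and> \<not> contains_baer_subplane B \<and>
           card B \<le> 2 * CARD('a) + 1"
proof -
  have "2 \<le> CARD('a)" using subfield_card_ge_2[OF subfield_UNIV[where 'a = 'a]] by simp
  have "r \<noteq> 0" "r \<noteq> 1" using \<open>2 \<le> CARD('a)\<close> assms by (auto intro: ccontr)
  then have "2 \<le> r" by linarith
  then have q4: "4 \<le> CARD('a)" unfolding assms using power_mono[of 2 r 2] by simp
  define a :: "'a ^ 3" where "a = axis 1 1"
  define b :: "'a ^ 3" where "b = axis 2 1"
  have a0: "a \<noteq> 0" "b \<noteq> 0" "a + b \<noteq> 0"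
    by (auto simp: a_def b_def vec_eq_iff axis_def intro!: exI[of _ 1] exI[of _ 2])
  define X where "X = perp {a}"
  define Y where "Y = perp {b}"
  have subs: "vec.subspace X" "vec.subspace Y" by (simp_all add: X_def Y_def)
  have dims: "vec.dim X = 2" "vec.dim Y = 2"
    using dim_perp[of "vec.span {a}"] dim_perp[of "vec.span {b}"] a0 by (simp_all add: perp_span X_def Y_def)
  have mem: "v \<in> X \<longleftrightarrow> v $ 1 = 0" "v \<in> Y \<longleftrightarrow> v $ 2 = 0" for v
    by (auto simp: X_def Y_def perp_def a_def b_def dotp_axis)
  have ab: "a \<notin> X" "b \<in> X" "a \<in> Y" "b \<notin> Y" "a + b \<notin> X" "a + b \<notin> Y"
    by (simp_all add: mem a_def b_def axis_def)
  let ?P = "vec.span {b}" and ?R = "vec.span {a}" and ?T = "vec.span {a + b}"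
  have pts: "?P \<in> proj_points" "?R \<in> proj_points" "?T \<in> proj_points" using a0 by (simp_all add: proj_point_span)
  have inl: "?P \<subseteq> X" "?R \<subseteq> Y" "\<not> ?R \<subseteq> X" "\<not> ?P \<subseteq> Y"
    using ab by (simp_all only: span1_subset_iff[OF subs(1)] span1_subset_iff[OF subs(2)] not_False_eq_True)
  define B where "B = (pts X - {?P}) \<union> (pts Y - {?R}) \<union> {?T}"
  have PB: "?P \<notin> B"
  proof -
    have "?P \<noteq> ?T" using ab(2,5) span1_subset_iff[OF subs(1)] by blast
    then show ?thesis using inl(4) by (auto simp: B_def)
  qed
  have RB: "?R \<notin> B"
  proof -
    have "?R \<noteq> ?T" using ab(3,6) span1_subset_iff[OF subs(2)] by blast
    then show ?thesis using inl(3) by (auto simp: B_def)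
  qed
  have fewpts: "card (pts (l \<inter> Z)) \<le> 1"
    if l: "l \<in> proj_lines" and Z: "vec.subspace Z" "vec.dim Z = 2" "l \<noteq> Z" for l Z :: "('a ^ 3) set"
  proof -
    have l': "vec.subspace l" "vec.dim l = 2" using l by (auto simp: proj_lines_def)
    have sub: "vec.subspace (l \<inter> Z)" using l' Z by (simp add: vec.subspace_inter)
    have "\<not> l \<subseteq> Z" using subspace_eqI[OF l'(1) Z(1)] l'(2) Z(2,3) by auto
    then have "vec.dim (l \<inter> Z) < 2" using dim_Int_less[OF l'(1) Z(1)] l'(2) by simp
    then have "vec.dim (l \<inter> Z) = 0 \<or> vec.dim (l \<inter> Z) = 1" by linarith
    then have "card (rat_points (l \<inter> Z)) \<le> 1"
      using card_rat_points(1,2)[OF subfield_UNIV kform_UNIV[OF sub]] by linarith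
    then show ?thesis unfolding rat_points_subspace[OF sub] .
  qed
  have noline: "\<not> pts l \<subseteq> B" if l: "l \<in> proj_lines" for l
  proof (cases "l = X \<or> l = Y")
    case True
    then show ?thesis using inl pts PB RB by auto
  next
    case False
    have l': "vec.subspace l" "vec.dim l = 2" using l by (auto simp: proj_lines_def)
    show ?thesis
    proof
      assume "pts l \<subseteq> B"
      then have "pts l \<subseteq> pts (l \<inter> X) \<union> pts (l \<inter> Y) \<union> {?T}" by (auto simp: B_def)
      then have "card (pts l) \<le> card (pts (l \<inter> X) \<union> pts (l \<inter> Y) \<union> {?T})" by (intro card_mono) auto
      also have "\<dots> \<le> card (pts (l \<inter> X)) + card (pts (l \<inter> Y)) + 1"
        by (rule order_trans[OF card_Un_le]) (simp add: card_Un_le)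
      also have "\<dots> \<le> 3" using fewpts[OF l subs(1) dims(1)] fewpts[OF l subs(2) dims(2)] False by simp
      finally show False using card_pts(1)[OF l'] q4 by simp
    qed
  qed
  have meets: "\<exists>v\<in>l \<inter> Z. v \<noteq> 0"
    if l: "l \<in> proj_lines" and Z: "vec.subspace Z" "vec.dim Z = 2" for l Z :: "('a ^ 3) set"
  proof -
    have l': "vec.subspace l" "vec.dim l = 2" using l by (auto simp: proj_lines_def)
    have "vec.dim (join l Z) \<le> 3" using vec.dim_subset[OF subset_UNIV, of "join l Z"] unfolding dim_UNIV_cart by simp
    then have "vec.dim (l \<inter> Z) \<noteq> 0" using dim_join[OF l'(1) Z(1)] l'(2) Z(2) by linarith
    then show ?thesis by auto
  qed
  have block: "\<exists>Q\<in>B. Q \<subseteq> l" if l: "l \<in> proj_lines" for l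
  proof -
    have l': "vec.subspace l" using l by (auto simp: proj_lines_def)
    obtain v where v: "v \<in> l" "v \<in> X" "v \<noteq> 0" using meets[OF l subs(1) dims(1)] by blast
    obtain w where w: "w \<in> l" "w \<in> Y" "w \<noteq> 0" using meets[OF l subs(2) dims(2)] by blast
    show ?thesis
    proof (cases "vec.span {v} = ?P \<and> vec.span {w} = ?R")
      case True
      have "?P \<subseteq> l" "?R \<subseteq> l"
        using v(1) w(1) span1_subset_iff[OF l'] True by metis+
      then have "a + b \<in> l" using span1_subset_iff[OF l'] vec.subspace_add[OF l'] by blast
      then have "?T \<subseteq> l" using span1_subset_iff[OF l'] by blast
      then show ?thesis unfolding B_def by blast
    next
      case False
      moreover have "vec.span {v} \<in> pts X" "vec.span {w} \<in> pts Y" "vec.span {v} \<subseteq> l" "vec.span {w} \<subseteq> l"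
        using v w span1_subset_iff[OF l'] span1_subset_iff[OF subs(1)] span1_subset_iff[OF subs(2)]
        by (simp_all add: proj_point_span)
      ultimately show ?thesis unfolding B_def by blast
    qed
  qed
  have cardB: "card B \<le> 2 * CARD('a) + 1"
  proof -
    have "card B \<le> card (pts X - {?P}) + card (pts Y - {?R}) + 1"
      unfolding B_def by (rule order_trans[OF card_Un_le]) (simp add: card_Un_le)
    moreover have "card (pts X - {?P}) = CARD('a)" "card (pts Y - {?R}) = CARD('a)"
      using card_pts(1)[OF subs(1) dims(1)] card_pts(1)[OF subs(2) dims(2)] inl pts by simp_all
    ultimately show ?thesis by simp
  qed
  have nobaer: "\<not> contains_baer_subplane B"
  proof
    assume "contains_baer_subplane B"
    then obtain S where S: "baer_subgeometry S" "S \<subseteq> B" unfolding contains_baer_subplane_def by blast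
    obtain K W where K: "subfield_set K" "(card K)\<^sup>2 = CARD('a)" and W: "kform K W UNIV" "S = rat_points W"
      using baer_subgeometryD[OF S(1)] .
    have s: "2 \<le> card K" using subfield_card_ge_2[OF K(1)] by simp
    note forms = kform_Int[OF K(1) W(1) subs(1)] kform_Int[OF K(1) W(1) subs(2)]
    have d2: "vec.dim (W \<inter> X) \<le> 2" "vec.dim (W \<inter> Y) \<le> 2"
      using vec.dim_subset[of "W \<inter> X" X] vec.dim_subset[of "W \<inter> Y" Y] dims by auto
    let ?A = "rat_points (W \<inter> X)" and ?B = "rat_points (W \<inter> Y)"
    have AB: "card ?A \<le> card K + 1" "card ?B \<le> card K + 1"
      using card_rat_points_le[OF K(1) forms(1)] card_rat_points_le[OF K(1) forms(2)] d2 by simp_all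
    have "S \<subseteq> ?A \<union> ?B \<union> {?T}"
      using S(2) W(2) unfolding rat_points_Int[OF subs(1)] rat_points_Int[OF subs(2)] by (auto simp: B_def)
    then have "card S \<le> card (?A \<union> ?B \<union> {?T})" by (intro card_mono) auto
    also have "\<dots> \<le> card (?A \<union> ?B) + 1" by (rule order_trans[OF card_Un_le]) simp
    also have "card (?A \<union> ?B) \<le> 2 * card K + 1"
    proof (cases "vec.dim (W \<inter> X) = 2 \<and> vec.dim (W \<inter> Y) = 2")
      case True
      have "vec.dim (W \<inter> (X \<inter> Y)) \<noteq> 0"
        using kform_grassmann[OF K(1) W(1) subs] True dim_UNIV_cart[where 'n = 3 and 'a = 'a]
        by (simp del: vec.dim_eq_0)
      then obtain w where "w \<in> W \<inter> (X \<inter> Y)" "w \<noteq> 0" by auto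
      then have "vec.span {w} \<in> ?A \<inter> ?B" by (auto simp: rat_points_def)
      then have "card (?A \<inter> ?B) \<noteq> 0" by (metis card_0_eq emptyE finite)
      then show ?thesis using card_Un_Int[OF finite finite, of ?A ?B] AB by linarith
    next
      case False
      then have "vec.dim (W \<inter> X) \<le> 1 \<or> vec.dim (W \<inter> Y) \<le> 1" using d2 by linarith
      then have "card ?A \<le> 1 \<or> card ?B \<le> 1"
        using card_rat_points(1,2)[OF K(1) forms(1)] card_rat_points(1,2)[OF K(1) forms(2)]
        by (metis One_nat_def le_Suc_eq le_zero_eq vec.dim_span)
      then show ?thesis using AB card_Un_le[of ?A ?B] s by linarith
    qed
    also have "card S = card K ^ 2 + card K + 1"
      using card_rat_points(4)[OF K(1) W(1)] W(2) dim_UNIV_cart[where 'n = 3 and 'a = 'a] by simp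
    finally have "card K * card K \<le> card K + 1" by (simp add: power2_eq_square)
    moreover have "2 * card K \<le> card K * card K" using s by simp
    ultimately show False using s by linarith
  qed
  have "blocking_set B" unfolding blocking_set_def using block pts by (auto simp: B_def)
  then have "nontrivial_blocking_set B" using noline unfolding nontrivial_blocking_set_def by blast
  then show ?thesis using nobaer cardB by blast
qed


section \<open>Points and planes with two intersection numbers\<close>

lemma sum_card_swap:
  assumes "finite A" "finite B"
  shows "(\<Sum>a\<in>A. card {b \<in> B. R a b}) = (\<Sum>b\<in>B. card {a \<in> A. R a b})"
proof -
  have "(\<Sum>a\<in>A. \<Sum>b\<in>{b \<in> B. R a b}. 1::nat) = (\<Sum>b\<in>B. \<Sum>a\<in>{a \<in> A. R a b}. 1)"
    by (rule sum.swap_restrict[OF assms])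
  then show ?thesis by simp
qed

lemma sum_if_card:
  assumes "finite A"
  shows "(\<Sum>a\<in>A. if R a then b + c else b :: nat) = card A * b + c * card {a \<in> A. R a}"
proof -
  have "(\<Sum>a\<in>A. if R a then b + c else b) = (\<Sum>a\<in>A. b + (if R a then c else 0))"
    by (rule sum.cong) auto
  also have "\<dots> = card A * b + (\<Sum>a\<in>A. if R a then c else 0)" by (simp add: sum.distrib)
  also have "(\<Sum>a\<in>A. if R a then c else 0) = c * card {a \<in> A. R a}"
    using assms by (simp add: sum.If_cases Int_def mult.commute)
  finally show ?thesis .
qed

text \<open>
  The points and planes of a Cameron-Liebler set under the Klein correspondence. The conditions are
  invariant under duality, and \<open>cl_pairI\<close> derives all of them from the intersection numbers with planes.
\<close>
definition cl_pair :: "('a::{field,finite} ^ 4) set set \<Rightarrow> ('a ^ 4) set set \<Rightarrow> nat \<Rightarrow> bool" where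
  "cl_pair S T x \<longleftrightarrow> S \<subseteq> proj_points \<and> T \<subseteq> proj_planes \<and>
     card S = x * (CARD('a) + 1) \<and> card T = x * (CARD('a) + 1) \<and>
     (\<forall>E\<in>proj_planes. card {P \<in> S. P \<subseteq> E} = x + (if E \<in> T then CARD('a) else 0)) \<and>
     (\<forall>P\<in>proj_points. card {E \<in> T. P \<subseteq> E} = x + (if P \<in> S then CARD('a) else 0)) \<and>
     (\<forall>l\<in>proj_lines. card {P \<in> S. P \<subseteq> l} = card {E \<in> T. l \<subseteq> E})"

lemma cl_pairD:
  fixes S :: "('a::{field,finite} ^ 4) set set"
  assumes "cl_pair S T x"
  shows "S \<subseteq> proj_points" "T \<subseteq> proj_planes"
    "card S = x * (CARD('a) + 1)" "card T = x * (CARD('a) + 1)"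
    and "\<And>E. E \<in> proj_planes \<Longrightarrow> card {P \<in> S. P \<subseteq> E} = x + (if E \<in> T then CARD('a) else 0)"
    and "\<And>P. P \<in> proj_points \<Longrightarrow> card {E \<in> T. P \<subseteq> E} = x + (if P \<in> S then CARD('a) else 0)"
    and "\<And>l. l \<in> proj_lines \<Longrightarrow> card {P \<in> S. P \<subseteq> l} = card {E \<in> T. l \<subseteq> E}"
  using assms unfolding cl_pair_def by blast+

lemma covers_containing:
  assumes U: "vec.subspace U" "U \<subseteq> V" and V: "vec.subspace V"
    and Q: "Q \<in> proj_points" "Q \<subseteq> V"
  shows "{X \<in> covers U V. Q \<subseteq> X} = (if Q \<subseteq> U then covers U V else {join U Q})"
proof (cases "Q \<subseteq> U")
  case True
  then show ?thesis by (auto simp: covers_def)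
next
  case False
  have sub: "vec.subspace (U \<inter> Q)" using U Q by (simp add: vec.subspace_inter proj_pointsD)
  have "vec.dim (U \<inter> Q) \<noteq> 1"
  proof
    assume "vec.dim (U \<inter> Q) = 1"
    then have "U \<inter> Q = Q" using sub Q by (intro subspace_eqI) (auto simp: proj_pointsD)
    then show False using False by blast
  qed
  moreover have "vec.dim (U \<inter> Q) \<le> 1" using vec.dim_subset[of "U \<inter> Q" Q] Q by (simp add: proj_pointsD)
  ultimately have d: "vec.dim (join U Q) = vec.dim U + 1"
    using dim_join[OF U(1), of Q] Q by (simp add: proj_pointsD)
  have J: "join U Q \<in> covers U V"
    using d join_upper(1) join_least[OF V U(2) Q(2)] by (simp add: covers_def)
  have "X = join U Q" if X: "X \<in> covers U V" "Q \<subseteq> X" for X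
    by (rule subspace_eqI[symmetric]) (use X d join_least[of X U Q] in \<open>auto simp: covers_def\<close>)
  then show ?thesis using J False join_upper(2) by auto
qed

lemma proj_linesD: "l \<in> proj_lines \<Longrightarrow> vec.subspace l" "l \<in> proj_lines \<Longrightarrow> vec.dim l = 2"
  by (auto simp: proj_lines_def)

lemma proj_planesD: "E \<in> proj_planes \<Longrightarrow> vec.subspace E" "E \<in> proj_planes \<Longrightarrow> vec.dim E = 3"
  by (auto simp: proj_planes_def)

lemma covers_line: "vec.dim l = 2 \<Longrightarrow> covers l UNIV = {E \<in> proj_planes. l \<subseteq> E}"
  by (auto simp: covers_def proj_planes_def)

lemma covers_point: "vec.dim P = 1 \<Longrightarrow> covers P E = {l \<in> proj_lines. P \<subseteq> l \<and> l \<subseteq> E}"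
  by (auto simp: covers_def proj_lines_def)

lemma dim_UNIV4: "vec.dim (UNIV :: ('a::field ^ 4) set) = 4"
  using dim_UNIV_cart[where 'n = 4 and 'a = 'a] by simp

lemma proj_point_subset_iff:
  assumes "P \<in> proj_points" "Q \<in> proj_points"
  shows "P \<subseteq> Q \<longleftrightarrow> P = Q"
proof
  assume "P \<subseteq> Q"
  then show "P = Q" by (intro subspace_eqI) (use assms in \<open>simp_all add: proj_pointsD\<close>)
qed simp

text \<open>
  Counting incident pairs of points of S and planes through a line l gives the equality for l. Counting
  pairs along the lines through a point then gives the condition for that point.
\<close>
lemma cl_pairI:
  fixes S :: "('a::{field,finite} ^ 4) set set"
  assumes S: "S \<subseteq> proj_points" and T: "T \<subseteq> proj_planes"
    and E: "\<And>E. E \<in> proj_planes \<Longrightarrow> card {P \<in> S. P \<subseteq> E} = x + (if E \<in> T then CARD('a) else 0)"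
    and c: "card S = x * (CARD('a) + 1)"
  shows "cl_pair S T x"
proof -
  let ?q = "CARD('a)"
  have line: "card {P \<in> S. P \<subseteq> l} = card {E \<in> T. l \<subseteq> E}" if l: "l \<in> proj_lines" for l
  proof -
    note l' = proj_linesD[OF l]
    let ?C = "covers l UNIV"
    have cC: "card ?C = ?q + 1" by (rule card_covers(1)) (use l' dim_UNIV4[where 'a = 'a] in auto)
    have T_eq: "{E \<in> ?C. E \<in> T} = {E \<in> T. l \<subseteq> E}" using T covers_line[OF l'(2)] by auto
    have "(\<Sum>E\<in>?C. card {P \<in> S. P \<subseteq> E}) = (\<Sum>E\<in>?C. if E \<in> T then x + ?q else x)"
      by (rule sum.cong) (use E covers_line[OF l'(2)] in auto)
    also have "\<dots> = (?q + 1) * x + ?q * card {E \<in> T. l \<subseteq> E}"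
      by (subst sum_if_card) (simp_all add: cC T_eq)
    finally have 1: "(\<Sum>E\<in>?C. card {P \<in> S. P \<subseteq> E}) = (?q + 1) * x + ?q * card {E \<in> T. l \<subseteq> E}" .
    have "(\<Sum>E\<in>?C. card {P \<in> S. P \<subseteq> E}) = (\<Sum>P\<in>S. card {E \<in> ?C. P \<subseteq> E})"
      by (rule sum_card_swap) simp_all
    also have "\<dots> = (\<Sum>P\<in>S. if P \<subseteq> l then 1 + ?q else 1)"
    proof (rule sum.cong[OF refl])
      fix P assume "P \<in> S"
      then show "card {E \<in> ?C. P \<subseteq> E} = (if P \<subseteq> l then 1 + ?q else 1)"
        using S cC by (subst covers_containing) (auto simp: l')
    qed
    also have "\<dots> = card S + ?q * card {P \<in> S. P \<subseteq> l}" by (subst sum_if_card) simp_all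
    finally have "?q * card {P \<in> S. P \<subseteq> l} = ?q * card {E \<in> T. l \<subseteq> E}"
      using 1 c by (simp add: algebra_simps)
    then show ?thesis by simp
  qed
  have point: "card {E \<in> T. P \<subseteq> E} = x + (if P \<in> S then ?q else 0)" if P: "P \<in> proj_points" for P
  proof -
    note P' = proj_pointsD[OF P]
    let ?C = "covers P UNIV"
    have cC: "card ?C = ?q ^ 2 + ?q + 1" by (rule card_covers(2)) (use P' dim_UNIV4[where 'a = 'a] in auto)
    have "(\<Sum>l\<in>?C. card {Q \<in> S. Q \<subseteq> l}) = (\<Sum>Q\<in>S. card {l \<in> ?C. Q \<subseteq> l})"
      by (rule sum_card_swap) simp_all
    also have "\<dots> = (\<Sum>Q\<in>S. if Q = P then 1 + (?q ^ 2 + ?q) else 1)"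
    proof (rule sum.cong[OF refl])
      fix Q assume "Q \<in> S"
      then have "Q \<in> proj_points" using S by blast
      then show "card {l \<in> ?C. Q \<subseteq> l} = (if Q = P then 1 + (?q ^ 2 + ?q) else 1)"
        using cC P by (subst covers_containing) (auto simp: P' proj_point_subset_iff)
    qed
    also have "\<dots> = card S + (?q ^ 2 + ?q) * card {Q \<in> S. Q = P}" by (subst sum_if_card) simp_all
    also have "{Q \<in> S. Q = P} = (if P \<in> S then {P} else {})" by auto
    finally have 1: "(\<Sum>l\<in>?C. card {Q \<in> S. Q \<subseteq> l}) = (?q + 1) * (x + (if P \<in> S then ?q else 0))"
      using c by (simp add: algebra_simps power2_eq_square)
    have "(\<Sum>l\<in>?C. card {Q \<in> S. Q \<subseteq> l}) = (\<Sum>l\<in>?C. card {E \<in> T. l \<subseteq> E})"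
      by (rule sum.cong) (use line covers_point[OF P'(2)] in auto)
    also have "\<dots> = (\<Sum>E\<in>T. card {l \<in> ?C. l \<subseteq> E})"
      by (rule sum_card_swap) simp_all
    also have "\<dots> = (\<Sum>E\<in>T. if P \<subseteq> E then 0 + (?q + 1) else 0)"
    proof (rule sum.cong[OF refl])
      fix F assume F: "F \<in> T"
      have "{l \<in> ?C. l \<subseteq> F} = covers P F" by (auto simp: covers_def)
      moreover have "card (covers P F) = ?q + 1" if "P \<subseteq> F"
        by (rule card_covers(1)) (use that F T P' in \<open>auto simp: proj_planes_def\<close>)
      moreover have "covers P F = {}" if "\<not> P \<subseteq> F" using that by (auto simp: covers_def)
      ultimately show "card {l \<in> ?C. l \<subseteq> F} = (if P \<subseteq> F then 0 + (?q + 1) else 0)" by simp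
    qed
    also have "\<dots> = (?q + 1) * card {E \<in> T. P \<subseteq> E}" by (subst sum_if_card) simp_all
    finally have "(?q + 1) * card {E \<in> T. P \<subseteq> E} = (?q + 1) * (x + (if P \<in> S then ?q else 0))"
      using 1 by simp
    then show ?thesis by (simp only: mult_cancel1) simp
  qed
  have "card T = x * (?q + 1)"
  proof -
    let ?p = "proj_points :: ('a ^ 4) set set"
    have "(\<Sum>P\<in>?p. card {E \<in> T. P \<subseteq> E}) = (\<Sum>P\<in>?p. if P \<in> S then x + ?q else x)"
      by (rule sum.cong) (use point in auto)
    also have "\<dots> = card ?p * x + ?q * card {P \<in> ?p. P \<in> S}" by (rule sum_if_card) simp
    also have "{P \<in> ?p. P \<in> S} = S" using S by auto
    also have "card ?p = (?q + 1) * (?q ^ 2 + 1)"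
      using card_pts(3)[OF vec.subspace_UNIV dim_UNIV4] by simp
    finally have 1: "(\<Sum>P\<in>?p. card {E \<in> T. P \<subseteq> E}) = x * (?q + 1) * (?q ^ 2 + ?q + 1)"
      using c by (simp add: algebra_simps)
    have "(\<Sum>P\<in>?p. card {E \<in> T. P \<subseteq> E}) = (\<Sum>E\<in>T. card {P \<in> ?p. P \<subseteq> E})"
      by (rule sum_card_swap) simp_all
    also have "\<dots> = (\<Sum>E\<in>T. ?q ^ 2 + ?q + 1)"
      by (rule sum.cong) (use T card_pts(2) in \<open>auto simp: proj_planes_def\<close>)
    finally have "card T * (?q ^ 2 + ?q + 1) = x * (?q + 1) * (?q ^ 2 + ?q + 1)" using 1 by simp
    then show ?thesis by (simp only: mult_cancel2) simp
  qed
  then show ?thesis unfolding cl_pair_def using S T E c line point by blast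
qed

lemma perp_points_planes:
  fixes U :: "('a::{field,finite} ^ 4) set"
  shows "U \<in> proj_points \<Longrightarrow> perp U \<in> proj_planes" "U \<in> proj_planes \<Longrightarrow> perp U \<in> proj_points"
    "U \<in> proj_lines \<Longrightarrow> perp U \<in> proj_lines"
  using dim_perp[of U] by (auto simp: proj_points_def proj_planes_def proj_lines_def)

lemma card_perp_image:
  fixes A :: "('a::{field,finite} ^ 4) set set"
  assumes "A \<subseteq> {U. vec.subspace U}" "vec.subspace X"
  shows "card {U \<in> perp ` A. U \<subseteq> X} = card {U \<in> A. perp X \<subseteq> U}"
    and "card {U \<in> perp ` A. X \<subseteq> U} = card {U \<in> A. U \<subseteq> perp X}"
proof -
  have iff: "perp U \<subseteq> X \<longleftrightarrow> perp X \<subseteq> U" "X \<subseteq> perp U \<longleftrightarrow> U \<subseteq> perp X" if "U \<in> A" for U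
    using that assms perp_subset_iff[of U "perp X"] perp_subset_iff[of "perp X" U] perp_perp[OF assms(2)]
    by (auto simp: subset_iff)
  have "{U \<in> perp ` A. U \<subseteq> X} = perp ` {U \<in> A. perp X \<subseteq> U}"
    "{U \<in> perp ` A. X \<subseteq> U} = perp ` {U \<in> A. U \<subseteq> perp X}"
    using iff by blast+
  moreover have "inj_on perp B" if "B \<subseteq> A" for B
    using inj_on_subset[OF inj_on_perp] that assms(1) by blast
  ultimately show "card {U \<in> perp ` A. U \<subseteq> X} = card {U \<in> A. perp X \<subseteq> U}"
    and "card {U \<in> perp ` A. X \<subseteq> U} = card {U \<in> A. U \<subseteq> perp X}"
    by (simp_all add: card_image)
qed

lemma perp_mem_image_iff:
  fixes A :: "('a::{field,finite} ^ 'n) set set"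
  assumes "A \<subseteq> {U. vec.subspace U}" "vec.subspace X"
  shows "X \<in> perp ` A \<longleftrightarrow> perp X \<in> A"
  using assms perp_perp by (metis (no_types, lifting) image_iff mem_Collect_eq subsetD)

lemma cl_pair_dual:
  fixes S :: "('a::{field,finite} ^ 4) set set"
  assumes c: "cl_pair S T x"
  shows "cl_pair (perp ` T) (perp ` S) x"
proof -
  note D = cl_pairD[OF c]
  have sub: "S \<subseteq> {U. vec.subspace U}" "T \<subseteq> {U. vec.subspace U}"
    using D(1,2) by (auto simp: proj_points_def proj_planes_def)
  show ?thesis
    unfolding cl_pair_def
  proof (intro conjI ballI)
    show "perp ` T \<subseteq> proj_points" "perp ` S \<subseteq> proj_planes" using D(1,2) perp_points_planes by blast+
    show "card (perp ` T) = x * (CARD('a) + 1)" "card (perp ` S) = x * (CARD('a) + 1)"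
      using D(3,4) card_image[OF inj_on_subset[OF inj_on_perp sub(1)]]
        card_image[OF inj_on_subset[OF inj_on_perp sub(2)]] by simp_all
  next
    fix E :: "('a ^ 4) set" assume E: "E \<in> proj_planes"
    then show "card {P \<in> perp ` T. P \<subseteq> E} = x + (if E \<in> perp ` S then CARD('a) else 0)"
      using D(6)[OF perp_points_planes(2)[OF E]]
      by (simp add: card_perp_image[OF sub(2)] perp_mem_image_iff[OF sub(1)] proj_planesD)
  next
    fix P :: "('a ^ 4) set" assume P: "P \<in> proj_points"
    then show "card {E \<in> perp ` S. P \<subseteq> E} = x + (if P \<in> perp ` T then CARD('a) else 0)"
      using D(5)[OF perp_points_planes(1)[OF P]]
      by (simp add: card_perp_image[OF sub(1)] perp_mem_image_iff[OF sub(2)] proj_pointsD)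
  next
    fix l :: "('a ^ 4) set" assume l: "l \<in> proj_lines"
    then show "card {P \<in> perp ` T. P \<subseteq> l} = card {E \<in> perp ` S. l \<subseteq> E}"
      using D(7)[OF perp_points_planes(3)[OF l]]
      by (simp add: card_perp_image[OF sub(1)] card_perp_image[OF sub(2)] proj_linesD)
  qed
qed

text \<open>
  Each of the x + q points of S in E lies on one line of the pencil, except P, which lies on
  all q + 1 of them.
\<close>
lemma cl_pair_pencil_sum:
  fixes S :: "('a::{field,finite} ^ 4) set set"
  assumes c: "cl_pair S T x" and P: "P \<in> S" and E: "E \<in> T" and PE: "P \<subseteq> E"
  shows "(\<Sum>l\<in>covers P E. card {Q \<in> S. Q \<subseteq> l}) = x + 2 * CARD('a)"
proof -
  note D = cl_pairD[OF c]
  have P': "P \<in> proj_points" "vec.subspace P" "vec.dim P = 1" using P D(1) by (auto simp: proj_points_def)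
  have E': "E \<in> proj_planes" "vec.subspace E" "vec.dim E = 3" using E D(2) by (auto simp: proj_planes_def)
  let ?q = "CARD('a)" and ?C = "covers P E" and ?A = "{Q \<in> S. Q \<subseteq> E}"
  have cC: "card ?C = ?q + 1" by (rule card_covers(1)) (use P' E' PE in auto)
  have "(\<Sum>l\<in>?C. card {Q \<in> S. Q \<subseteq> l}) = (\<Sum>l\<in>?C. card {Q \<in> ?A. Q \<subseteq> l})"
    by (rule sum.cong) (auto simp: covers_def intro!: arg_cong[where f = card])
  also have "\<dots> = (\<Sum>Q\<in>?A. card {l \<in> ?C. Q \<subseteq> l})"
    by (rule sum_card_swap) simp_all
  also have "\<dots> = (\<Sum>Q\<in>?A. if Q = P then 1 + ?q else 1)"
  proof (rule sum.cong[OF refl])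
    fix Q assume Q: "Q \<in> ?A"
    then have "Q \<in> proj_points" using D(1) by blast
    then show "card {l \<in> ?C. Q \<subseteq> l} = (if Q = P then 1 + ?q else 1)"
      using cC P' E' PE Q by (subst covers_containing) (auto simp: proj_point_subset_iff)
  qed
  also have "\<dots> = card ?A + ?q * card {Q \<in> ?A. Q = P}" by (subst sum_if_card) simp_all
  also have "{Q \<in> ?A. Q = P} = {P}" using P PE by auto
  finally show ?thesis using D(5)[OF E'(1)] E by simp
qed

section \<open>Baer sublines in a pencil of lines\<close>

lemma kform_full_dim:
  fixes W :: "('a::{field,finite} ^ 'n) set"
  assumes "subfield_set K" "kform K W U" "vec.subspace X" "vec.dim (W \<inter> X) = vec.dim X"
  shows "kform K (W \<inter> X) X"
proof -
  have "vec.span (W \<inter> X) = X"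
    by (rule subspace_eqI) (use assms(3,4) vec.span_minimal[of "W \<inter> X" X] in auto)
  then show ?thesis using kform_Int[OF assms(1,2,3)] by simp
qed

lemma span_Int_superset_point:
  assumes "Q \<in> rat_points W" "Q \<subseteq> X"
  shows "Q \<subseteq> vec.span (W \<inter> X)"
proof -
  obtain w where w: "w \<in> W" "w \<noteq> 0" "w \<in> Q" "Q = vec.span {w}" using rat_pointsD[OF assms(1)] .
  then have "{w} \<subseteq> W \<inter> X" using assms(2) by blast
  then show ?thesis unfolding w(4) by (rule vec.span_mono)
qed

text \<open>
  In a rational basis starting with a vector of P, the remaining two basis vectors span N. The
  rational lines through P are those joining P to the Baer subline of N.
\<close>
lemma pencil_kform:
  fixes W :: "('a::{field,finite} ^ 'n) set"
  assumes K: "subfield_set K" and W: "kform K W E" and E: "vec.dim E = 3" and P: "P \<in> rat_points W"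
  obtains N where "vec.subspace N" "N \<subseteq> E" "P \<inter> N = {0}" "vec.dim N = 2" "kform K (W \<inter> N) N"
    "\<forall>l\<in>covers P E. vec.dim (W \<inter> l) = 2 \<longleftrightarrow> l \<inter> N \<in> rat_points (W \<inter> N)"
proof -
  obtain p where p: "p \<in> W" "p \<noteq> 0" "p \<in> P" "P = vec.span {p}" using rat_pointsD[OF P] .
  have sE: "vec.subspace E" using W by (rule kform_subspace)
  have ip: "vec.independent {p}" "{p} \<subseteq> W" using p by auto
  obtain B where B: "{p} \<subseteq> B" "B \<subseteq> W" "vec.independent B" "W \<subseteq> vec.span B"
    using vec.maximal_independent_subset_extend[OF ip(2,1)] by blast
  have "vec.span B = vec.span W"
    using vec.span_mono[of B W] vec.span_minimal[of W "vec.span B"] B by blast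
  then have sB: "vec.span B = E" using W by (simp add: kform_def)
  have pB: "p \<in> B" "finite B" using B(1) by auto
  define N where "N = vec.span (B - {p})"
  have indN: "vec.independent (B - {p})" using B(3) by (rule vec.independent_mono) blast
  have sN: "vec.subspace N" by (simp add: N_def)
  have NE: "N \<subseteq> E" unfolding N_def sB[symmetric] by (intro vec.span_mono) blast
  have "card B = 3" using vec.dim_span_eq_card_independent[OF B(3)] sB E by simp
  then have dN: "vec.dim N = 2"
    unfolding N_def vec.dim_span_eq_card_independent[OF indN] using pB by simp
  have pN: "p \<notin> N" unfolding N_def using B(3) pB(1) vec.dependent_def by blast
  have PN: "P \<inter> N = {0}"
  proof -
    have "v = 0" if "v \<in> P" "v \<in> N" for v
    proof (rule ccontr)
      assume "v \<noteq> 0"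
      then have "P = vec.span {v}" using proj_point_eq_span[OF _ that(1)] P rat_points_subset[of W] by blast
      then have "P \<subseteq> N" using span1_subset_iff[OF sN] that(2) by blast
      then show False using p(3) pN by blast
    qed
    moreover have "0 \<in> P" unfolding p(4) by (rule vec.span_zero)
    ultimately show ?thesis using vec.subspace_0[OF sN] by blast
  qed
  have dWN: "vec.dim (W \<inter> N) = vec.dim N"
  proof (rule antisym)
    show "vec.dim (W \<inter> N) \<le> vec.dim N" by (rule vec.dim_subset) blast
    have "B - {p} \<subseteq> W \<inter> N" using B(2) vec.span_superset[of "B - {p}"] unfolding N_def by blast
    then show "vec.dim N \<le> vec.dim (W \<inter> N)"
      unfolding N_def vec.dim_span by (rule vec.dim_subset)
  qed
  have WN: "kform K (W \<inter> N) N" by (rule kform_full_dim[OF K W sN dWN])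
  have "P \<in> proj_points" using rat_points_subset[of W] P by blast
  moreover have "P \<subseteq> E" unfolding p(4) using span1_subset_iff[OF sE, of p] kform_subset[OF W] p(1) by blast
  ultimately have Pp: "vec.subspace P" "P \<subseteq> E" "vec.dim P = 1" by (simp_all add: proj_pointsD)
  have dsum: "vec.dim P + vec.dim N = vec.dim E" using Pp(3) dN E by simp
  note bij = bij_complement[OF Pp(1) sN sE PN Pp(2) NE dsum]
  have main: "vec.dim (W \<inter> l) = 2 \<longleftrightarrow> l \<inter> N \<in> rat_points (W \<inter> N)" if l: "l \<in> covers P E" for l
  proof
    have sl: "vec.subspace l" "P \<subseteq> l" "vec.dim l = 2" using l Pp(3) by (auto simp: covers_def)
    {
      assume "vec.dim (W \<inter> l) = 2"
      then have "vec.dim (W \<inter> (l \<inter> N)) \<noteq> 0"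
        using kform_grassmann[OF K W sl(1) sN] dWN dN E by (simp del: vec.dim_eq_0)
      then obtain w where w: "w \<in> W \<inter> (l \<inter> N)" "w \<noteq> 0" by auto
      then show "l \<inter> N \<in> rat_points (W \<inter> N)"
        using bij(2)[OF l] by (intro rat_pointsI[of _ w]) auto
    next
      assume Q: "l \<inter> N \<in> rat_points (W \<inter> N)"
      then have "l \<inter> N \<in> rat_points W" by (auto simp: rat_points_def)
      then have "l \<inter> N \<subseteq> vec.span (W \<inter> l)" by (rule span_Int_superset_point) blast
      moreover have "P \<subseteq> vec.span (W \<inter> l)" by (rule span_Int_superset_point[OF P sl(2)])
      ultimately have "join P (l \<inter> N) \<subseteq> vec.span (W \<inter> l)" by (intro join_least) auto
      then have "l \<subseteq> vec.span (W \<inter> l)" using bij(3)[OF l] by simp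
      then have "vec.dim l \<le> vec.dim (W \<inter> l)" using vec.dim_subset[of l "vec.span (W \<inter> l)"] by simp
      moreover have "vec.dim (W \<inter> l) \<le> vec.dim l" by (rule vec.dim_subset) blast
      ultimately show "vec.dim (W \<inter> l) = 2" using sl(3) by simp
    }
  qed
  show ?thesis by (rule that[OF sN NE PN dN WN]) (use main in blast)
qed

lemma perp_join: "perp (join U X) = perp U \<inter> perp X"
  unfolding join_def perp_span by (auto simp: perp_def)

text \<open>
  The planes of a rational form Z of the star of P cut the pencil of P in E in the lines joining P
  to the points of a rational form of N. With a basis b, c of N, the plane orthogonal to z meets N
  in the point spanned by \<open>dotp z c *s b - dotp z b *s c\<close>, which depends linearly on z.
\<close>
lemma pencil_kform_dual:
  fixes Z :: "('a::{field,finite} ^ 4) set"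
  assumes K: "subfield_set K" "(card K)\<^sup>2 = CARD('a)"
    and P: "P \<in> proj_points" and E: "E \<in> proj_planes" and PE: "P \<subseteq> E"
    and Z: "kform K Z (perp P)" and EZ: "perp E \<in> rat_points Z"
    and N: "vec.subspace N" "N \<subseteq> E" "P \<inter> N = {0}" "vec.dim N = 2"
  obtains W where "kform K W N"
    "\<forall>l\<in>covers P E. vec.dim (Z \<inter> perp l) = 2 \<longleftrightarrow> l \<inter> N \<in> rat_points W"
proof -
  note P' = proj_pointsD[OF P] and E' = proj_planesD[OF E]
  have s2: "2 \<le> card K" using subfield_card_ge_2[OF K(1)] by simp
  obtain B where B: "B \<subseteq> N" "vec.independent B" "N \<subseteq> vec.span B" "card B = 2"
    using vec.basis_exists[of N] N(4) by auto
  obtain b c where bc: "B = {b, c}" "b \<noteq> c" using B(4) by (meson card_2_iff)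
  have spN: "vec.span {b, c} = N" using vec.span_subspace[OF B(1,3) N(1)] bc by simp
  have bcN: "b \<in> N" "c \<in> N" using B(1) bc by auto
  define \<phi> where "\<phi> z = dotp z c *s b - dotp z b *s c" for z
  have \<phi>_add: "\<phi> (u + v) = \<phi> u + \<phi> v" and \<phi>_diff: "\<phi> (u - v) = \<phi> u - \<phi> v"
    and \<phi>_scale: "\<phi> (k *s u) = k *s \<phi> u" for u v k
    by (simp_all add: \<phi>_def dotp_add dotp_diff dotp_scale algebra_simps vec.scale_right_distrib
        vec.scale_left_distrib vec.scale_right_diff_distrib vec.scale_left_diff_distrib)
  have \<phi>_0: "\<phi> 0 = 0" by (simp add: \<phi>_def)
  have \<phi>N: "\<phi> z \<in> N" for z
    unfolding \<phi>_def using bcN N(1) by (intro vec.subspace_diff vec.subspace_scale)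
  have ker: "\<phi> z = 0 \<longleftrightarrow> z \<in> perp N" for z
  proof -
    let ?g = "\<lambda>v. if v = b then dotp z c else - dotp z b"
    have "\<phi> z = (\<Sum>v\<in>{b, c}. ?g v *s v)"
      using bc(2) by (simp add: \<phi>_def)
    then have "\<forall>v\<in>{b, c}. ?g v = 0" if "\<phi> z = 0"
      using vec.independentD[OF B(2) _ subset_refl, of ?g] that bc(1) by simp
    then have "dotp z c = 0 \<and> dotp z b = 0" if "\<phi> z = 0" using that bc(2) by auto
    moreover have "z \<in> perp N \<longleftrightarrow> dotp z b = 0 \<and> dotp z c = 0"
      unfolding spN[symmetric] perp_span by (auto simp: perp_def dotp_commute)
    ultimately show ?thesis by (auto simp: \<phi>_def)
  qed
  have dsum: "vec.dim P + vec.dim N = vec.dim E" using P' E' N(4) by simp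
  note bij = bij_complement[OF P'(1) N(1) E'(1) N(3) PE N(2) dsum]
  have "join P N = E"
    by (rule subspace_eqI)
      (use dim_join[OF P'(1) N(1)] N dsum E' join_least[OF E'(1) PE N(2)] in auto)
  then have perpE: "perp E = perp P \<inter> perp N" using perp_join by metis
  have dpE: "vec.dim (perp E) = 1" using dim_perp[OF E'(1)] E'(2) by simp
  have dpP: "vec.dim (perp P) = 3" using dim_perp[OF P'(1)] P'(2) by simp
  have ZP: "Z \<subseteq> perp P" using kform_subset[OF Z] .
  have ksZ: "ksubspace K Z" using Z by (simp add: kform_def)
  have spE: "perp E \<subseteq> vec.span (Z \<inter> perp E)" by (rule span_Int_superset_point[OF EZ subset_refl])
  have dZE: "vec.dim (Z \<inter> perp E) = 1"
    using vec.dim_subset[OF spE] vec.dim_subset[of "Z \<inter> perp E" "perp E"] dpE by simp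
  have "card (\<phi> ` perp P) * card (perp E) = card (perp P)"
  proof -
    have "{z \<in> perp P. \<phi> z = 0} = perp E" unfolding perpE ker by blast
    then show ?thesis
      using card_image_kernel[of "perp P" \<phi>] by (simp add: \<phi>_diff vec.subspace_diff)
  qed
  then have "card (\<phi> ` perp P) * CARD('a) = CARD('a) ^ 2 * CARD('a)"
    by (simp add: card_subspace dpE dpP eval_nat_numeral)
  then have "card (\<phi> ` perp P) = card N"
    by (simp only: mult_cancel2 card_subspace[OF N(1)] N(4)) simp
  then have imgP: "\<phi> ` perp P = N" using \<phi>N by (intro card_subset_eq) auto
  have "card (\<phi> ` Z) * card (Z \<inter> perp E) = card Z"
  proof -
    have "{z \<in> Z. \<phi> z = 0} = Z \<inter> perp E" unfolding perpE ker using ZP by blast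
    then show ?thesis
      using card_image_kernel[of Z \<phi>] ksubspace_diff[OF K(1) ksZ] by (simp add: \<phi>_diff)
  qed
  moreover have "card (Z \<inter> perp E) = card K ^ 1"
    using kform_Int[OF K(1) Z subspace_perp] dZE unfolding kform_def by simp
  moreover have "card Z = card K ^ 2 * card K ^ 1"
    using Z dpP by (simp add: kform_def eval_nat_numeral)
  ultimately have cZ: "card (\<phi> ` Z) = card K ^ vec.dim N" using s2 N(4) by auto
  have W: "kform K (\<phi> ` Z) N"
    unfolding kform_def
  proof (intro conjI cZ)
    show "ksubspace K (\<phi> ` Z)"
      unfolding ksubspace_def
    proof (intro conjI ballI)
      show "0 \<in> \<phi> ` Z" using ksZ \<phi>_0 unfolding ksubspace_def by (intro image_eqI[of _ _ 0]) auto
    next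
      fix u v assume "u \<in> \<phi> ` Z" "v \<in> \<phi> ` Z"
      then show "u + v \<in> \<phi> ` Z" using ksZ unfolding ksubspace_def by (auto simp: \<phi>_add[symmetric])
    next
      fix k u assume "k \<in> K" "u \<in> \<phi> ` Z"
      then show "k *s u \<in> \<phi> ` Z" using ksZ unfolding ksubspace_def by (auto simp: \<phi>_scale[symmetric])
    qed
    show "vec.span (\<phi> ` Z) = N"
    proof
      show "vec.span (\<phi> ` Z) \<subseteq> N" by (rule vec.span_minimal) (use \<phi>N N(1) in auto)
      have "vec.subspace {z. \<phi> z \<in> vec.span (\<phi> ` Z)}"
        by (auto simp: vec.subspace_def \<phi>_0 \<phi>_add \<phi>_scale intro: vec.span_zero vec.span_add vec.span_scale)
      then have "vec.span Z \<subseteq> {z. \<phi> z \<in> vec.span (\<phi> ` Z)}"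
        by (intro vec.span_minimal) (auto intro: vec.span_base)
      moreover have "vec.span Z = perp P" using Z by (simp add: kform_def)
      ultimately show "N \<subseteq> vec.span (\<phi> ` Z)" unfolding imgP[symmetric] by blast
    qed
  qed
  have self: "dotp z (\<phi> z) = 0" for z
    by (simp add: \<phi>_def dotp_diff dotp_scale mult.commute)
  have main: "vec.dim (Z \<inter> perp l) = 2 \<longleftrightarrow> l \<inter> N \<in> rat_points (\<phi> ` Z)" if l: "l \<in> covers P E" for l
  proof
    have sl: "vec.subspace l" "P \<subseteq> l" "l \<subseteq> E" "vec.dim l = 2" using l P'(2) by (auto simp: covers_def)
    have Q: "l \<inter> N \<in> proj_points" using bij(2)[OF l] by simp
    have lj: "perp l = perp P \<inter> perp (l \<inter> N)" using bij(3)[OF l] perp_join by metis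
    {
      assume d: "vec.dim (Z \<inter> perp l) = 2"
      have "\<not> Z \<inter> perp l \<subseteq> perp E"
      proof
        assume "Z \<inter> perp l \<subseteq> perp E"
        then show False using vec.dim_subset[of "Z \<inter> perp l" "perp E"] d dpE by simp
      qed
      then obtain z where z: "z \<in> Z" "z \<in> perp l" "z \<notin> perp E" by blast
      then have zN: "z \<notin> perp N" using ZP perpE by blast
      then have nz: "\<phi> z \<noteq> 0" using ker by blast
      have sub: "vec.subspace (N \<inter> perp {z})" using N(1) by (simp add: vec.subspace_inter)
      have "\<not> N \<subseteq> perp {z}" using zN by (auto simp: perp_def dotp_commute)
      then have "vec.dim (N \<inter> perp {z}) \<le> 1" using dim_Int_less[OF N(1) subspace_perp, of "{z}"] N(4) by simp
      moreover have "l \<inter> N \<subseteq> N \<inter> perp {z}" using z(2) by (auto simp: perp_def dotp_commute)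
      ultimately have "l \<inter> N = N \<inter> perp {z}"
        using Q sub by (intro subspace_eqI) (auto simp: proj_pointsD)
      moreover have "\<phi> z \<in> N \<inter> perp {z}" using \<phi>N self by (simp add: perp_def)
      ultimately have "\<phi> z \<in> l \<inter> N" by simp
      then show "l \<inter> N \<in> rat_points (\<phi> ` Z)"
        using Q nz z(1) by (intro rat_pointsI[of _ "\<phi> z"]) auto
    next
      assume "l \<inter> N \<in> rat_points (\<phi> ` Z)"
      then obtain w where w: "w \<in> \<phi> ` Z" "w \<noteq> 0" "w \<in> l \<inter> N" "l \<inter> N = vec.span {w}" by (rule rat_pointsD)
      then obtain z where z: "z \<in> Z" "w = \<phi> z" by blast
      have "z \<notin> perp E" using w(2) z(2) ker perpE by blast
      have "z \<in> perp (l \<inter> N)" unfolding w(4) perp_span using self[of z] z(2) by (simp add: perp_def dotp_commute)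
      then have "z \<in> perp l" unfolding lj using z(1) ZP by blast
      then have "z \<in> vec.span (Z \<inter> perp l)" using z(1) by (intro vec.span_base) blast
      moreover have "perp E \<subseteq> vec.span (Z \<inter> perp l)"
        by (rule span_Int_superset_point[OF EZ perp_mono[OF sl(3)]])
      ultimately have "perp E \<subset> vec.span (Z \<inter> perp l)" using \<open>z \<notin> perp E\<close> by blast
      moreover have "vec.span (perp E) = perp E" by simp
      ultimately have "vec.dim (perp E) < vec.dim (vec.span (Z \<inter> perp l))"
        using vec.dim_psubset[of "perp E" "vec.span (Z \<inter> perp l)"] by (simp only: vec.span_span)
      moreover have "vec.dim (Z \<inter> perp l) \<le> vec.dim (perp l)" by (rule vec.dim_subset) blast
      ultimately show "vec.dim (Z \<inter> perp l) = 2" using dpE dim_perp[OF sl(1)] sl(4) by simp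
    }
  qed
  show ?thesis by (rule that[OF W]) (use main in blast)
qed

section \<open>Baer subgeometries from local Baer subplanes\<close>

lemma three_common_elements:
  assumes "3 \<le> card (A \<inter> B)"
  obtains a b c where "{a, b, c} \<subseteq> A \<inter> B" "a \<noteq> b" "a \<noteq> c" "b \<noteq> c"
proof -
  obtain C where C: "C \<subseteq> A \<inter> B" "card C = 3"
    using obtain_subset_with_card_n[OF assms] by blast
  then obtain a b c where "C = {a, b, c}" "a \<noteq> b" "a \<noteq> c" "b \<noteq> c"
    by (auto simp: card_3_iff)
  then show ?thesis using that C by blast
qed

text \<open>
  Distinct Baer sublines of a line have at most two common points.
\<close>
lemma card_Un_of_rigid:
  fixes W W' :: "('a::{field,finite} ^ 'n) set"
  assumes K: "subfield_set K" and W: "kform K W l" and W': "kform K W' l" and l: "vec.dim l = 2"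
    and ne: "rat_points W \<noteq> rat_points W'"
  shows "2 * card K \<le> card (rat_points W \<union> rat_points W')"
proof -
  have "\<not> 3 \<le> card (rat_points W \<inter> rat_points W')"
  proof
    assume "3 \<le> card (rat_points W \<inter> rat_points W')"
    then obtain a b c where abc: "{a, b, c} \<subseteq> rat_points W \<inter> rat_points W'" "a \<noteq> b" "a \<noteq> c" "b \<noteq> c"
      by (rule three_common_elements)
    obtain k where "k \<noteq> 0" "W' = (*s) k ` W" by (rule kform_line_rigid[OF K W W' l abc])
    then show False using rat_points_scale[of k W] ne by simp
  qed
  moreover have "card (rat_points W) = card K + 1" "card (rat_points W') = card K + 1"
    using card_rat_points(3)[OF K W l] card_rat_points(3)[OF K W' l] by simp_all
  ultimately show ?thesis
    using card_Un_Int[OF finite finite, of "rat_points W" "rat_points W'"] by linarith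
qed

lemma card_rational_pencil:
  fixes W :: "('a::{field,finite} ^ 'n) set"
  assumes K: "subfield_set K" and W: "kform K W E" and E: "vec.dim E = 3" and P: "P \<in> rat_points W"
  shows "card {l \<in> covers P E. vec.dim (W \<inter> l) = 2} = card K + 1"
proof -
  have sE: "vec.subspace E" using W by (rule kform_subspace)
  obtain N where N: "vec.subspace N" "N \<subseteq> E" "P \<inter> N = {0}" "vec.dim N = 2" "kform K (W \<inter> N) N"
    and long: "\<forall>l\<in>covers P E. vec.dim (W \<inter> l) = 2 \<longleftrightarrow> l \<inter> N \<in> rat_points (W \<inter> N)"
    using pencil_kform[OF K W E P] .
  let ?L = "{l \<in> covers P E. vec.dim (W \<inter> l) = 2}"
  have P': "P \<in> proj_points" using P rat_points_subset[of W] by blast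
  have PE: "P \<subseteq> E" using P kform_subset[OF W] span1_subset_iff[OF sE] by (auto simp: rat_points_def)
  have dsum: "vec.dim P + vec.dim N = vec.dim E" using P' E N(4) by (simp add: proj_pointsD)
  note bij = bij_complement[OF proj_pointsD(1)[OF P'] N(1) sE N(3) PE N(2) dsum]
  have sub: "rat_points (W \<inter> N) \<subseteq> pts N"
    using rat_points_subset[of "W \<inter> N"] rat_points_Int[OF N(1), of W] by blast
  have "bij_betw (\<lambda>l. l \<inter> N) ?L (rat_points (W \<inter> N))"
  proof (rule bij_betw_byWitness[where f' = "join P"])
    show "\<forall>l\<in>?L. join P (l \<inter> N) = l" using bij(3) by blast
    show "\<forall>Q\<in>rat_points (W \<inter> N). join P Q \<inter> N = Q" using bij(4) sub by blast
    show "(\<lambda>l. l \<inter> N) ` ?L \<subseteq> rat_points (W \<inter> N)" using long by blast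
    show "join P ` rat_points (W \<inter> N) \<subseteq> ?L"
    proof
      fix l assume "l \<in> join P ` rat_points (W \<inter> N)"
      then obtain Q where Q: "Q \<in> rat_points (W \<inter> N)" "l = join P Q" by blast
      then have "l \<in> covers P E" using bij_betw_imp_surj_on[OF bij(1)] sub by blast
      then show "l \<in> ?L" using long bij(4)[of Q] Q sub by auto
    qed
  qed
  then show ?thesis using bij_betw_same_card[of _ ?L "rat_points (W \<inter> N)"] card_rat_points(3)[OF K N(5,4)] by simp
qed

lemma card_rational_lines:
  fixes W :: "('a::{field,finite} ^ 'n) set"
  assumes K: "subfield_set K" and W: "kform K W E" and E: "vec.dim E = 3"
  shows "card {m \<in> proj_lines. m \<subseteq> E \<and> vec.dim (W \<inter> m) = 2} = card K ^ 2 + card K + 1"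
proof -
  let ?A = "{m \<in> proj_lines. m \<subseteq> E \<and> vec.dim (W \<inter> m) = 2}"
  have "(\<Sum>P\<in>rat_points W. card {m \<in> ?A. P \<subseteq> m}) = (\<Sum>P\<in>rat_points W. card K + 1)"
  proof (rule sum.cong[OF refl])
    fix P assume P: "P \<in> rat_points W"
    then have "P \<in> proj_points" using rat_points_subset[of W] by blast
    then have "{m \<in> ?A. P \<subseteq> m} = {l \<in> covers P E. vec.dim (W \<inter> l) = 2}"
      by (subst covers_point) (auto simp: proj_pointsD)
    then show "card {m \<in> ?A. P \<subseteq> m} = card K + 1" using card_rational_pencil[OF K W E P] by simp
  qed
  moreover have "(\<Sum>P\<in>rat_points W. card {m \<in> ?A. P \<subseteq> m}) = (\<Sum>m\<in>?A. card {P \<in> rat_points W. P \<subseteq> m})"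
    by (rule sum_card_swap) simp_all
  moreover have "\<dots> = (\<Sum>m\<in>?A. card K + 1)"
  proof (rule sum.cong[OF refl])
    fix m assume "m \<in> ?A"
    then have m: "vec.subspace m" "vec.dim m = 2" "vec.dim (W \<inter> m) = 2" by (auto simp: proj_lines_def)
    then have "kform K (W \<inter> m) m" using kform_full_dim[OF K W m(1)] by simp
    then have "card (rat_points (W \<inter> m)) = card K + 1" using card_rat_points(3)[OF K] m(2) by blast
    then show "card {P \<in> rat_points W. P \<subseteq> m} = card K + 1" by (simp only: rat_points_Int[OF m(1)])
  qed
  ultimately have "card ?A * (card K + 1) = card (rat_points W) * (card K + 1)" by simp
  then show ?thesis using card_rat_points(4)[OF K W E] by (simp only: mult_cancel2) simp
qed

text \<open>
  Since x is at most q, the numbers of points of S other than P on the lines of a pencil, for P in S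
  and the plane of the pencil in T, have a sum below 2q. All contradictions in this part come from this bound.
\<close>
locale baer_config =
  fixes K :: "'a::{field,finite} set" and S T :: "('a ^ 4) set set" and x :: nat
  assumes K: "subfield_set K" and Kq: "(card K)\<^sup>2 = CARD('a)"
    and cl: "cl_pair S T x" and xq: "x \<le> CARD('a)"
begin

definition point_form :: "('a ^ 4) set \<Rightarrow> ('a ^ 4) set \<Rightarrow> bool" where
  "point_form E W \<longleftrightarrow> kform K W E \<and> rat_points W \<subseteq> S"

text \<open>
  A point form of E is a Baer subplane inside S and E. A plane form of P is the dual object: a
  Baer subplane of the quotient at P, whose points are planes of T through P. Passing to
  orthogonal spaces turns planes into points.
\<close>
definition plane_form :: "('a ^ 4) set \<Rightarrow> ('a ^ 4) set \<Rightarrow> bool" where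
  "plane_form P Z \<longleftrightarrow> kform K Z (perp P) \<and> rat_points Z \<subseteq> perp ` T"

lemma dual: "baer_config K (perp ` T) (perp ` S) x"
  using K Kq cl_pair_dual[OF cl] xq by unfold_locales

lemma S_points: "P \<in> S \<Longrightarrow> P \<in> proj_points" and T_planes: "E \<in> T \<Longrightarrow> E \<in> proj_planes"
  using cl_pairD(1,2)[OF cl] by blast+

lemma s_ge_2: "2 \<le> card K"
  using subfield_card_ge_2[OF K] by simp

abbreviation mult :: "('a ^ 4) set \<Rightarrow> nat" where
  "mult l \<equiv> card {Q \<in> S. Q \<subseteq> l}"

lemma mult_planes: "l \<in> proj_lines \<Longrightarrow> mult l = card {E \<in> T. l \<subseteq> E}"
  using cl_pairD(7)[OF cl] .

lemma card_pencil:
  fixes P :: "('a ^ 4) set"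
  assumes "P \<in> proj_points" "E \<in> proj_planes" "P \<subseteq> E"
  shows "card (covers P E) = CARD('a) + 1"
  by (rule card_covers(1)) (use assms in \<open>auto simp: proj_pointsD proj_planesD\<close>)

text \<open>
  The numbers of points of S other than P on the lines of the pencil add up to x + q - 1.
\<close>
lemma excess_bound:
  assumes P: "P \<in> S" and E: "E \<in> T" and PE: "P \<subseteq> E"
    and g: "\<And>l. l \<in> covers P E \<Longrightarrow> g l + 1 \<le> mult l"
  shows "(\<Sum>l\<in>covers P E. g l) + 1 \<le> x + CARD('a)"
proof -
  have "(\<Sum>l\<in>covers P E. g l + 1) \<le> (\<Sum>l\<in>covers P E. mult l)"
    by (rule sum_mono) (rule g)
  also have "\<dots> = x + 2 * CARD('a)" by (rule cl_pair_pencil_sum[OF cl P E PE])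
  also have "(\<Sum>l\<in>covers P E. g l + 1) = (\<Sum>l\<in>covers P E. g l) + (CARD('a) + 1)"
    using card_pencil[OF S_points[OF P] T_planes[OF E] PE] sum.distrib[of g "\<lambda>_. 1" "covers P E"] by simp
  finally show ?thesis by simp
qed

lemma excess_bound_subset:
  assumes P: "P \<in> S" and E: "E \<in> T" and PE: "P \<subseteq> E"
    and A: "A \<subseteq> covers P E" and d: "\<And>l. l \<in> A \<Longrightarrow> d + 1 \<le> mult l"
  shows "d * card A + 1 \<le> x + CARD('a)"
proof -
  have pos: "1 \<le> mult l" if "l \<in> covers P E" for l
  proof -
    have "{Q \<in> S. Q \<subseteq> l} \<noteq> {}" using that P by (auto simp: covers_def)
    then have "mult l \<noteq> 0" by (simp add: card_eq_0_iff)
    then show ?thesis by linarith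
  qed
  have "(\<Sum>l\<in>covers P E. if l \<in> A then d else 0) + 1 \<le> x + CARD('a)"
    by (rule excess_bound[OF P E PE]) (use pos d in auto)
  moreover have "(\<Sum>l\<in>covers P E. if l \<in> A then d else 0) = d * card A"
    using A by (simp add: sum.If_cases Int_absorb1 mult.commute)
  ultimately show ?thesis by simp
qed

lemma covers_lines:
  fixes P :: "('a ^ 4) set"
  assumes "P \<in> proj_points" "l \<in> covers P E"
  shows "l \<in> proj_lines" "P \<subseteq> l" "l \<subseteq> E" "vec.subspace l" "vec.dim l = 2"
  using assms by (auto simp: covers_def proj_lines_def proj_pointsD)

lemma point_form_mult:
  assumes W: "point_form E W" and l: "l \<in> proj_lines" "vec.dim (W \<inter> l) = 2"
  shows "card K + 1 \<le> mult l"
proof -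
  note l' = proj_linesD[OF l(1)]
  have "kform K (W \<inter> l) l" using kform_full_dim[OF K _ l'(1)] W l(2) l'(2) by (auto simp: point_form_def)
  then have "card (rat_points (W \<inter> l)) = card K + 1" using card_rat_points(3)[OF K] l'(2) by blast
  moreover have "rat_points (W \<inter> l) \<subseteq> {Q \<in> S. Q \<subseteq> l}"
    using W unfolding rat_points_Int[OF l'(1)] point_form_def by blast
  ultimately show ?thesis using card_mono[OF finite, of "rat_points (W \<inter> l)" "{Q \<in> S. Q \<subseteq> l}"] by simp
qed

lemma plane_form_planes:
  assumes Z: "plane_form P Z" and l: "vec.subspace l"
  shows "perp ` rat_points (Z \<inter> perp l) \<subseteq> {F \<in> T. l \<subseteq> F}"
proof
  fix F assume "F \<in> perp ` rat_points (Z \<inter> perp l)"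
  then obtain R where R: "R \<in> rat_points Z" "R \<subseteq> perp l" "F = perp R"
    unfolding rat_points_Int[OF subspace_perp] by blast
  then obtain F' where F': "F' \<in> T" "R = perp F'" using Z by (auto simp: plane_form_def)
  have "F = F'" using R(3) F' perp_perp[OF proj_planesD(1)[OF T_planes]] by blast
  moreover have "l \<subseteq> F" using perp_mono[OF R(2)] perp_perp[OF l] R(3) by simp
  ultimately show "F \<in> {F \<in> T. l \<subseteq> F}" using F' by blast
qed

lemma plane_form_mult:
  assumes Z: "plane_form P Z" and l: "l \<in> proj_lines" "vec.dim (Z \<inter> perp l) = 2"
  shows "card K + 1 \<le> mult l"
proof -
  note l' = proj_linesD[OF l(1)]
  have "kform K (Z \<inter> perp l) (perp l)"
    using kform_full_dim[OF K _ subspace_perp, of Z "perp P" l] Z l(2) dim_perp[OF l'(1)] l'(2)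
    by (simp add: plane_form_def)
  then have "card (rat_points (Z \<inter> perp l)) = card K + 1"
    using card_rat_points(3)[OF K] dim_perp[OF l'(1)] l'(2) by simp
  moreover have "inj_on perp (rat_points (Z \<inter> perp l))"
    using rat_points_subset by (intro inj_on_subset[OF inj_on_perp]) (auto simp: rat_points_def)
  ultimately have "card (perp ` rat_points (Z \<inter> perp l)) = card K + 1" by (simp add: card_image)
  then show ?thesis
    using card_mono[OF finite plane_form_planes[OF Z l'(1)]] mult_planes[OF l(1)] by simp
qed

text \<open>
  If P is rational in E but E were not rational in the star of P, every line of the
  pencil would lie on a plane of T other than E, and the s + 1 rational lines through P
  would carry at least s + 1 points of S each. The excess would be at least
  \<open>(q + 1) + (s - 1) * (s + 1) = 2 * q\<close>.
\<close>
lemma rational_flag: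
  assumes P: "P \<in> S" and E: "E \<in> T" and W: "point_form E W" and Z: "plane_form P Z"
    and PW: "P \<in> rat_points W"
  shows "perp E \<in> rat_points Z"
proof (rule ccontr)
  assume EZ: "perp E \<notin> rat_points Z"
  note P' = S_points[OF P] and E' = T_planes[OF E]
  have kW: "kform K W E" and kZ: "kform K Z (perp P)" using W Z by (auto simp: point_form_def plane_form_def)
  have PE: "P \<subseteq> E"
    using PW kform_subset[OF kW] span1_subset_iff[OF proj_planesD(1)[OF E']] by (auto simp: rat_points_def)
  let ?L = "{l \<in> covers P E. vec.dim (W \<inter> l) = 2}"
  have cL: "card ?L = card K + 1" by (rule card_rational_pencil[OF K kW proj_planesD(2)[OF E'] PW])
  have other: "2 \<le> mult l" if l: "l \<in> covers P E" for l
  proof -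
    note l' = covers_lines[OF P' l]
    have "vec.dim (Z \<inter> perp l) \<noteq> 0"
    proof -
      have "2 * vec.dim (perp l) \<le> vec.dim (perp P) + vec.dim (Z \<inter> perp l)"
        by (rule kform_dim_Int_ge[OF K Kq kZ subspace_perp perp_mono[OF l'(2)]])
      then show ?thesis using dim_perp[OF l'(4)] dim_perp[OF proj_pointsD(1)[OF P']] l'(5) proj_pointsD(2)[OF P']
        by (simp del: vec.dim_eq_0)
    qed
    then obtain z where z: "z \<in> Z \<inter> perp l" "z \<noteq> 0" by auto
    let ?R = "vec.span {z}"
    have R: "?R \<in> rat_points (Z \<inter> perp l)" using z unfolding rat_points_def by blast
    then have "perp ?R \<in> {F \<in> T. l \<subseteq> F}" using plane_form_planes[OF Z l'(4)] by blast
    moreover have "perp ?R \<noteq> E"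
    proof
      assume "perp ?R = E"
      then have "perp E = perp (perp ?R)" by simp
      then have "perp E = ?R" by (simp only: perp_perp[OF vec.subspace_span])
      then show False using EZ z by (auto simp: rat_points_def)
    qed
    ultimately have "{perp ?R, E} \<subseteq> {F \<in> T. l \<subseteq> F}" "card {perp ?R, E} = 2" using E l'(3) by auto
    then show ?thesis using card_mono[OF finite, of "{perp ?R, E}" "{F \<in> T. l \<subseteq> F}"] mult_planes[OF l'(1)] by simp
  qed
  have "(\<Sum>l\<in>covers P E. if vec.dim (W \<inter> l) = 2 then 1 + (card K - 1) else 1) + 1 \<le> x + CARD('a)"
  proof (rule excess_bound[OF P E PE])
    fix l assume l: "l \<in> covers P E"
    show "(if vec.dim (W \<inter> l) = 2 then 1 + (card K - 1) else 1) + 1 \<le> mult l"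
      using other[OF l] point_form_mult[OF W covers_lines(1)[OF P' l]] s_ge_2 by auto
  qed
  then have "(CARD('a) + 1) + (card K - 1) * (card K + 1) + 1 \<le> x + CARD('a)"
    by (subst (asm) sum_if_card) (simp_all only: cL card_pencil[OF P' E' PE] mult_1_right finite)
  moreover obtain t where "card K = Suc t" using s_ge_2 by (cases "card K") auto
  ultimately show False using Kq xq by (simp add: power2_eq_square)
qed

text \<open>
  Both sets of rational lines are Baer sublines of the pencil. If they differ, they have together at least 2s
  lines, each with at least s + 1 points of S, and the excess is at least \<open>2 * s * s = 2 * q\<close>.
\<close>
lemma rational_pencils_agree:
  assumes P: "P \<in> S" and E: "E \<in> T" and W: "point_form E W" and Z: "plane_form P Z"
    and PW: "P \<in> rat_points W" and l: "l \<in> covers P E"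
  shows "vec.dim (W \<inter> l) = 2 \<longleftrightarrow> vec.dim (Z \<inter> perp l) = 2"
proof -
  note P' = S_points[OF P] and E' = T_planes[OF E]
  have kW: "kform K W E" and kZ: "kform K Z (perp P)" using W Z by (auto simp: point_form_def plane_form_def)
  have PE: "P \<subseteq> E"
    using PW kform_subset[OF kW] span1_subset_iff[OF proj_planesD(1)[OF E']] by (auto simp: rat_points_def)
  obtain N where N: "vec.subspace N" "N \<subseteq> E" "P \<inter> N = {0}" "vec.dim N = 2" "kform K (W \<inter> N) N"
    and long0: "\<forall>l\<in>covers P E. vec.dim (W \<inter> l) = 2 \<longleftrightarrow> l \<inter> N \<in> rat_points (W \<inter> N)"
    using pencil_kform[OF K kW proj_planesD(2)[OF E'] PW] .
  note long = bspec[OF long0]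
  obtain W' where W': "kform K W' N"
    and long0': "\<forall>l\<in>covers P E. vec.dim (Z \<inter> perp l) = 2 \<longleftrightarrow> l \<inter> N \<in> rat_points W'"
    using pencil_kform_dual[OF K Kq P' E' PE kZ rational_flag[OF P E W Z PW] N(1-4)] .
  note long' = bspec[OF long0']
  have dsum: "vec.dim P + vec.dim N = vec.dim E" using P' E' N(4) by (simp add: proj_pointsD proj_planesD)
  note bij = bij_complement[OF proj_pointsD(1)[OF P'] N(1) proj_planesD(1)[OF E'] N(3) PE N(2) dsum]
  have "rat_points (W \<inter> N) = rat_points W'"
  proof (rule ccontr)
    assume ne: "rat_points (W \<inter> N) \<noteq> rat_points W'"
    let ?U = "rat_points (W \<inter> N) \<union> rat_points W'"
    have "W \<inter> N \<subseteq> N" "W' \<subseteq> N" using kform_subset[OF W'] by auto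
    then have sub: "?U \<subseteq> pts N"
      using rat_points_subset[of "W \<inter> N"] rat_points_subset[of W'] span1_subset_iff[OF N(1)]
      unfolding rat_points_def by blast
    have inj: "inj_on (join P) ?U" using inj_on_subset[OF bij_betw_imp_inj_on[OF bij(1)] sub] .
    have im: "join P ` ?U \<subseteq> covers P E" using bij_betw_imp_surj_on[OF bij(1)] sub by blast
    have "card K * card (join P ` ?U) + 1 \<le> x + CARD('a)"
    proof (rule excess_bound_subset[OF P E PE im])
      fix l assume "l \<in> join P ` ?U"
      then obtain Q where Q: "Q \<in> ?U" "l = join P Q" by blast
      have l: "l \<in> covers P E" using im Q by blast
      have "l \<inter> N = Q" using bij(4) Q sub by blast
      then have "vec.dim (W \<inter> l) = 2 \<or> vec.dim (Z \<inter> perp l) = 2" using long[OF l] long'[OF l] Q(1) by blast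
      then show "card K + 1 \<le> mult l"
        using point_form_mult[OF W covers_lines(1)[OF P' l]] plane_form_mult[OF Z covers_lines(1)[OF P' l]] by blast
    qed
    moreover have "2 * card K \<le> card (join P ` ?U)"
      unfolding card_image[OF inj] by (rule card_Un_of_rigid[OF K N(5) W' N(4) ne])
    then have "card K * (2 * card K) \<le> card K * card (join P ` ?U)" by (rule mult_le_mono2)
    ultimately have "card K * (2 * card K) + 1 \<le> x + CARD('a)" by linarith
    then show False using Kq xq by (simp add: power2_eq_square)
  qed
  then show ?thesis using long[OF l] long'[OF l] by simp
qed

text \<open>
  This is \<open>rational_flag\<close> for the orthogonal configuration, in which P and E, and hence W and Z, change roles.
\<close>
lemma rational_flag_dual:
  assumes P: "P \<in> S" and E: "E \<in> T" and W: "point_form E W" and Z: "plane_form P Z"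
    and EZ: "perp E \<in> rat_points Z"
  shows "P \<in> rat_points W"
proof -
  interpret d: baer_config K "perp ` T" "perp ` S" x by (rule dual)
  have pE: "perp (perp E) = E" "perp (perp P) = P"
    using T_planes[OF E] S_points[OF P] by (simp_all add: perp_perp proj_planesD proj_pointsD)
  have "perp ` perp ` S = S" using S_points by (force simp: image_image perp_perp proj_pointsD)
  then have "d.plane_form (perp E) W" "d.point_form (perp P) Z"
    using W Z pE by (auto simp: d.plane_form_def d.point_form_def point_form_def plane_form_def)
  then have "perp (perp P) \<in> rat_points W" using P E EZ by (intro d.rational_flag[of "perp E" "perp P"]) auto
  then show ?thesis using pE by simp
qed

end

context baer_config
begin

text \<open>
  Otherwise each of the s + 1 rational lines l through P would carry a second Baer subline, coming from
  another plane through l that is rational in the star of P. Then l has at least 2s points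
  of S, and the excess is at least \<open>(s + 1) * (2 * s - 1)\<close>, which exceeds 2q - 1.
\<close>
lemma common_subline:
  assumes WW: "\<And>E. E \<in> T \<Longrightarrow> point_form E (WW E)" and ZZ: "\<And>P. P \<in> S \<Longrightarrow> plane_form P (ZZ P)"
    and P: "P \<in> S" and E: "E \<in> T" and PW: "P \<in> rat_points (WW E)"
  obtains l F where "l \<in> proj_lines" "l \<subseteq> E" "l \<subseteq> F" "F \<in> T" "F \<noteq> E"
    "vec.dim (WW E \<inter> l) = 2" "vec.dim (WW F \<inter> l) = 2" "rat_points (WW E \<inter> l) = rat_points (WW F \<inter> l)"
proof (rule ccontr)
  assume none: "\<not> thesis"
  note P' = S_points[OF P] and E' = T_planes[OF E]
  note W = WW[OF E] and Z = ZZ[OF P]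
  have kW: "kform K (WW E) E" using W by (simp add: point_form_def)
  have kZ: "kform K (ZZ P) (perp P)" using Z by (simp add: plane_form_def)
  have PE: "P \<subseteq> E"
    using PW kform_subset[OF kW] span1_subset_iff[OF proj_planesD(1)[OF E']] by (auto simp: rat_points_def)
  let ?L = "{l \<in> covers P E. vec.dim (WW E \<inter> l) = 2}"
  have cL: "card ?L = card K + 1" by (rule card_rational_pencil[OF K kW proj_planesD(2)[OF E'] PW])
  have "(2 * card K - 1) * card ?L + 1 \<le> x + CARD('a)"
  proof (rule excess_bound_subset[OF P E PE])
    fix l assume "l \<in> ?L"
    then have l: "l \<in> covers P E" and dW: "vec.dim (WW E \<inter> l) = 2" by auto
    note l' = covers_lines[OF P' l]
    have dZ: "vec.dim (ZZ P \<inter> perp l) = 2" using rational_pencils_agree[OF P E W Z PW l] dW by simp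
    have dl: "vec.dim (perp l) = 2" using dim_perp[OF l'(4)] l'(5) by simp
    have "kform K (ZZ P \<inter> perp l) (perp l)"
      using kform_full_dim[OF K kZ subspace_perp, of l] dZ dl by simp
    then have "card (rat_points (ZZ P \<inter> perp l)) = card K + 1" using card_rat_points(3)[OF K] dl by blast
    then have "\<not> rat_points (ZZ P \<inter> perp l) \<subseteq> {perp E}"
      using card_mono[of "{perp E}" "rat_points (ZZ P \<inter> perp l)"] s_ge_2 by auto
    then obtain R where R: "R \<in> rat_points (ZZ P \<inter> perp l)" "R \<noteq> perp E" by blast
    define F where "F = perp R"
    have F: "F \<in> T" "l \<subseteq> F" using plane_form_planes[OF Z l'(4)] R(1) by (auto simp: F_def)
    have "R \<in> proj_points" using R(1) rat_points_subset[of "ZZ P \<inter> perp l"] by blast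
    then have RF: "R = perp F" by (simp add: F_def perp_perp proj_pointsD)
    have FE: "F \<noteq> E" using R(2) RF by blast
    have RZ: "perp F \<in> rat_points (ZZ P)" using R(1) RF by (auto simp: rat_points_def)
    have PF: "P \<in> rat_points (WW F)" by (rule rational_flag_dual[OF P F(1) WW[OF F(1)] Z RZ])
    have lF: "l \<in> covers P F" using l F(2) by (simp add: covers_def)
    have dF: "vec.dim (WW F \<inter> l) = 2" using rational_pencils_agree[OF P F(1) WW[OF F(1)] Z PF lF] dZ by simp
    have kF: "kform K (WW F) F" using WW[OF F(1)] by (simp add: point_form_def)
    have ne: "rat_points (WW E \<inter> l) \<noteq> rat_points (WW F \<inter> l)"
      using none that[OF l'(1,3) F(2,1) FE dW dF] by blast
    have "2 * card K \<le> card (rat_points (WW E \<inter> l) \<union> rat_points (WW F \<inter> l))"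
      by (rule card_Un_of_rigid[OF K _ _ l'(5) ne])
        (use kform_full_dim[OF K kW l'(4)] kform_full_dim[OF K kF l'(4)] dW dF l'(5) in auto)
    also have "\<dots> \<le> mult l"
    proof (rule card_mono[OF finite])
      show "rat_points (WW E \<inter> l) \<union> rat_points (WW F \<inter> l) \<subseteq> {Q \<in> S. Q \<subseteq> l}"
        using W WW[OF F(1)] unfolding rat_points_Int[OF l'(4)] point_form_def by blast
    qed
    finally show "2 * card K - 1 + 1 \<le> mult l" using s_ge_2 by simp
  qed auto
  moreover obtain t where "card K = Suc t" using s_ge_2 by (cases "card K") auto
  ultimately show False using cL Kq xq by (simp add: power2_eq_square)
qed

lemma Int_planes:
  fixes E F :: "('a ^ 4) set"
  assumes "E \<in> proj_planes" "F \<in> proj_planes" "E \<noteq> F"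
  shows "E \<inter> F \<in> proj_lines" "join E F = UNIV"
proof -
  note E = proj_planesD[OF assms(1)] and F = proj_planesD[OF assms(2)]
  have "\<not> E \<subseteq> F" using subspace_eqI[OF E(1) F(1)] E(2) F(2) assms(3) by auto
  then have "vec.dim (E \<inter> F) < 3" using dim_Int_less[OF E(1) F(1)] E(2) by simp
  moreover have "vec.dim (join E F) \<le> 4" using vec.dim_subset[OF subset_UNIV, of "join E F"] dim_UNIV4[where 'a = 'a] by simp
  ultimately have d: "vec.dim (E \<inter> F) = 2" "vec.dim (join E F) = 4"
    using dim_join[OF E(1) F(1)] E(2) F(2) by linarith+
  show "E \<inter> F \<in> proj_lines" using d E F by (simp add: proj_lines_def vec.subspace_inter)
  show "join E F = UNIV" by (rule subspace_eqI) (use d dim_UNIV4[where 'a = 'a] in auto)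
qed

lemma Int_line_eq:
  fixes E F l :: "('a ^ 4) set"
  assumes "E \<in> proj_planes" "F \<in> proj_planes" "E \<noteq> F" "l \<in> proj_lines" "l \<subseteq> E" "l \<subseteq> F"
  shows "E \<inter> F = l"
  using Int_planes(1)[OF assms(1-3)] assms(4-6)
  by (intro subspace_eqI[symmetric]) (auto simp: proj_lines_def)

text \<open>
  The two forms meet in their trace on l, which has \<open>s\<^sup>2\<close> elements, so their sum has
  \<open>s\<^sup>3 * s\<^sup>3 / s\<^sup>2 = s\<^sup>4\<close> elements.
\<close>
lemma kform_sum:
  fixes W0 W1 :: "('a ^ 4) set"
  assumes W0: "kform K W0 E" and W1: "kform K W1 F" and EF: "E \<in> proj_planes" "F \<in> proj_planes" "E \<noteq> F"
    and l: "l = E \<inter> F" and W01: "W0 \<inter> l = W1 \<inter> l" and d: "vec.dim (W0 \<inter> l) = 2"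
  defines "W \<equiv> (\<lambda>(a, b). a - b) ` (W0 \<times> W1)"
  shows "kform K W UNIV" "W \<inter> E = W0" "W \<inter> F = W1"
proof -
  note E = proj_planesD[OF EF(1)] and F = proj_planesD[OF EF(2)]
  have ks: "ksubspace K W0" "ksubspace K W1" using W0 W1 by (auto simp: kform_def)
  have z: "0 \<in> W0" "0 \<in> W1" using ks by (auto simp: ksubspace_def)
  have sub: "W0 \<subseteq> W" "W1 \<subseteq> W"
  proof -
    show "W0 \<subseteq> W" unfolding W_def using z(2) by (auto intro!: image_eqI[where x = "(_, 0)"])
    show "W1 \<subseteq> W"
    proof
      fix b assume "b \<in> W1"
      then have "- b \<in> W1" using ksubspace_diff[OF K ks(2) z(2)] by fastforce
      then show "b \<in> W" unfolding W_def using z(1) by (auto intro!: image_eqI[where x = "(0, - b)"])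
    qed
  qed
  have ksW: "ksubspace K W"
    unfolding ksubspace_def
  proof (intro conjI ballI)
    show "0 \<in> W" using sub z by blast
  next
    fix u v assume "u \<in> W" "v \<in> W"
    then obtain a b a' b' where "u = a - b" "v = a' - b'" "a \<in> W0" "a' \<in> W0" "b \<in> W1" "b' \<in> W1"
      unfolding W_def by auto
    moreover then have "a + a' \<in> W0" "b + b' \<in> W1" using ks by (auto simp: ksubspace_def)
    ultimately show "u + v \<in> W"
      unfolding W_def by (intro image_eqI[where x = "(a + a', b + b')"]) auto
  next
    fix k u assume k: "k \<in> K" "u \<in> W"
    then obtain a b where "u = a - b" "a \<in> W0" "b \<in> W1" unfolding W_def by auto
    moreover then have "k *s a \<in> W0" "k *s b \<in> W1" using ks k by (auto simp: ksubspace_def)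
    ultimately show "k *s u \<in> W"
      unfolding W_def by (intro image_eqI[where x = "(k *s a, k *s b)"]) (auto simp: vec.scale_right_diff_distrib)
  qed
  have spW: "vec.span W = UNIV"
  proof -
    have "vec.span W0 \<subseteq> vec.span W" "vec.span W1 \<subseteq> vec.span W" using sub by (auto intro: vec.span_mono[THEN subsetD])
    then have "join E F \<subseteq> vec.span W" using W0 W1 by (intro join_least) (auto simp: kform_def)
    then show ?thesis using Int_planes(2)[OF EF] by auto
  qed
  have "W0 \<inter> W1 \<subseteq> l" using kform_subset[OF W0] kform_subset[OF W1] l by blast
  then have D: "W0 \<inter> W1 = W0 \<inter> l" using W01 by blast
  have "card (W0 \<inter> l) = card K ^ 2" using kform_Int[OF K W0, of l] d E(1) F(1) l by (simp add: kform_def vec.subspace_inter)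
  moreover have "card (W0 \<times> W1) = card W * card {p \<in> W0 \<times> W1. (case p of (a, b) \<Rightarrow> a - b) = 0}"
    unfolding W_def
    by (rule card_image_kernel) (auto simp: ksubspace_diff[OF K ks(1)] ksubspace_diff[OF K ks(2)])
  moreover have "{p \<in> W0 \<times> W1. (case p of (a, b) \<Rightarrow> a - b) = 0} = (\<lambda>a. (a, a)) ` (W0 \<inter> W1)" by auto
  moreover have "card ((\<lambda>a. (a, a)) ` (W0 \<inter> W1)) = card (W0 \<inter> W1)" by (rule card_image) (auto simp: inj_on_def)
  ultimately have "card W * card K ^ 2 = card K ^ 3 * card K ^ 3"
    using W0 W1 E(2) F(2) D by (simp add: card_cartesian_product kform_def)
  also have "\<dots> = card K ^ 4 * card K ^ 2" by (simp add: power_add[symmetric])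
  finally have cW: "card W = card K ^ 4" using s_ge_2 by (simp only: mult_cancel2) auto
  show kW: "kform K W UNIV" unfolding kform_def using ksW spW cW dim_UNIV4[where 'a = 'a] by simp
  have full: "W \<inter> X = W'" if X: "X \<in> proj_planes" and W': "kform K W' X" "W' \<subseteq> W" for X W'
  proof -
    note X' = proj_planesD[OF X]
    have "W' \<subseteq> W \<inter> X" using W' kform_subset[OF W'(1)] by blast
    moreover have "card (W \<inter> X) \<le> card W'"
    proof -
      have "vec.dim (W \<inter> X) \<le> 3" using vec.dim_subset[of "W \<inter> X" X] X'(2) by simp
      then have "card K ^ vec.dim (W \<inter> X) \<le> card K ^ 3" using s_ge_2 by (intro power_increasing) auto
      then show ?thesis using kform_Int[OF K kW X'(1)] W'(1) X'(2) by (simp add: kform_def)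
    qed
    ultimately show ?thesis by (intro card_seteq[symmetric]) auto
  qed
  show "W \<inter> E = W0" "W \<inter> F = W1" using full[OF EF(1) W0 sub(1)] full[OF EF(2) W1 sub(2)] by auto
qed

text \<open>
  Two Baer subplanes with a common subline on l generate a Baer subgeometry of the whole space. The local
  Baer subplanes of the quotients at the points of l force its planes off l into T; counting
  planes through a point forces its points into S, and counting points in a plane forces its
  remaining planes into T.
\<close>
lemma exists_baer_subgeometry:
  assumes WW: "\<And>E. E \<in> T \<Longrightarrow> point_form E (WW E)" and ZZ: "\<And>P. P \<in> S \<Longrightarrow> plane_form P (ZZ P)"
    and ne: "T \<noteq> {}"
  obtains W where "kform K W UNIV" "rat_points W \<subseteq> S" "{E \<in> proj_planes. vec.dim (W \<inter> E) = 3} \<subseteq> T"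
proof -
  obtain E0 where E0: "E0 \<in> T" using ne by blast
  note E0' = proj_planesD[OF T_planes[OF E0]]
  have k0: "kform K (WW E0) E0" "rat_points (WW E0) \<subseteq> S" using WW[OF E0] by (auto simp: point_form_def)
  have "card (rat_points (WW E0)) \<noteq> 0" using card_rat_points(4)[OF K k0(1) E0'(2)] by simp
  then obtain P0 where P0: "P0 \<in> rat_points (WW E0)" by fastforce
  then have P0S: "P0 \<in> S" using k0(2) by blast
  obtain l E1 where l: "l \<in> proj_lines" "l \<subseteq> E0" "l \<subseteq> E1" and E1: "E1 \<in> T" "E1 \<noteq> E0"
    and dl: "vec.dim (WW E0 \<inter> l) = 2" "vec.dim (WW E1 \<inter> l) = 2"
    and same: "rat_points (WW E0 \<inter> l) = rat_points (WW E1 \<inter> l)"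
    using common_subline[OF WW ZZ P0S E0 P0] .
  note l' = proj_linesD[OF l(1)] and E1' = proj_planesD[OF T_planes[OF E1(1)]]
  have k1: "kform K (WW E1) E1" "rat_points (WW E1) \<subseteq> S" using WW[OF E1(1)] by (auto simp: point_form_def)
  have kl: "kform K (WW E0 \<inter> l) l" "kform K (WW E1 \<inter> l) l"
    using kform_full_dim[OF K k0(1) l'(1)] kform_full_dim[OF K k1(1) l'(1)] dl l'(2) by auto
  have "3 \<le> card (rat_points (WW E1 \<inter> l) \<inter> rat_points (WW E0 \<inter> l))"
    using card_rat_points(3)[OF K kl(1) l'(2)] s_ge_2 same by simp
  then obtain a b c where abc: "{a, b, c} \<subseteq> rat_points (WW E1 \<inter> l) \<inter> rat_points (WW E0 \<inter> l)"
    "a \<noteq> b" "a \<noteq> c" "b \<noteq> c"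
    by (rule three_common_elements)
  obtain k where k: "k \<noteq> 0" "WW E0 \<inter> l = (*s) k ` (WW E1 \<inter> l)"
    by (rule kform_line_rigid[OF K kl(2,1) l'(2) abc])
  define W0 where "W0 = WW E0"
  (* The factor k makes the traces on l equal as sets of vectors, not only as sets of points. *)
  define W1 where "W1 = (*s) k ` WW E1"
  have kf1: "kform K W1 E1" unfolding W1_def by (rule kform_scale[OF k1(1) k(1)])
  have rat1: "rat_points W1 = rat_points (WW E1)" unfolding W1_def by (rule rat_points_scale[OF k(1)])
  have "W1 \<inter> l = (*s) k ` (WW E1 \<inter> l)"
  proof
    show "(*s) k ` (WW E1 \<inter> l) \<subseteq> W1 \<inter> l" unfolding W1_def using l'(1) by (auto intro: vec.subspace_scale)
    show "W1 \<inter> l \<subseteq> (*s) k ` (WW E1 \<inter> l)"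
    proof
      fix v assume v: "v \<in> W1 \<inter> l"
      then obtain w where w: "w \<in> WW E1" "v = k *s w" unfolding W1_def by blast
      then have "w = inverse k *s v" using k(1) by simp
      then have "w \<in> l" using v l'(1) by (auto intro: vec.subspace_scale)
      then show "v \<in> (*s) k ` (WW E1 \<inter> l)" using w by blast
    qed
  qed
  then have W01: "W0 \<inter> l = W1 \<inter> l" using k(2) by (simp add: W0_def)
  have El: "l = E0 \<inter> E1" using Int_line_eq[OF T_planes[OF E0] T_planes[OF E1(1)] E1(2)[symmetric] l] by simp
  define W where "W = (\<lambda>(a, b). a - b) ` (W0 \<times> W1)"
  have "kform K W0 E0" "vec.dim (W0 \<inter> l) = 2" using k0(1) dl(1) by (simp_all add: W0_def)
  note sum = kform_sum[OF this(1) kf1 T_planes[OF E0] T_planes[OF E1(1)] E1(2)[symmetric] El W01 this(2), folded W_def]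
  have pf: "point_form E0 W0" "point_form E1 W1"
    using WW[OF E0] kf1 k1(2) rat1 by (auto simp: point_form_def W0_def)
  have dWl: "vec.dim (W \<inter> l) = 2"
  proof -
    have "W \<inter> l = W0 \<inter> l" using sum(2) l(2) by blast
    then show ?thesis using dl(1) by (simp add: W0_def)
  qed
  (* A rational plane E not through l meets E0 and E1 in two rational lines through a point P of l.
     Both are rational in the star of P, hence so is the plane E that they span. *)
  have off: "E \<in> T" if E: "E \<in> proj_planes" "vec.dim (W \<inter> E) = 3" "\<not> l \<subseteq> E" for E
  proof -
    note E' = proj_planesD[OF E(1)]
    have "vec.dim (W \<inter> (E \<inter> l)) \<noteq> 0"
      using kform_grassmann[OF K sum(1) E'(1) l'(1)] E(2) dWl dim_UNIV4[where 'a = 'a] by (simp del: vec.dim_eq_0)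
    then obtain p where p: "p \<in> W" "p \<in> E" "p \<in> l" "p \<noteq> 0" by auto
    define P where "P = vec.span {p}"
    have PP: "P \<in> proj_points" unfolding P_def by (rule proj_point_span[OF p(4)])
    have P0: "P \<in> rat_points W0" "P \<in> rat_points W1"
      using p sum(2,3) l(2,3) unfolding P_def rat_points_def by blast+
    then have PS: "P \<in> S" using pf by (auto simp: point_form_def)
    have Psub: "P \<subseteq> E" "P \<subseteq> l" unfolding P_def using span1_subset_iff E'(1) l'(1) p by blast+
    note Z = ZZ[OF PS]
    have kZ: "kform K (ZZ P) (perp P)" "rat_points (ZZ P) \<subseteq> perp ` T" using Z by (auto simp: plane_form_def)
    have trace: "E \<inter> F \<in> proj_lines \<and> vec.dim (ZZ P \<inter> perp (E \<inter> F)) = 2"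
      if F: "F \<in> T" "point_form F WF" "W \<inter> F = WF" "l \<subseteq> F" "P \<in> rat_points WF" for F WF
    proof -
      note F' = proj_planesD[OF T_planes[OF F(1)]]
      have EF: "E \<noteq> F" using E(3) F(4) by blast
      note m = Int_planes(1)[OF E(1) T_planes[OF F(1)] EF]
      have "vec.dim (W \<inter> F) = 3"
        using F(2,3) vec.dim_span[of WF] F'(2) by (simp add: point_form_def kform_def)
      then have "2 \<le> vec.dim (W \<inter> (E \<inter> F))"
        using kform_grassmann[OF K sum(1) E'(1) F'(1)] E(2) dim_UNIV4[where 'a = 'a] by simp
      moreover have "vec.dim (W \<inter> (E \<inter> F)) \<le> vec.dim (E \<inter> F)" by (rule vec.dim_subset) blast
      moreover have "W \<inter> (E \<inter> F) = WF \<inter> (E \<inter> F)" using F(3) by blast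
      ultimately have d: "vec.dim (WF \<inter> (E \<inter> F)) = 2" using proj_linesD(2)[OF m] by simp
      have "E \<inter> F \<in> covers P F"
        using m Psub F(4) proj_pointsD(2)[OF PP] by (auto simp: covers_def proj_lines_def)
      then show ?thesis using rational_pencils_agree[OF PS F(1,2) Z F(5)] d m by blast
    qed
    have t0: "E \<inter> E0 \<in> proj_lines" "vec.dim (ZZ P \<inter> perp (E \<inter> E0)) = 2"
      using trace[OF E0 pf(1) sum(2) l(2) P0(1)] by auto
    have t1: "E \<inter> E1 \<in> proj_lines" "vec.dim (ZZ P \<inter> perp (E \<inter> E1)) = 2"
      using trace[OF E1(1) pf(2) sum(3) l(3) P0(2)] by auto
    have "vec.dim (ZZ P \<inter> (perp (E \<inter> E0) \<inter> perp (E \<inter> E1))) \<noteq> 0"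
      using kform_grassmann[OF K kZ(1) subspace_perp[of "E \<inter> E0"] subspace_perp[of "E \<inter> E1"]] t0(2) t1(2)
        dim_perp[OF proj_pointsD(1)[OF PP]] proj_pointsD(2)[OF PP] by (simp del: vec.dim_eq_0)
    then obtain z where z: "z \<in> ZZ P" "z \<in> perp (E \<inter> E0)" "z \<in> perp (E \<inter> E1)" "z \<noteq> 0" by auto
    have "join (E \<inter> E0) (E \<inter> E1) = E"
    proof (rule subspace_eqI)
      show "join (E \<inter> E0) (E \<inter> E1) \<subseteq> E" using E'(1) by (intro join_least) auto
      have "(E \<inter> E0) \<inter> (E \<inter> E1) = l \<inter> E" using El by blast
      moreover have "vec.dim (l \<inter> E) < 2" using dim_Int_less[OF l'(1) E'(1) E(3)] l'(2) by simp
      ultimately show "vec.dim E \<le> vec.dim (join (E \<inter> E0) (E \<inter> E1))"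
        using dim_join[OF proj_linesD(1)[OF t0(1)] proj_linesD(1)[OF t1(1)]]
          proj_linesD(2)[OF t0(1)] proj_linesD(2)[OF t1(1)] E'(2) by simp
    qed (use E'(1) in auto)
    then have "perp E = perp (E \<inter> E0) \<inter> perp (E \<inter> E1)" using perp_join[of "E \<inter> E0" "E \<inter> E1"] by simp
    then have "z \<in> perp E" using z by blast
    then have "perp E \<in> rat_points (ZZ P)"
      by (rule rat_pointsI[OF perp_points_planes(2)[OF E(1)] z(1,4)])
    then obtain F where F: "F \<in> T" "perp E = perp F" using kZ(2) by blast
    then have "perp (perp E) = perp (perp F)" by simp
    then have "E = F" by (simp only: perp_perp[OF E'(1)] perp_perp[OF proj_planesD(1)[OF T_planes[OF F(1)]]])
    then show "E \<in> T" using F(1) by simp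
  qed
  (* A rational point outside S and E0 would lie on the q + s rational planes that join it to the
     rational lines of E0 other than l, but only x planes of T pass through it. *)
  have points: "rat_points W \<subseteq> S"
  proof
    fix Y assume Y: "Y \<in> rat_points W"
    then have Y': "Y \<in> proj_points" using rat_points_subset[of W] by blast
    show "Y \<in> S"
    proof (cases "Y \<subseteq> E0")
      case True
      then have "Y \<in> rat_points (W \<inter> E0)" using Y rat_points_Int[OF E0'(1)] by blast
      then show ?thesis using sum(2) k0(2) by (auto simp: W0_def)
    next
      case False
      show ?thesis
      proof (rule ccontr)
        assume "Y \<notin> S"
        then have x: "card {E \<in> T. Y \<subseteq> E} = x" using cl_pairD(6)[OF cl Y'] by simp
        let ?A = "{m \<in> proj_lines. m \<subseteq> E0 \<and> vec.dim (W0 \<inter> m) = 2}"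
        have cA: "card ?A = card K ^ 2 + card K + 1"
          unfolding W0_def by (rule card_rational_lines[OF K k0(1) E0'(2)])
        have dm: "vec.dim (join m Y) = 3" if "m \<in> proj_lines" "m \<subseteq> E0" for m
        proof -
          have "vec.dim (m \<inter> Y) = 0"
          proof -
            have "\<not> Y \<subseteq> m" using False that(2) by blast
            then have "vec.dim (Y \<inter> m) < 1"
              using dim_Int_less[OF proj_pointsD(1)[OF Y'] proj_linesD(1)[OF that(1)]] proj_pointsD(2)[OF Y'] by simp
            then show ?thesis by (simp add: Int_commute)
          qed
          then show ?thesis
            using dim_join[OF proj_linesD(1)[OF that(1)] proj_pointsD(1)[OF Y']]
              proj_linesD(2)[OF that(1)] proj_pointsD(2)[OF Y'] by linarith
        qed
        have jm: "join m Y \<inter> E0 = m" if "m \<in> proj_lines" "m \<subseteq> E0" for m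
        proof -
          have pl: "join m Y \<in> proj_planes" using dm[OF that] by (simp add: proj_planes_def)
          have "join m Y \<noteq> E0" using False join_upper(2)[of Y m] by blast
          then show ?thesis
            using Int_line_eq[OF pl T_planes[OF E0] _ that(1) join_upper(1) that(2)] by blast
        qed
        have "join m Y \<in> {E \<in> T. Y \<subseteq> E}" if m: "m \<in> ?A - {l}" for m
        proof -
          have m': "m \<in> proj_lines" "m \<subseteq> E0" "vec.dim (W0 \<inter> m) = 2" "m \<noteq> l" using m by auto
          have "\<not> l \<subseteq> join m Y"
          proof
            assume "l \<subseteq> join m Y"
            then have "l \<subseteq> m" using jm[OF m'(1,2)] l(2) by blast
            then have "l = m" using l' proj_linesD[OF m'(1)] by (intro subspace_eqI) auto
            then show False using m'(4) by simp
          qed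
          moreover have "vec.dim (W \<inter> join m Y) = 3"
          proof (rule antisym)
            show "vec.dim (W \<inter> join m Y) \<le> 3"
              using vec.dim_subset[of "W \<inter> join m Y" "join m Y"] dm[OF m'(1,2)] by simp
            have "vec.span (W0 \<inter> m) = m"
              using kform_full_dim[OF K k0(1) proj_linesD(1)[OF m'(1)]] m'(3) proj_linesD(2)[OF m'(1)]
              by (simp add: kform_def W0_def)
            moreover have "W0 \<inter> m \<subseteq> W \<inter> join m Y" using sum(2) join_upper(1)[of m Y] by blast
            ultimately have "m \<subseteq> vec.span (W \<inter> join m Y)"
              using vec.span_mono[of "W0 \<inter> m" "W \<inter> join m Y"] by simp
            moreover have "Y \<subseteq> vec.span (W \<inter> join m Y)" by (rule span_Int_superset_point[OF Y join_upper(2)])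
            ultimately have "join m Y \<subseteq> vec.span (W \<inter> join m Y)" by (intro join_least) auto
            then have "vec.dim (join m Y) \<le> vec.dim (vec.span (W \<inter> join m Y))" by (rule vec.dim_subset)
            then show "3 \<le> vec.dim (W \<inter> join m Y)" using dm[OF m'(1,2)] by simp
          qed
          moreover have "join m Y \<in> proj_planes" using dm[OF m'(1,2)] by (simp add: proj_planes_def)
          ultimately show ?thesis using off join_upper(2)[of Y m] by blast
        qed
        then have "(\<lambda>m. join m Y) ` (?A - {l}) \<subseteq> {E \<in> T. Y \<subseteq> E}" by blast
        then have "card ((\<lambda>m. join m Y) ` (?A - {l})) \<le> x"
          using card_mono[OF finite, of "(\<lambda>m. join m Y) ` (?A - {l})" "{E \<in> T. Y \<subseteq> E}"] x by simp
        moreover have "inj_on (\<lambda>m. join m Y) (?A - {l})"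
          by (rule inj_on_inverseI[where g = "\<lambda>F. F \<inter> E0"]) (use jm in auto)
        ultimately have "card (?A - {l}) \<le> x" by (simp only: card_image)
        moreover have "card ?A - 1 \<le> card (?A - {l})" using diff_card_le_card_Diff[of "{l}" ?A] by simp
        ultimately show False using cA xq Kq s_ge_2 by linarith
      qed
    qed
  qed
  have planes: "{E \<in> proj_planes. vec.dim (W \<inter> E) = 3} \<subseteq> T"
  proof clarify
    fix E :: "('a ^ 4) set" assume E: "E \<in> proj_planes" "vec.dim (W \<inter> E) = 3"
    note E' = proj_planesD[OF E(1)]
    have "kform K (W \<inter> E) E" using kform_full_dim[OF K sum(1) E'(1)] E(2) E'(2) by simp
    then have "card (rat_points (W \<inter> E)) = card K ^ 2 + card K + 1" using card_rat_points(4)[OF K] E'(2) by blast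
    moreover have "rat_points (W \<inter> E) \<subseteq> {P \<in> S. P \<subseteq> E}"
      using points unfolding rat_points_Int[OF E'(1)] by blast
    then have "card (rat_points (W \<inter> E)) \<le> card {P \<in> S. P \<subseteq> E}" by (intro card_mono) auto
    ultimately show "E \<in> T" using cl_pairD(5)[OF cl E(1)] Kq xq s_ge_2 by (cases "E \<in> T") auto
  qed
  show ?thesis by (rule that[OF sum(1) points planes])
qed

end

section \<open>Existence and removal of a component\<close>

lemma cl_pair_diff:
  fixes S A :: "('a::{field,finite} ^ 4) set set"
  assumes c: "cl_pair S T x" and d: "cl_pair A B y" and sub: "A \<subseteq> S" "B \<subseteq> T"
  shows "y \<le> x" "cl_pair (S - A) (T - B) (x - y)"
proof -
  note C = cl_pairD[OF c] and D = cl_pairD[OF d]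
  have "card A \<le> card S" using sub(1) by (intro card_mono) auto
  then have "y * (CARD('a) + 1) \<le> x * (CARD('a) + 1)" unfolding C(3) D(3) .
  then show yx: "y \<le> x" by (rule mult_right_le_imp_le) simp
  show "cl_pair (S - A) (T - B) (x - y)"
  proof (rule cl_pairI)
    show "S - A \<subseteq> proj_points" "T - B \<subseteq> proj_planes" using C(1,2) by blast+
    show "card (S - A) = (x - y) * (CARD('a) + 1)"
      by (simp only: card_Diff_subset[OF finite sub(1)] C(3) D(3) diff_mult_distrib)
    fix E :: "('a ^ 4) set" assume E: "E \<in> proj_planes"
    have "{P \<in> S - A. P \<subseteq> E} = {P \<in> S. P \<subseteq> E} - {P \<in> A. P \<subseteq> E}" by blast
    moreover have "{P \<in> A. P \<subseteq> E} \<subseteq> {P \<in> S. P \<subseteq> E}" using sub(1) by blast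
    ultimately have "card {P \<in> S - A. P \<subseteq> E} = card {P \<in> S. P \<subseteq> E} - card {P \<in> A. P \<subseteq> E}"
      by (simp add: card_Diff_subset)
    then show "card {P \<in> S - A. P \<subseteq> E} = x - y + (if E \<in> T - B then CARD('a) else 0)"
      using C(5)[OF E] D(5)[OF E] sub(2) yx by auto
  qed
qed

definition component :: "('a::{field,finite} ^ 4) set set \<Rightarrow> ('a ^ 4) set set \<Rightarrow> nat \<Rightarrow> bool" where
  "component A B y \<longleftrightarrow>
     (\<exists>l\<in>proj_lines. A = pts l \<and> B = {E \<in> proj_planes. l \<subseteq> E} \<and> y = 1) \<or>
     (\<exists>K W. subfield_set K \<and> (card K)\<^sup>2 = CARD('a) \<and> kform K W UNIV \<and>
        A = rat_points W \<and> B = {E \<in> proj_planes. vec.dim (W \<inter> E) = 3} \<and> y = card K + 1)"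

lemma cl_pair_line:
  fixes l :: "('a::{field,finite} ^ 4) set"
  assumes l: "l \<in> proj_lines"
  shows "cl_pair (pts l) {E \<in> proj_planes. l \<subseteq> E} 1"
proof (rule cl_pairI)
  note l' = proj_linesD[OF l]
  show "card (pts l) = 1 * (CARD('a) + 1)" using card_pts(1)[OF l'] by simp
  fix E :: "('a ^ 4) set" assume E: "E \<in> proj_planes"
  note E' = proj_planesD[OF E]
  have sub: "vec.subspace (l \<inter> E)" using l'(1) E'(1) by (simp add: vec.subspace_inter)
  have eq: "{P \<in> pts l. P \<subseteq> E} = rat_points (l \<inter> E)" unfolding rat_points_subspace[OF sub] by auto
  show "card {P \<in> pts l. P \<subseteq> E} = 1 + (if E \<in> {E \<in> proj_planes. l \<subseteq> E} then CARD('a) else 0)"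
  proof (cases "l \<subseteq> E")
    case True
    then have "l \<inter> E = l" by blast
    then show ?thesis unfolding eq using True E card_rat_points(3)[OF subfield_UNIV kform_UNIV[OF l'(1)] l'(2)] by simp
  next
    case False
    have "vec.dim (join l E) \<le> 4" using vec.dim_subset[OF subset_UNIV, of "join l E"] dim_UNIV4[where 'a = 'a] by simp
    then have "vec.dim (l \<inter> E) = 1"
      using dim_Int_less[OF l'(1) E'(1) False] dim_join[OF l'(1) E'(1)] l'(2) E'(2) by linarith
    then show ?thesis unfolding eq using False card_rat_points(2)[OF subfield_UNIV kform_UNIV[OF sub]] by simp
  qed
qed auto

text \<open>
  One linear condition over the large field costs at most two dimensions over K, so the rational points of a
  plane form a Baer subline or a Baer subplane.
\<close>
lemma baer_plane_dim:
  fixes W :: "('a::{field,finite} ^ 4) set"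
  assumes K: "subfield_set K" "(card K)\<^sup>2 = CARD('a)" and W: "kform K W UNIV" and E: "E \<in> proj_planes"
  shows "vec.dim (W \<inter> E) = 2 \<or> vec.dim (W \<inter> E) = 3"
proof -
  note E' = proj_planesD[OF E]
  have "vec.dim (W \<inter> E) \<le> 3" using vec.dim_subset[of "W \<inter> E" E] E'(2) by simp
  moreover have "2 \<le> vec.dim (W \<inter> E)"
    using kform_dim_Int_ge[OF K W E'(1) subset_UNIV] E'(2) dim_UNIV4[where 'a = 'a] by simp
  ultimately show ?thesis by linarith
qed

lemma cl_pair_baer:
  fixes W :: "('a::{field,finite} ^ 4) set"
  assumes K: "subfield_set K" "(card K)\<^sup>2 = CARD('a)" and W: "kform K W UNIV"
  shows "cl_pair (rat_points W) {E \<in> proj_planes. vec.dim (W \<inter> E) = 3} (card K + 1)"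
proof (rule cl_pairI)
  show "rat_points W \<subseteq> proj_points" by (rule rat_points_subset)
  show "card (rat_points W) = (card K + 1) * (CARD('a) + 1)"
    using card_rat_points(5)[OF K(1) W dim_UNIV4] K(2) by simp
  fix E :: "('a ^ 4) set" assume E: "E \<in> proj_planes"
  note E' = proj_planesD[OF E]
  have eq: "{P \<in> rat_points W. P \<subseteq> E} = rat_points (W \<inter> E)" by (rule rat_points_Int[OF E'(1), symmetric])
  note form = kform_Int[OF K(1) W E'(1)]
  show "card {P \<in> rat_points W. P \<subseteq> E} =
      card K + 1 + (if E \<in> {E \<in> proj_planes. vec.dim (W \<inter> E) = 3} then CARD('a) else 0)"
    using baer_plane_dim[OF K W E]
  proof
    assume "vec.dim (W \<inter> E) = 2"
    then show ?thesis unfolding eq using card_rat_points(3)[OF K(1) form] by simp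
  next
    assume "vec.dim (W \<inter> E) = 3"
    then show ?thesis unfolding eq using card_rat_points(4)[OF K(1) form] K(2) E by simp
  qed
qed auto

lemma component_cl_pair: "component A B y \<Longrightarrow> cl_pair A B y"
  unfolding component_def using cl_pair_line cl_pair_baer by blast

lemma component_pos: "component A B y \<Longrightarrow> 1 \<le> y"
  unfolding component_def by auto

text \<open>
  The minimality hypothesis on blocking sets in a form that is inherited by smaller parameters.
\<close>
definition blocking_bound :: "'a::{field,finite} itself \<Rightarrow> nat \<Rightarrow> bool" where
  "blocking_bound _ n \<longleftrightarrow> (\<forall>B :: ('a ^ 3) set set. blocking_set B \<and> card B \<le> n \<longrightarrow>
     (\<exists>l\<in>proj_lines. pts l \<subseteq> B) \<or> contains_baer_subplane B)"

text \<open>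
  Every line of a plane E of T meets S, since it lies on a plane of T.
  So the x + q points of S in E form a blocking set of E.
\<close>
lemma plane_contains_line_or_baer:
  fixes S :: "('a::{field,finite} ^ 4) set set"
  assumes c: "cl_pair S T x" and H: "blocking_bound TYPE('a) (x + CARD('a))" and E: "E \<in> T"
  shows "(\<exists>l\<in>proj_lines. pts l \<subseteq> S) \<or>
    (\<exists>K W. subfield_set K \<and> (card K)\<^sup>2 = CARD('a) \<and> kform K W E \<and> rat_points W \<subseteq> S)"
proof -
  note D = cl_pairD[OF c]
  have EP: "E \<in> proj_planes" using E D(2) by blast
  note E' = proj_planesD[OF EP]
  have "vec.dim E = CARD(3)" using E'(2) by simp
  from kform_matrix[OF subfield_UNIV kform_UNIV[OF E'(1)] this]
  obtain M :: "'a ^ 3 ^ 4" where inj: "inj ((*v) M)" and M: "range ((*v) M) = E"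
    and "(*v) M ` rat_vectors UNIV = E" .
  let ?f = "\<lambda>P. (*v) M ` P"
  have injf: "inj ?f" by (rule injI) (simp only: inj_image_eq_iff[OF inj])
  have pre: "\<exists>Q\<in>proj_points. P = ?f Q" if P: "P \<in> proj_points" "P \<subseteq> E" for P
  proof -
    have P_eq: "P = ?f ((*v) M -` P)" using P(2) M by blast
    have "vec.subspace ((*v) M -` P)" by (rule vec.subspace_vimage) (rule proj_pointsD(1)[OF P(1)])
    moreover have "vec.dim ((*v) M -` P) = 1"
      using dim_matrix_image[OF inj, of "(*v) M -` P"] arg_cong[OF P_eq, of vec.dim] proj_pointsD(2)[OF P(1)] by linarith
    ultimately show ?thesis unfolding proj_points_def using P_eq by blast
  qed
  have img_points: "?f P \<in> proj_points" if "P \<in> proj_points" for P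
    using that by (simp add: proj_points_def subspace_matrix_image dim_matrix_image inj)
  have img_lines: "?f l \<in> proj_lines" "?f l \<subseteq> E" if "l \<in> proj_lines" for l
    using that M by (auto simp: proj_lines_def subspace_matrix_image dim_matrix_image inj)
  define B where "B = {P \<in> proj_points. ?f P \<in> S}"
  have "?f ` B \<subseteq> {P \<in> S. P \<subseteq> E}" using M by (auto simp: B_def)
  then have "card (?f ` B) \<le> card {P \<in> S. P \<subseteq> E}" by (rule card_mono[OF finite])
  then have cB: "card B \<le> x + CARD('a)"
    using D(5)[OF EP] E card_image[OF inj_on_subset[OF injf subset_UNIV, of B]] by simp
  have "blocking_set B"
    unfolding blocking_set_def
  proof (intro conjI ballI)
    fix l :: "('a ^ 3) set" assume l: "l \<in> proj_lines"
    note l' = img_lines[OF l]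
    have "E \<in> {F \<in> T. ?f l \<subseteq> F}" using E l'(2) by blast
    then have "card {F \<in> T. ?f l \<subseteq> F} \<noteq> 0" by auto
    then have "card {P \<in> S. P \<subseteq> ?f l} \<noteq> 0" using D(7)[OF l'(1)] by simp
    then have "{P \<in> S. P \<subseteq> ?f l} \<noteq> {}" by (intro notI) (simp only: card.empty)
    then obtain P where P: "P \<in> S" "P \<subseteq> ?f l" by blast
    then obtain Q where Q: "Q \<in> proj_points" "P = ?f Q" using pre[of P] D(1) l'(2) by blast
    then have "Q \<subseteq> l" using P(2) inj by (simp add: inj_image_subset_iff)
    then show "\<exists>Q\<in>B. Q \<subseteq> l" using Q P(1) by (auto simp: B_def)
  qed (auto simp: B_def)
  then consider l where "l \<in> proj_lines" "pts l \<subseteq> B" | "contains_baer_subplane B"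
    using H cB unfolding blocking_bound_def by blast
  then show ?thesis
  proof cases
    case 1
    have "pts (?f l) \<subseteq> S"
    proof
      fix P assume P: "P \<in> pts (?f l)"
      then obtain Q where Q: "Q \<in> proj_points" "P = ?f Q" using pre[of P] img_lines(2)[OF 1(1)] by blast
      then have "Q \<subseteq> l" using P inj by (simp add: inj_image_subset_iff)
      then have "Q \<in> B" using 1(2) Q(1) by blast
      then show "P \<in> S" using Q(2) by (simp add: B_def)
    qed
    then show ?thesis using img_lines(1)[OF 1(1)] by blast
  next
    case 2
    then obtain R where R: "baer_subgeometry R" "R \<subseteq> B" unfolding contains_baer_subplane_def by blast
    then have "baer_subplane_of E (?f ` R)" unfolding baer_subplane_of_def using inj M by blast
    then obtain K W where KW: "subfield_set K" "(card K)\<^sup>2 = CARD('a)" "kform K W E" "?f ` R = rat_points W"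
      by (rule baer_subplane_ofD)
    have "?f ` R \<subseteq> S" using R(2) by (auto simp: B_def)
    then have "rat_points W \<subseteq> S" using KW(4) by simp
    then show ?thesis using KW(1-3) by blast
  qed
qed

text \<open>
  A line carries as many points of S as it lies on planes of T, and both numbers have the same maximum q + 1.
\<close>
lemma full_line_planes:
  fixes S :: "('a::{field,finite} ^ 4) set set"
  assumes c: "cl_pair S T x" and l: "l \<in> proj_lines"
  shows "pts l \<subseteq> S \<longleftrightarrow> {E \<in> proj_planes. l \<subseteq> E} \<subseteq> T"
proof -
  note D = cl_pairD[OF c] and l' = proj_linesD[OF l]
  have cP: "card (pts l) = CARD('a) + 1" by (rule card_pts(1)[OF l'])
  have cE: "card {E \<in> proj_planes. l \<subseteq> E} = CARD('a) + 1"
    unfolding covers_line[OF l'(2), symmetric] by (rule card_covers(1)) (use l' dim_UNIV4[where 'a = 'a] in auto)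
  have "pts l \<subseteq> S \<longleftrightarrow> card {P \<in> S. P \<subseteq> l} = CARD('a) + 1"
  proof
    assume "pts l \<subseteq> S"
    then have "{P \<in> S. P \<subseteq> l} = pts l" using D(1) by blast
    then show "card {P \<in> S. P \<subseteq> l} = CARD('a) + 1" using cP by simp
  next
    assume "card {P \<in> S. P \<subseteq> l} = CARD('a) + 1"
    then have "{P \<in> S. P \<subseteq> l} = pts l" using cP D(1) by (intro card_subset_eq) auto
    then show "pts l \<subseteq> S" by blast
  qed
  moreover have "{E \<in> proj_planes. l \<subseteq> E} \<subseteq> T \<longleftrightarrow> card {E \<in> T. l \<subseteq> E} = CARD('a) + 1"
  proof
    assume "{E \<in> proj_planes. l \<subseteq> E} \<subseteq> T"
    then have "{E \<in> T. l \<subseteq> E} = {E \<in> proj_planes. l \<subseteq> E}" using D(2) by blast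
    then show "card {E \<in> T. l \<subseteq> E} = CARD('a) + 1" using cE by simp
  next
    assume "card {E \<in> T. l \<subseteq> E} = CARD('a) + 1"
    then have "{E \<in> T. l \<subseteq> E} = {E \<in> proj_planes. l \<subseteq> E}" using cE D(2) by (intro card_subset_eq) auto
    then show "{E \<in> proj_planes. l \<subseteq> E} \<subseteq> T" by blast
  qed
  ultimately show ?thesis using D(7)[OF l] by simp
qed

text \<open>
  If S contains no line, then every plane of T has a Baer subplane of points of S, and by duality every point of S
  has a Baer subplane of planes of T in its quotient.
\<close>
lemma exists_component:
  fixes S :: "('a::{field,finite} ^ 4) set set"
  assumes c: "cl_pair S T x" and x: "x \<noteq> 0" "x \<le> CARD('a)"
    and H: "blocking_bound TYPE('a) (x + CARD('a))"
  obtains A B y where "component A B y" "A \<subseteq> S" "B \<subseteq> T"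
proof (cases "\<exists>l\<in>proj_lines. pts l \<subseteq> S")
  case True
  then obtain l where l: "l \<in> proj_lines" "pts l \<subseteq> S" by blast
  have "component (pts l) {E \<in> proj_planes. l \<subseteq> E} 1" unfolding component_def using l(1) by blast
  then show ?thesis using that l full_line_planes[OF c l(1)] by blast
next
  case False
  note D = cl_pairD[OF c]
  have pair_dual: "cl_pair (perp ` T) (perp ` S) x" by (rule cl_pair_dual[OF c])
  have noline': "\<not> (\<exists>l\<in>proj_lines. pts l \<subseteq> perp ` T)"
  proof
    assume "\<exists>l\<in>proj_lines. pts l \<subseteq> perp ` T"
    then obtain l where l: "l \<in> proj_lines" "pts l \<subseteq> perp ` T" by blast
    note l' = proj_linesD[OF l(1)]
    have "{E \<in> proj_planes. perp l \<subseteq> E} \<subseteq> T"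
    proof clarify
      fix E :: "('a ^ 4) set" assume E: "E \<in> proj_planes" "perp l \<subseteq> E"
      have "perp E \<in> pts l" using perp_points_planes(2)[OF E(1)] perp_mono[OF E(2)] perp_perp[OF l'(1)] by simp
      then obtain F where F: "F \<in> T" "perp E = perp F" using l(2) by blast
      have "perp (perp E) = perp (perp F)" using F(2) by simp
      then have "E = F" using E(1) F(1) D(2) by (simp add: perp_perp proj_planesD subset_iff)
      then show "E \<in> T" using F(1) by simp
    qed
    then have "pts (perp l) \<subseteq> S" using full_line_planes[OF c perp_points_planes(3)[OF l(1)]] by simp
    then show False using False perp_points_planes(3)[OF l(1)] by blast
  qed
  have baer: "\<exists>K W. subfield_set K \<and> (card K)\<^sup>2 = CARD('a) \<and> kform K W E \<and> rat_points W \<subseteq> S" if "E \<in> T" for E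
    using plane_contains_line_or_baer[OF c H that] False by blast
  have baer': "\<exists>K W. subfield_set K \<and> (card K)\<^sup>2 = CARD('a) \<and> kform K W (perp P) \<and> rat_points W \<subseteq> perp ` T"
    if "P \<in> S" for P
    using plane_contains_line_or_baer[OF pair_dual H imageI[OF that]] noline' by blast
  have "card T \<noteq> 0" using D(4) x(1) by simp
  then have ne: "T \<noteq> {}" by auto
  then obtain E where "E \<in> T" by blast
  from baer[OF this] obtain K :: "'a set" where K: "subfield_set K" "(card K)\<^sup>2 = CARD('a)" by blast
  have uniq: "K' = K" if "subfield_set K'" "(card K')\<^sup>2 = CARD('a)" for K'
    by (rule subfield_unique) (use that K power2_eq_imp_eq[of "card K'" "card K"] in auto)
  interpret baer_config K S T x using K c x(2) by unfold_locales
  have "\<forall>E\<in>T. \<exists>W. point_form E W" using baer uniq unfolding point_form_def by blast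
  then obtain WW where WW: "\<forall>E\<in>T. point_form E (WW E)" by (rule bchoice[THEN exE])
  have "\<forall>P\<in>S. \<exists>Z. plane_form P Z" using baer' uniq unfolding plane_form_def by blast
  then obtain ZZ where ZZ: "\<forall>P\<in>S. plane_form P (ZZ P)" by (rule bchoice[THEN exE])
  obtain W where W: "kform K W UNIV" "rat_points W \<subseteq> S" "{E \<in> proj_planes. vec.dim (W \<inter> E) = 3} \<subseteq> T"
    using exists_baer_subgeometry[OF bspec[OF WW] bspec[OF ZZ] ne] .
  have "component (rat_points W) {E \<in> proj_planes. vec.dim (W \<inter> E) = 3} (card K + 1)"
    unfolding component_def using K Kq W(1) by blast
  then show ?thesis using that W(2,3) by blast
qed

section \<open>Weights on lines\<close>

lemma sum_weight_swap:
  fixes f :: "'l \<Rightarrow> real"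
  assumes "finite A" "finite L"
  shows "(\<Sum>P\<in>A. \<Sum>l\<in>{l \<in> L. R P l}. f l) = (\<Sum>l\<in>L. f l * real (card {P \<in> A. R P l}))"
proof -
  have "(\<Sum>P\<in>A. \<Sum>l\<in>{l \<in> L. R P l}. f l) = (\<Sum>l\<in>L. \<Sum>P\<in>{P \<in> A. R P l}. f l)"
    by (rule sum.swap_restrict[OF assms])
  then show ?thesis by (simp add: mult.commute)
qed

lemma sum_indicator_card:
  assumes "finite A"
  shows "(\<Sum>P\<in>A. indicator S P :: real) = real (card {P \<in> S. P \<in> A})"
proof -
  have "(\<Sum>P\<in>A. indicator S P :: real) = real (card (A \<inter> S))"
    using assms by (simp add: sum.inter_restrict[symmetric] indicator_def of_bool_def if_distrib Int_def flip: card_eq_sum)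
  then show ?thesis by (simp add: Int_def conj_commute)
qed

text \<open>
  If point and plane indicators come from the same weights on the lines, summing over the points of a plane E
  counts the lines of E with factor q + 1 and all other lines once.
\<close>
lemma cl_pair_of_weights:
  fixes S T :: "('a::{field,finite} ^ 4) set set" and f :: "('a ^ 4) set \<Rightarrow> real"
  assumes S: "S \<subseteq> proj_points" and T: "T \<subseteq> proj_planes"
    and fS: "\<And>P. P \<in> proj_points \<Longrightarrow> indicator S P = (\<Sum>l\<in>{l \<in> proj_lines. P \<subseteq> l}. f l)"
    and fT: "\<And>E. E \<in> proj_planes \<Longrightarrow> indicator T E = (\<Sum>l\<in>{l \<in> proj_lines. l \<subseteq> E}. f l)"
  obtains x where "cl_pair S T x"
proof -
  let ?q = "CARD('a)" and ?L = "proj_lines :: ('a ^ 4) set set"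
  define x where "x = (\<Sum>l\<in>?L. f l)"
  have cS: "real (card S) = x * (?q + 1)"
  proof -
    have "real (card S) = (\<Sum>P\<in>proj_points. indicator S P)"
      unfolding sum_indicator_card[OF finite] using S by (auto intro: arg_cong[where f = card])
    also have "\<dots> = (\<Sum>P\<in>proj_points. \<Sum>l\<in>{l \<in> ?L. P \<subseteq> l}. f l)" by (rule sum.cong) (use fS in auto)
    also have "\<dots> = (\<Sum>l\<in>?L. f l * real (card {P \<in> proj_points. P \<subseteq> l}))" by (rule sum_weight_swap) auto
    also have "\<dots> = (\<Sum>l\<in>?L. f l * (?q + 1))"
    proof (rule sum.cong[OF refl])
      fix l assume "l \<in> ?L"
      then show "f l * real (card (pts l)) = f l * (?q + 1)"
        using card_pts(1)[of l] by (simp add: proj_lines_def)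
    qed
    finally show ?thesis by (simp add: x_def sum_distrib_right)
  qed
  have plane: "real (card {P \<in> S. P \<subseteq> E}) = x + (if E \<in> T then ?q else 0)" if E: "E \<in> proj_planes" for E
  proof -
    have "real (card {P \<in> S. P \<subseteq> E}) = (\<Sum>P\<in>pts E. indicator S P)"
      unfolding sum_indicator_card[OF finite] using S by (auto intro!: arg_cong[where f = card])
    also have "\<dots> = (\<Sum>P\<in>pts E. \<Sum>l\<in>{l \<in> ?L. P \<subseteq> l}. f l)" by (rule sum.cong) (use fS in auto)
    also have "\<dots> = (\<Sum>l\<in>?L. f l * real (card {P \<in> pts E. P \<subseteq> l}))" by (rule sum_weight_swap) auto
    also have "\<dots> = (\<Sum>l\<in>?L. f l + (if l \<subseteq> E then ?q * f l else 0))"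
    proof (rule sum.cong[OF refl])
      fix l assume l: "l \<in> ?L"
      have "{P \<in> pts E. P \<subseteq> l} = {P \<in> pts l. P \<subseteq> E}" by blast
      then show "f l * real (card {P \<in> pts E. P \<subseteq> l}) = f l + (if l \<subseteq> E then ?q * f l else 0)"
        using cl_pairD(5)[OF cl_pair_line[OF l] E] E by (simp add: algebra_simps)
    qed
    also have "\<dots> = x + ?q * (\<Sum>l\<in>{l \<in> ?L. l \<subseteq> E}. f l)"
      by (simp add: x_def sum.distrib sum_distrib_left sum.inter_filter[symmetric])
    also have "(\<Sum>l\<in>{l \<in> ?L. l \<subseteq> E}. f l) = indicator T E" using fT[OF E] by simp
    finally show ?thesis by (simp add: indicator_def)
  qed
  have "0 \<le> x * (?q + 1)" using cS[symmetric] by simp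
  then have "0 \<le> x" by (simp add: zero_le_mult_iff)
  have "\<exists>n::nat. x = real n"
  proof -
    obtain E :: "('a ^ 4) set" where E: "E \<in> proj_planes"
      using perp_points_planes(1)[OF proj_point_span[of "axis 1 1 :: 'a ^ 4"]] by auto
    obtain i :: int where i: "x = real_of_int i"
    proof
      show "x = real_of_int (int (card {P \<in> S. P \<subseteq> E}) - (if E \<in> T then int ?q else 0))"
        using plane[OF E] by simp
    qed
    then have "x = real (nat i)" using \<open>0 \<le> x\<close> by simp
    then show ?thesis by blast
  qed
  then obtain n :: nat where n: "x = real n" by blast
  have "cl_pair S T n"
  proof (rule cl_pairI[OF S T])
    have "real (card S) = real (n * (?q + 1))" using cS n by (simp add: algebra_simps)
    then show "card S = n * (?q + 1)" by (simp only: of_nat_eq_iff)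
    fix E :: "('a ^ 4) set" assume "E \<in> proj_planes"
    from plane[OF this] show "card {P \<in> S. P \<subseteq> E} = n + (if E \<in> T then ?q else 0)"
      unfolding n by (simp split: if_splits flip: of_nat_add)
  qed
  then show ?thesis by (rule that)
qed

section \<open>The Klein correspondence\<close>

lemma forall_4': "(\<forall>i::4. P i) \<longleftrightarrow> P 0 \<and> P 1 \<and> P 2 \<and> P 3"
proof -
  have four: "(4 :: 4) = 0" by simp
  show ?thesis unfolding forall_4 four by blast
qed

lemma exhaust_6: "x = 0 \<or> x = 1 \<or> x = 2 \<or> x = 3 \<or> x = 4 \<or> x = 5" for x :: 6
proof (induct x)
  case (of_int z)
  then have "0 \<le> z" and "z < 6" by simp_all
  then have "z = 0 \<or> z = 1 \<or> z = 2 \<or> z = 3 \<or> z = 4 \<or> z = 5" by arith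
  then show ?case by auto
qed

lemma forall_6: "(\<forall>i::6. P i) \<longleftrightarrow> P 0 \<and> P 1 \<and> P 2 \<and> P 3 \<and> P 4 \<and> P 5"
  by (metis exhaust_6)

lemma plucker_nth:
  "plucker u v $ 0 = u $ 0 * v $ 1 - u $ 1 * v $ 0"
  "plucker u v $ 1 = u $ 0 * v $ 2 - u $ 2 * v $ 0"
  "plucker u v $ 2 = u $ 0 * v $ 3 - u $ 3 * v $ 0"
  "plucker u v $ 3 = u $ 1 * v $ 2 - u $ 2 * v $ 1"
  "plucker u v $ 4 = u $ 3 * v $ 1 - u $ 1 * v $ 3"
  "plucker u v $ 5 = u $ 2 * v $ 3 - u $ 3 * v $ 2"
  by (simp_all add: plucker_def plucker_coord_def)

lemma vec6_eq_iff: "X = Y \<longleftrightarrow> X $ 0 = Y $ 0 \<and> X $ 1 = Y $ 1 \<and> X $ 2 = Y $ 2 \<and> X $ 3 = Y $ 3 \<and> X $ 4 = Y $ 4 \<and> X $ 5 = Y $ 5"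
  for X Y :: "'a ^ 6"
  unfolding vec_eq_iff forall_6 ..

lemma vec4_eq_iff: "X = Y \<longleftrightarrow> X $ 0 = Y $ 0 \<and> X $ 1 = Y $ 1 \<and> X $ 2 = Y $ 2 \<and> X $ 3 = Y $ 3"
  for X Y :: "'a ^ 4"
  unfolding vec_eq_iff forall_4' ..

lemma dotp4: "dotp u v = u $ 0 * v $ 0 + u $ 1 * v $ 1 + u $ 2 * v $ 2 + u $ 3 * v $ 3" for u v :: "'a::field ^ 4"
proof -
  have four: "(4 :: 4) = 0" by simp
  show ?thesis unfolding dotp_def sum_4 four by (simp add: add.commute add.left_commute)
qed

lemma plucker_quadric: "plucker u v \<in> klein_quadric"
  by (simp add: klein_quadric_def plucker_nth algebra_simps)

lemma plucker_add: "plucker u (v + w) = plucker u v + plucker u w" "plucker (v + w) u = plucker v u + plucker w u"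
  by (simp_all add: vec6_eq_iff plucker_nth algebra_simps)

lemma plucker_diff: "plucker u (v - w) = plucker u v - plucker u w"
  by (simp_all add: vec6_eq_iff plucker_nth algebra_simps)

lemma plucker_scale: "plucker u (c *s v) = c *s plucker u v" "plucker (c *s u) v = c *s plucker u v"
  by (simp_all add: vec6_eq_iff plucker_nth algebra_simps)

lemma plucker_comb: "plucker (a *s u + b *s v) (c *s u + d *s v) = (a * d - b * c) *s plucker u v"
  by (simp add: vec6_eq_iff plucker_nth algebra_simps)

lemma plucker_eq_0:
  fixes u v :: "'a::field ^ 4"
  shows "plucker u v = 0 \<longleftrightarrow> u = 0 \<or> v \<in> vec.span {u}"
proof
  assume 0: "plucker u v = 0"
  have "v \<in> vec.span {u}" if "u $ k \<noteq> 0" for k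
  proof -
    have "v = (v $ k / u $ k) *s u"
      using 0 that by (cases "k = 0"; cases "k = 1"; cases "k = 2"; cases "k = 3")
        (use forall_4'[of "\<lambda>i. i = 0 \<or> i = 1 \<or> i = 2 \<or> i = 3"] in
          \<open>auto simp: vec6_eq_iff vec4_eq_iff plucker_nth field_simps\<close>)
    then show ?thesis using vec.span_scale[OF vec.span_base[of u "{u}"]] by (metis singletonI)
  qed
  then show "u = 0 \<or> v \<in> vec.span {u}" by (auto simp: vec_eq_iff)
next
  assume "u = 0 \<or> v \<in> vec.span {u}"
  then show "plucker u v = 0"
    by (auto simp: vec.span_singleton vec6_eq_iff plucker_nth)
qed

text \<open>The rows of the alternating matrix with Pluecker coordinates X.\<close>
definition prow :: "'a::field ^ 6 \<Rightarrow> 4 \<Rightarrow> 'a ^ 4" where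
  "prow X i = (\<chi> j. if i = 0 then (if j = 0 then 0 else if j = 1 then X $ 0 else if j = 2 then X $ 1 else X $ 2)
     else if i = 1 then (if j = 0 then - X $ 0 else if j = 1 then 0 else if j = 2 then X $ 3 else - X $ 4)
     else if i = 2 then (if j = 0 then - X $ 1 else if j = 1 then - X $ 3 else if j = 2 then 0 else X $ 5)
     else (if j = 0 then - X $ 2 else if j = 1 then X $ 4 else if j = 2 then - X $ 5 else 0))"

text \<open>
  The coordinates of the orthogonal line, by \<open>klein_perp\<close>.
\<close>
definition pstar :: "'a ^ 6 \<Rightarrow> 'a ^ 6" where
  "pstar X = (\<chi> i. X $ (5 - i))"

lemma pstar_nth:
  "pstar X $ 0 = X $ 5" "pstar X $ 1 = X $ 4" "pstar X $ 2 = X $ 3"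
  "pstar X $ 3 = X $ 2" "pstar X $ 4 = X $ 1" "pstar X $ 5 = X $ 0"
  by (simp_all add: pstar_def)

lemma prow_nth:
  "prow X 0 $ 0 = 0" "prow X 0 $ 1 = X $ 0" "prow X 0 $ 2 = X $ 1" "prow X 0 $ 3 = X $ 2"
  "prow X 1 $ 0 = - X $ 0" "prow X 1 $ 1 = 0" "prow X 1 $ 2 = X $ 3" "prow X 1 $ 3 = - X $ 4"
  "prow X 2 $ 0 = - X $ 1" "prow X 2 $ 1 = - X $ 3" "prow X 2 $ 2 = 0" "prow X 2 $ 3 = X $ 5"
  "prow X 3 $ 0 = - X $ 2" "prow X 3 $ 1 = X $ 4" "prow X 3 $ 2 = - X $ 5" "prow X 3 $ 3 = 0"
  by (simp_all add: prow_def)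

text \<open>On the quadric the alternating matrix has rank at most two; the Pluecker vector of rows i and j is a multiple of X.\<close>
lemma singular_plucker:
  fixes X :: "'a::field ^ 6"
  assumes X: "X \<in> klein_quadric" "X \<noteq> 0"
  obtains i j c where "X = plucker (prow X i) (c *s prow X j)"
proof -
  have q: "X $ 0 * X $ 5 + X $ 1 * X $ 4 + X $ 2 * X $ 3 = 0" using X(1) by (simp add: klein_quadric_def)
  have m0: "plucker (prow X 0) (prow X 1) = X $ 0 *s X"
    unfolding vec6_eq_iff plucker_nth prow_nth vector_smult_component by (intro conjI; (algebra | (insert q, algebra)))
  have m1: "plucker (prow X 0) (prow X 2) = X $ 1 *s X"
    unfolding vec6_eq_iff plucker_nth prow_nth vector_smult_component by (intro conjI; (algebra | (insert q, algebra)))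
  have m2: "plucker (prow X 0) (prow X 3) = X $ 2 *s X"
    unfolding vec6_eq_iff plucker_nth prow_nth vector_smult_component by (intro conjI; (algebra | (insert q, algebra)))
  have m3: "plucker (prow X 1) (prow X 2) = X $ 3 *s X"
    unfolding vec6_eq_iff plucker_nth prow_nth vector_smult_component by (intro conjI; (algebra | (insert q, algebra)))
  have m4: "plucker (prow X 3) (prow X 1) = X $ 4 *s X"
    unfolding vec6_eq_iff plucker_nth prow_nth vector_smult_component by (intro conjI; (algebra | (insert q, algebra)))
  have m5: "plucker (prow X 2) (prow X 3) = X $ 5 *s X"
    unfolding vec6_eq_iff plucker_nth prow_nth vector_smult_component by (intro conjI; (algebra | (insert q, algebra)))
  have "\<exists>i j c. X = plucker (prow X i) (c *s prow X j)" if "plucker (prow X i) (prow X j) = a *s X" "a \<noteq> 0" for i j a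
    using that by (intro exI[of _ i] exI[of _ j] exI[of _ "inverse a"]) (simp add: plucker_scale)
  then have "\<exists>i j c. X = plucker (prow X i) (c *s prow X j)"
    using m0 m1 m2 m3 m4 m5 X(2) unfolding vec6_eq_iff zero_index by blast
  then show ?thesis using that by blast
qed

text \<open>
  The vectors whose wedge product with X vanishes. For the Pluecker vector of a line they
  form the line itself, so the line can be recovered from its image.
\<close>
definition line_of :: "'a::field ^ 6 \<Rightarrow> ('a ^ 4) set" where
  "line_of X = perp (range (prow (pstar X)))"

lemma line_of_iff:
  "w \<in> line_of X \<longleftrightarrow>
     w $ 1 * X $ 5 + w $ 2 * X $ 4 + w $ 3 * X $ 3 = 0 \<and> w $ 0 * X $ 5 - w $ 2 * X $ 2 + w $ 3 * X $ 1 = 0 \<and>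
     w $ 3 * X $ 0 - w $ 0 * X $ 4 - w $ 1 * X $ 2 = 0 \<and> w $ 0 * X $ 3 - w $ 1 * X $ 1 + w $ 2 * X $ 0 = 0"
proof -
  have "w \<in> line_of X \<longleftrightarrow> (\<forall>i. dotp (prow (pstar X) i) w = 0)" by (auto simp: line_of_def perp_def)
  then show ?thesis
    unfolding forall_4' dotp4 by (auto simp: prow_nth pstar_nth algebra_simps neg_eq_iff_add_eq_0 add_eq_0_iff)
qed


lemma line_of_scale: "c \<noteq> 0 \<Longrightarrow> line_of (c *s X) = line_of X"
proof -
  assume c: "c \<noteq> 0"
  have "prow (pstar (c *s X)) i = c *s prow (pstar X) i" for i
    by (simp add: vec4_eq_iff prow_def pstar_def)
  then show ?thesis using c by (auto simp: line_of_def perp_def dotp_scale)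
qed

text \<open>By Cramer's rule a vector whose wedge product with u and v vanishes is a combination of them.\<close>
lemma line_of_plucker:
  fixes u v :: "'a::field ^ 4"
  assumes "plucker u v \<noteq> 0"
  shows "line_of (plucker u v) = vec.span {u, v}"
proof
  have "u \<in> line_of (plucker u v)" "v \<in> line_of (plucker u v)"
    unfolding line_of_iff by (simp_all add: plucker_nth algebra_simps)
  then show "vec.span {u, v} \<subseteq> line_of (plucker u v)"
    by (intro vec.span_minimal) (auto simp: line_of_def)
  show "line_of (plucker u v) \<subseteq> vec.span {u, v}"
  proof
    fix w assume "w \<in> line_of (plucker u v)"
    then have w: "w $ 1 * (u $ 2 * v $ 3 - u $ 3 * v $ 2) + w $ 2 * (u $ 3 * v $ 1 - u $ 1 * v $ 3) + w $ 3 * (u $ 1 * v $ 2 - u $ 2 * v $ 1) = 0"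
      "w $ 0 * (u $ 2 * v $ 3 - u $ 3 * v $ 2) - w $ 2 * (u $ 0 * v $ 3 - u $ 3 * v $ 0) + w $ 3 * (u $ 0 * v $ 2 - u $ 2 * v $ 0) = 0"
      "w $ 3 * (u $ 0 * v $ 1 - u $ 1 * v $ 0) - w $ 0 * (u $ 3 * v $ 1 - u $ 1 * v $ 3) - w $ 1 * (u $ 0 * v $ 3 - u $ 3 * v $ 0) = 0"
      "w $ 0 * (u $ 1 * v $ 2 - u $ 2 * v $ 1) - w $ 1 * (u $ 0 * v $ 2 - u $ 2 * v $ 0) + w $ 2 * (u $ 0 * v $ 1 - u $ 1 * v $ 0) = 0"
      unfolding line_of_iff plucker_nth by blast+
    have cramer: "w \<in> vec.span {u, v}"
      if "plucker_coord u v i j \<noteq> 0" "plucker_coord u v i j *s w = plucker_coord w v i j *s u + plucker_coord u w i j *s v" for i j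
    proof -
      have "plucker_coord u v i j *s w \<in> vec.span {u, v}"
        unfolding that(2) by (intro vec.span_add vec.span_scale vec.span_base) auto
      then have "inverse (plucker_coord u v i j) *s (plucker_coord u v i j *s w) \<in> vec.span {u, v}"
        by (rule vec.span_scale)
      then show ?thesis using that(1) by simp
    qed
    have c0: "plucker_coord u v 0 1 *s w = plucker_coord w v 0 1 *s u + plucker_coord u w 0 1 *s v"
      unfolding vec4_eq_iff plucker_coord_def vector_smult_component vector_add_component
      by (intro conjI; (algebra | (insert w(1), algebra) | (insert w(2), algebra) | (insert w(3), algebra) | (insert w(4), algebra)))
    have c1: "plucker_coord u v 0 2 *s w = plucker_coord w v 0 2 *s u + plucker_coord u w 0 2 *s v"
      unfolding vec4_eq_iff plucker_coord_def vector_smult_component vector_add_component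
      by (intro conjI; (algebra | (insert w(1), algebra) | (insert w(2), algebra) | (insert w(3), algebra) | (insert w(4), algebra)))
    have c2: "plucker_coord u v 0 3 *s w = plucker_coord w v 0 3 *s u + plucker_coord u w 0 3 *s v"
      unfolding vec4_eq_iff plucker_coord_def vector_smult_component vector_add_component
      by (intro conjI; (algebra | (insert w(1), algebra) | (insert w(2), algebra) | (insert w(3), algebra) | (insert w(4), algebra)))
    have c3: "plucker_coord u v 1 2 *s w = plucker_coord w v 1 2 *s u + plucker_coord u w 1 2 *s v"
      unfolding vec4_eq_iff plucker_coord_def vector_smult_component vector_add_component
      by (intro conjI; (algebra | (insert w(1), algebra) | (insert w(2), algebra) | (insert w(3), algebra) | (insert w(4), algebra)))
    have c4: "plucker_coord u v 3 1 *s w = plucker_coord w v 3 1 *s u + plucker_coord u w 3 1 *s v"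
      unfolding vec4_eq_iff plucker_coord_def vector_smult_component vector_add_component
      by (intro conjI; (algebra | (insert w(1), algebra) | (insert w(2), algebra) | (insert w(3), algebra) | (insert w(4), algebra)))
    have c5: "plucker_coord u v 2 3 *s w = plucker_coord w v 2 3 *s u + plucker_coord u w 2 3 *s v"
      unfolding vec4_eq_iff plucker_coord_def vector_smult_component vector_add_component
      by (intro conjI; (algebra | (insert w(1), algebra) | (insert w(2), algebra) | (insert w(3), algebra) | (insert w(4), algebra)))
    have "plucker_coord u v 0 1 \<noteq> 0 \<or> plucker_coord u v 0 2 \<noteq> 0 \<or> plucker_coord u v 0 3 \<noteq> 0 \<or>
        plucker_coord u v 1 2 \<noteq> 0 \<or> plucker_coord u v 3 1 \<noteq> 0 \<or> plucker_coord u v 2 3 \<noteq> 0"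
      using assms unfolding vec6_eq_iff plucker_nth plucker_coord_def by auto
    then show "w \<in> vec.span {u, v}" using cramer c0 c1 c2 c3 c4 c5 by blast
  qed
qed

lemma proj_line_basis:
  assumes "l \<in> proj_lines" "P \<in> proj_points" "P \<subseteq> l" "p \<in> P" "p \<noteq> 0"
  obtains w where "l = vec.span {p, w}" "w \<notin> P"
proof -
  note l = proj_linesD[OF assms(1)] and P = proj_pointsD[OF assms(2)]
  have "\<not> l \<subseteq> P" using vec.dim_subset[of l P] l(2) P(2) by auto
  then obtain w where w: "w \<in> l" "w \<notin> P" by blast
  have Pp: "P = vec.span {p}" by (rule proj_point_eq_span[OF assms(2,4,5)])
  have ind: "vec.independent {w, p}" "w \<noteq> p" using indep2[OF assms(5)] w(2) Pp by auto
  have "vec.span {w, p} = l"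
  proof (rule subspace_eqI)
    show "vec.span {w, p} \<subseteq> l" using w assms(3,4) l(1) by (intro vec.span_minimal) auto
    show "vec.dim l \<le> vec.dim (vec.span {w, p})"
      using l(2) vec.dim_eq_card_independent[OF ind(1)] ind(2) by simp
  qed (use l in auto)
  then show ?thesis using that[of w] w(2) by (simp add: insert_commute)
qed

lemma exists_point_in:
  assumes "l \<in> proj_lines"
  obtains p where "p \<in> l" "p \<noteq> 0"
proof -
  note l = proj_linesD[OF assms]
  have "\<not> l \<subseteq> {0}" using l(2) vec.dim_eq_0[of l] by simp
  then show ?thesis using that by blast
qed

lemma span_pair: "x \<in> vec.span {u, v} \<longleftrightarrow> (\<exists>a b. x = a *s u + b *s v)"
proof
  assume "x \<in> vec.span {u, v}"
  then obtain a b where "x - a *s u = b *s v"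
    by (auto simp: vec.span_breakdown_eq vec.span_singleton)
  then have "x = a *s u + b *s v" by (simp add: algebra_simps)
  then show "\<exists>a b. x = a *s u + b *s v" by blast
next
  assume "\<exists>a b. x = a *s u + b *s v"
  then obtain a b where x: "x = a *s u + b *s v" by blast
  show "x \<in> vec.span {u, v}" unfolding x by (intro vec.span_add vec.span_scale vec.span_base) auto
qed

lemma klein_span: "klein (vec.span {u, v}) = vec.span {plucker u v}"
  unfolding klein_def
proof
  have "plucker a b \<in> vec.span {plucker u v}" if ab: "a \<in> vec.span {u, v}" "b \<in> vec.span {u, v}" for a b
  proof -
    obtain a1 a2 where a: "a = a1 *s u + a2 *s v" using ab(1) span_pair[of a u v] by blast
    obtain b1 b2 where b: "b = b1 *s u + b2 *s v" using ab(2) span_pair[of b u v] by blast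
    from a b have "plucker a b = (a1 * b2 - a2 * b1) *s plucker u v" by (simp only: plucker_comb)
    show ?thesis unfolding \<open>plucker a b = _\<close> by (intro vec.span_scale vec.span_base singletonI)
  qed
  then show "vec.span {plucker a b | a b. a \<in> vec.span {u, v} \<and> b \<in> vec.span {u, v}} \<subseteq> vec.span {plucker u v}"
    by (intro vec.span_minimal) auto
  show "vec.span {plucker u v} \<subseteq> vec.span {plucker a b | a b. a \<in> vec.span {u, v} \<and> b \<in> vec.span {u, v}}"
  proof (rule vec.span_mono)
    have "u \<in> vec.span {u, v}" "v \<in> vec.span {u, v}" by (auto intro: vec.span_base)
    then show "{plucker u v} \<subseteq> {plucker a b | a b. a \<in> vec.span {u, v} \<and> b \<in> vec.span {u, v}}" by blast
  qed
qed

lemma plucker_nz: "u \<noteq> 0 \<Longrightarrow> v \<notin> vec.span {u} \<Longrightarrow> plucker u v \<noteq> 0"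
  by (simp add: plucker_eq_0)

lemma span_pair_line:
  assumes "plucker u v \<noteq> 0"
  shows "vec.span {u, v} \<in> proj_lines"
proof -
  have "u \<noteq> 0" "v \<notin> vec.span {u}" using assms plucker_eq_0 by auto
  then have "vec.independent {v, u}" "v \<noteq> u" using indep2 by auto
  then have "vec.dim (vec.span {v, u}) = 2" by (simp add: vec.dim_eq_card_independent)
  then show ?thesis by (simp add: proj_lines_def insert_commute)
qed

lemma klein_cases:
  assumes l: "l \<in> proj_lines"
  obtains u v where "l = vec.span {u, v}" "plucker u v \<noteq> 0" "klein l = vec.span {plucker u v}"
proof -
  obtain p where p: "p \<in> l" "p \<noteq> 0" using exists_point_in[OF l] .
  have P: "vec.span {p} \<in> proj_points" by (rule proj_point_span[OF p(2)])
  have Pl: "vec.span {p} \<subseteq> l" using span1_subset_iff[OF proj_linesD(1)[OF l]] p(1) by blast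
  obtain w where w: "l = vec.span {p, w}" "w \<notin> vec.span {p}"
    using proj_line_basis[OF l P Pl vec.span_base[OF singletonI] p(2)] .
  then show ?thesis using that plucker_nz[OF p(2) w(2)] klein_span by blast
qed

lemma line_of_klein:
  assumes l: "l \<in> proj_lines" and X: "X \<in> klein l" "X \<noteq> 0"
  shows "line_of X = l"
proof -
  obtain u v where uv: "l = vec.span {u, v}" "plucker u v \<noteq> 0" "klein l = vec.span {plucker u v}"
    using klein_cases[OF l] .
  obtain c where c: "X = c *s plucker u v" using X(1) uv(3) by (auto simp: vec.span_singleton)
  then have "c \<noteq> 0" using X(2) by auto
  then show ?thesis using line_of_scale[of c "plucker u v"] line_of_plucker[OF uv(2)] uv(1) c by simp
qed

lemma klein_point: "l \<in> proj_lines \<Longrightarrow> klein l \<in> klein_points"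
proof -
  assume l: "l \<in> proj_lines"
  obtain u v where uv: "l = vec.span {u, v}" "plucker u v \<noteq> 0" "klein l = vec.span {plucker u v}"
    using klein_cases[OF l] .
  have "c *s plucker u v \<in> klein_quadric" for c
    using plucker_quadric[of u "c *s v"] by (simp add: plucker_scale)
  then show ?thesis using uv proj_point_span by (auto simp: klein_points_def vec.span_singleton)
qed

lemma bij_klein: "bij_betw klein proj_lines (klein_points :: ('a::field ^ 6) set set)"
  unfolding bij_betw_def
proof (intro conjI subset_antisym)
  show "inj_on klein (proj_lines :: ('a ^ 4) set set)"
  proof (rule inj_onI)
    fix l l' :: "('a ^ 4) set" assume l: "l \<in> proj_lines" "l' \<in> proj_lines" "klein l = klein l'"
    obtain u v where uv: "l = vec.span {u, v}" "plucker u v \<noteq> 0" "klein l = vec.span {plucker u v}"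
      using klein_cases[OF l(1)] .
    have X: "plucker u v \<in> klein l" using uv(3) by (simp add: vec.span_base)
    show "l = l'" using line_of_klein[OF l(1) X uv(2)] line_of_klein[OF l(2) _ uv(2)] X l(3) by simp
  qed
  show "klein ` proj_lines \<subseteq> (klein_points :: ('a ^ 6) set set)" using klein_point by blast
  show "(klein_points :: ('a ^ 6) set set) \<subseteq> klein ` proj_lines"
  proof
    fix P :: "('a ^ 6) set" assume P: "P \<in> klein_points"
    then obtain X where X: "X \<noteq> 0" "P = vec.span {X}" by (auto simp: klein_points_def elim: proj_pointE)
    have "X \<in> P" using X(2) by (simp add: vec.span_base)
    then have "X \<in> klein_quadric" using P by (auto simp: klein_points_def)
    then obtain i j c where "X = plucker (prow X i) (c *s prow X j)" using singular_plucker[OF _ X(1)] by blast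
    then obtain u v where uv: "X = plucker u v" by blast
    have "vec.span {u, v} \<in> proj_lines" using span_pair_line X(1) uv by blast
    moreover have "klein (vec.span {u, v}) = P" using klein_span uv X(2) by simp
    ultimately show "P \<in> klein ` proj_lines" by blast
  qed
qed

lemma pstar_pstar [simp]: "pstar (pstar X) = X"
  by (simp add: vec6_eq_iff pstar_nth)

lemma inj_pstar: "inj pstar"
  by (metis injI pstar_pstar)

lemma pstar_linear: "pstar (X + Y) = pstar X + pstar Y" "pstar (c *s X) = c *s pstar X" "pstar 0 = 0"
  by (simp_all add: vec6_eq_iff pstar_nth)

lemma pstar_quadric: "pstar X \<in> klein_quadric \<longleftrightarrow> X \<in> klein_quadric"
  by (simp add: klein_quadric_def pstar_nth algebra_simps)

lemma klein_subspace: "vec.subspace (klein l)"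
  by (simp add: klein_def)

text \<open>
  The line of X is orthogonal to the rows of the alternating matrix of \<open>pstar X\<close>, and
  \<open>pstar X\<close> is up to a factor the Pluecker vector of two of these rows.
\<close>
lemma klein_perp:
  fixes l :: "('a::{field,finite} ^ 4) set"
  assumes l: "l \<in> proj_lines"
  shows "klein (perp l) = pstar ` klein l"
proof -
  have sub: "pstar X \<in> klein (perp l)" if X: "X \<in> klein l" for X
  proof (cases "X = 0")
    case True
    then show ?thesis using vec.subspace_0[OF klein_subspace] by (simp add: pstar_linear)
  next
    case False
    have "klein l \<subseteq> klein_quadric" using klein_point[OF l] by (simp add: klein_points_def)
    then have q: "pstar X \<in> klein_quadric" using X pstar_quadric by blast
    have "pstar X \<noteq> 0" using False pstar_pstar[of X] pstar_linear(3) by metis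
    then obtain i j c where ij: "pstar X = plucker (prow (pstar X) i) (c *s prow (pstar X) j)"
      using singular_plucker[OF q] by blast
    have "prow (pstar X) i \<in> perp l" for i
      using perp_perp_subset[of "range (prow (pstar X))"] line_of_klein[OF l X False] by (auto simp: line_of_def)
    then have "prow (pstar X) i \<in> perp l" "c *s prow (pstar X) j \<in> perp l"
      by (auto intro: vec.subspace_scale[OF subspace_perp])
    then show ?thesis unfolding klein_def by (subst ij) (auto intro: vec.span_base)
  qed
  have pt: "card (klein m) = CARD('a)" if "m \<in> proj_lines" for m :: "('a ^ 4) set"
    using klein_point[OF that] card_subspace[of "klein m"] by (simp add: klein_points_def proj_points_def)
  have "pstar ` klein l = klein (perp l)"
  proof (rule card_subset_eq)
    show "pstar ` klein l \<subseteq> klein (perp l)" using sub by blast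
    show "card (pstar ` klein l) = card (klein (perp l))"
      using pt[OF l] pt[OF perp_points_planes(3)[OF l]]
        card_image[OF inj_on_subset[OF inj_pstar subset_UNIV], of "klein l"] by simp
  qed simp
  then show ?thesis by simp
qed

lemma latin_plane_iff:
  assumes l: "l \<in> proj_lines"
  shows "klein l \<subseteq> latin_plane P \<longleftrightarrow> P \<subseteq> l"
proof
  obtain u v where uv: "l = vec.span {u, v}" "plucker u v \<noteq> 0" "klein l = vec.span {plucker u v}"
    using klein_cases[OF l] .
  have X: "plucker u v \<in> klein l" using uv(3) by (simp add: vec.span_base)
  assume "klein l \<subseteq> latin_plane P"
  then obtain m where m: "m \<in> proj_lines" "P \<subseteq> m" "plucker u v \<in> klein m"
    using X unfolding latin_plane_def by blast
  have "l = m" using line_of_klein[OF l X uv(2)] line_of_klein[OF m(1,3) uv(2)] by simp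
  then show "P \<subseteq> l" using m(2) by simp
qed (use l in \<open>auto simp: latin_plane_def\<close>)

lemma greek_plane_iff:
  assumes l: "l \<in> proj_lines"
  shows "klein l \<subseteq> greek_plane E \<longleftrightarrow> l \<subseteq> E"
proof
  obtain u v where uv: "l = vec.span {u, v}" "plucker u v \<noteq> 0" "klein l = vec.span {plucker u v}"
    using klein_cases[OF l] .
  have X: "plucker u v \<in> klein l" using uv(3) by (simp add: vec.span_base)
  assume "klein l \<subseteq> greek_plane E"
  then obtain m where m: "m \<in> proj_lines" "m \<subseteq> E" "plucker u v \<in> klein m"
    using X unfolding greek_plane_def by blast
  have "l = m" using line_of_klein[OF l X uv(2)] line_of_klein[OF m(1,3) uv(2)] by simp
  then show "l \<subseteq> E" using m(2) by simp
qed (use l in \<open>auto simp: greek_plane_def\<close>)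

lemma latin_plane_range:
  assumes p: "p \<noteq> 0"
  shows "latin_plane (vec.span {p}) = range (plucker p)"
proof
  have P: "vec.span {p} \<in> proj_points" by (rule proj_point_span[OF p])
  show "latin_plane (vec.span {p}) \<subseteq> range (plucker p)"
  proof
    fix X assume "X \<in> latin_plane (vec.span {p})"
    then obtain l where l: "l \<in> proj_lines" "vec.span {p} \<subseteq> l" "X \<in> klein l" unfolding latin_plane_def by blast
    obtain w where w: "l = vec.span {p, w}" "w \<notin> vec.span {p}"
      using proj_line_basis[OF l(1) P l(2) vec.span_base[OF singletonI] p] .
    then obtain c where "X = c *s plucker p w" using l(3) by (auto simp: klein_span vec.span_singleton)
    then have "X = plucker p (c *s w)" by (simp add: plucker_scale)
    then show "X \<in> range (plucker p)" by blast
  qed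
  have on: "X \<in> latin_plane (vec.span {p})" if "v \<notin> vec.span {p}" "X \<in> vec.span {plucker p v}" for v X
  proof -
    have "vec.span {p, v} \<in> proj_lines" by (rule span_pair_line[OF plucker_nz[OF p that(1)]])
    moreover have "vec.span {p} \<subseteq> vec.span {p, v}" by (rule vec.span_mono) simp
    moreover have "X \<in> klein (vec.span {p, v})" using that(2) by (simp add: klein_span)
    ultimately show ?thesis unfolding latin_plane_def by blast
  qed
  show "range (plucker p) \<subseteq> latin_plane (vec.span {p})"
  proof clarify
    fix v
    show "plucker p v \<in> latin_plane (vec.span {p})"
    proof (cases "v \<in> vec.span {p}")
      case True
      then have 0: "plucker p v = 0" by (simp add: plucker_eq_0)
      have "vec.dim (vec.span {p}) = 1" using p by simp
      then have "vec.span {p} \<noteq> UNIV" using dim_UNIV4 by (metis numeral_eq_one_iff semiring_norm(83))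
      then obtain w where "w \<notin> vec.span {p}" by blast
      then show ?thesis unfolding 0 by (rule on) (rule vec.span_zero)
    next
      case False
      then show ?thesis by (rule on) (simp add: vec.span_base)
    qed
  qed
qed

text \<open>
  The kernel of \<open>plucker p\<close> is the point P, so the image has \<open>q\<^sup>3\<close> elements.
\<close>
lemma latin_plane_generator:
  fixes P :: "('a::{field,finite} ^ 4) set"
  assumes P: "P \<in> proj_points"
  shows "latin_plane P \<in> generators"
proof -
  obtain p where p: "p \<noteq> 0" "P = vec.span {p}" using proj_pointE[OF P] .
  have eq: "latin_plane P = range (plucker p)" using latin_plane_range[OF p(1)] p(2) by simp
  have sub: "vec.subspace (range (plucker p))"
    unfolding vec.subspace_def
  proof (intro conjI ballI allI)
    have "plucker p 0 = 0" by (simp add: vec6_eq_iff plucker_nth)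
    then show "0 \<in> range (plucker p)" by (metis rangeI)
  qed (auto simp: plucker_add(1)[symmetric] plucker_scale(1)[symmetric])
  have "card (UNIV :: ('a ^ 4) set) = card (range (plucker p)) * card {w \<in> UNIV. plucker p w = 0}"
    by (rule card_image_kernel) (auto simp: plucker_diff)
  moreover have "{w \<in> UNIV. plucker p w = 0} = P" using p by (simp add: plucker_eq_0)
  moreover have "card P = CARD('a)" using card_subspace[of P] P by (simp add: proj_points_def)
  moreover have "card (UNIV :: ('a ^ 4) set) = CARD('a) ^ 3 * CARD('a)"
    using card_subspace[OF vec.subspace_UNIV, where 'a = 'a and 'n = 4] dim_UNIV4[where 'a = 'a] by (simp add: eval_nat_numeral)
  ultimately have "card (range (plucker p)) = CARD('a) ^ 3" by simp
  then have "CARD('a) ^ vec.dim (range (plucker p)) = CARD('a) ^ 3" using card_subspace[OF sub] by simp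
  then have "vec.dim (range (plucker p)) = 3"
    using subfield_card_ge_2[OF subfield_UNIV[where 'a = 'a]] by (subst (asm) power_inject_exp) auto
  then show ?thesis
    unfolding generators_def proj_planes_def eq using sub plucker_quadric by auto
qed

lemma greek_plane_eq:
  fixes E :: "('a::{field,finite} ^ 4) set"
  assumes E: "E \<in> proj_planes"
  shows "greek_plane E = pstar ` latin_plane (perp E)"
proof -
  note E' = proj_planesD[OF E]
  have k: "klein l = pstar ` klein (perp l)" if l: "l \<in> proj_lines" for l :: "('a ^ 4) set"
    using klein_perp[OF perp_points_planes(3)[OF l]] perp_perp[OF proj_linesD(1)[OF l]] by simp
  have "{l \<in> proj_lines. l \<subseteq> E} = perp ` {m \<in> proj_lines. perp E \<subseteq> m}"
  proof
    show "{l \<in> proj_lines. l \<subseteq> E} \<subseteq> perp ` {m \<in> proj_lines. perp E \<subseteq> m}"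
    proof
      fix l assume l: "l \<in> {l \<in> proj_lines. l \<subseteq> E}"
      then show "l \<in> perp ` {m \<in> proj_lines. perp E \<subseteq> m}"
        using perp_points_planes(3)[of l] perp_mono[of l E] perp_perp[of l]
        by (intro image_eqI[of _ _ "perp l"]) (auto simp: proj_linesD)
    qed
    show "perp ` {m \<in> proj_lines. perp E \<subseteq> m} \<subseteq> {l \<in> proj_lines. l \<subseteq> E}"
      using perp_points_planes(3) perp_mono[of "perp E"] perp_perp[OF E'(1)] by auto
  qed
  then have "greek_plane E = (\<Union>m\<in>{m \<in> proj_lines. perp E \<subseteq> m}. klein (perp m))" by (simp add: greek_plane_def)
  also have "\<dots> = (\<Union>m\<in>{m \<in> proj_lines. perp E \<subseteq> m}. pstar ` klein m)"
    by (rule SUP_cong) (auto simp: klein_perp)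
  finally show ?thesis by (simp add: latin_plane_def image_Union image_image)
qed

lemma greek_plane_generator:
  fixes E :: "('a::{field,finite} ^ 4) set"
  assumes E: "E \<in> proj_planes"
  shows "greek_plane E \<in> generators"
proof -
  let ?G = "latin_plane (perp E)"
  have G: "vec.subspace ?G" "vec.dim ?G = 3" "?G \<subseteq> klein_quadric"
    using latin_plane_generator[OF perp_points_planes(2)[OF E]] by (auto simp: generators_def proj_planes_def)
  have sub: "vec.subspace (pstar ` ?G)"
    unfolding vec.subspace_def
  proof (intro conjI ballI allI)
    show "0 \<in> pstar ` ?G" using vec.subspace_0[OF G(1)] pstar_linear(3) by (metis image_eqI)
  qed (use G(1) in \<open>auto simp: pstar_linear[symmetric] vec.subspace_add vec.subspace_scale\<close>)
  have "CARD('a) ^ vec.dim (pstar ` ?G) = CARD('a) ^ 3"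
    using card_subspace[OF sub] card_subspace[OF G(1)] G(2) card_image[OF inj_on_subset[OF inj_pstar subset_UNIV], of ?G] by simp
  then have "vec.dim (pstar ` ?G) = 3"
    using subfield_card_ge_2[OF subfield_UNIV[where 'a = 'a]] by (subst (asm) power_inject_exp) auto
  moreover have "pstar ` ?G \<subseteq> klein_quadric" using G(3) pstar_quadric by blast
  ultimately show ?thesis using sub by (simp add: greek_plane_eq[OF E] generators_def proj_planes_def)
qed

text \<open>
  The bilinear form of the quadric; on Pluecker vectors it is the determinant of the four vectors.
\<close>
definition polar :: "'a::field ^ 6 \<Rightarrow> 'a ^ 6 \<Rightarrow> 'a" where
  "polar X Y = X $ 0 * Y $ 5 + X $ 5 * Y $ 0 + X $ 1 * Y $ 4 + X $ 4 * Y $ 1 + X $ 2 * Y $ 3 + X $ 3 * Y $ 2"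

lemma polar_linear: "polar X (Y + Z) = polar X Y + polar X Z" "polar X (c *s Y) = c * polar X Y"
  "polar (c *s X) Y = c * polar X Y"
  by (simp_all add: polar_def algebra_simps)

lemma polar_self: "polar (plucker u v) (plucker u w) = 0" "polar (plucker u v) (plucker v w) = 0"
  by (simp_all add: polar_def plucker_nth algebra_simps)

lemma plucker_swap: "plucker u v = - plucker v u"
  by (simp add: vec6_eq_iff plucker_nth)

text \<open>
  If the lines were skew, the whole space would be their sum, and X would be orthogonal to the
  Pluecker vectors of all pairs of vectors, in particular to all unit vectors.
\<close>
lemma polar_meet:
  fixes l m :: "('a::{field,finite} ^ 4) set"
  assumes l: "l \<in> proj_lines" "X \<in> klein l" "X \<noteq> 0" and m: "m \<in> proj_lines" "Y \<in> klein m" "Y \<noteq> 0"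
    and p: "polar X Y = 0"
  shows "l \<inter> m \<noteq> {0}"
proof
  assume skew: "l \<inter> m = {0}"
  note l' = proj_linesD[OF l(1)] and m' = proj_linesD[OF m(1)]
  have "vec.dim (join l m) = 4" using dim_join[OF l'(1) m'(1)] l'(2) m'(2) skew by simp
  then have j: "join l m = UNIV"
    by (intro subspace_eqI) (use dim_UNIV4[where 'a = 'a] in auto)
  obtain u v where uv: "l = vec.span {u, v}" "plucker u v \<noteq> 0" "klein l = vec.span {plucker u v}"
    using klein_cases[OF l(1)] .
  obtain a where a: "X = a *s plucker u v" using l(2) uv(3) by (auto simp: vec.span_singleton)
  have left: "polar X (plucker b w) = 0" if b: "b \<in> l" for b w
  proof -
    obtain s t where "b = s *s u + t *s v" using b uv(1) span_pair[of b u v] by blast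
    then show ?thesis by (simp add: a plucker_add plucker_scale polar_linear polar_self)
  qed
  have right: "polar X (plucker w b) = 0" if b: "b \<in> l" for b w
  proof -
    have "plucker w b = (-1) *s plucker b w" using plucker_swap[of w b] by simp
    then show ?thesis using left[OF b] by (simp only: polar_linear) simp
  qed
  have mm: "polar X (plucker b c) = 0" if b: "b \<in> m" "c \<in> m" for b c
  proof -
    have "plucker b c \<in> klein m" unfolding klein_def using b by (auto intro: vec.span_base)
    moreover have "klein m = vec.span {Y}"
      by (rule proj_point_eq_span[OF _ m(2,3)]) (use klein_point[OF m(1)] in \<open>simp add: klein_points_def\<close>)
    ultimately obtain k where "plucker b c = k *s Y" by (auto simp: vec.span_singleton)
    then show ?thesis using p by (simp add: polar_linear)
  qed
  have all: "polar X (plucker b c) = 0" for b c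
  proof -
    have "\<exists>b1\<in>l. \<exists>b2\<in>m. b = b1 + b2" for b
    proof -
      have sp: "vec.span l = l" "vec.span m = m" using l'(1) m'(1) by (simp_all only: vec.span_eq_iff)
      have "b \<in> join l m" by (simp add: j)
      then have "b \<in> {x + y | x y. x \<in> l \<and> y \<in> m}" unfolding join_def vec.span_Un sp .
      then show ?thesis by blast
    qed
    then obtain b1 b2 c1 c2 where bc: "b1 \<in> l" "b2 \<in> m" "b = b1 + b2" "c1 \<in> l" "c2 \<in> m" "c = c1 + c2" by meson
    have "plucker b c = plucker b1 c + (plucker b2 c1 + plucker b2 c2)" by (simp add: bc(3,6) plucker_add)
    then show ?thesis using left[OF bc(1)] right[OF bc(4)] mm[OF bc(2,5)] by (simp add: polar_linear)
  qed
  let ?e = "\<lambda>i::4. axis i 1 :: 'a ^ 4"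
  have "X $ 0 = 0" using all[of "?e 2" "?e 3"] by (simp add: polar_def plucker_nth axis_def)
  moreover have "X $ 1 = 0" using all[of "?e 3" "?e 1"] by (simp add: polar_def plucker_nth axis_def)
  moreover have "X $ 2 = 0" using all[of "?e 1" "?e 2"] by (simp add: polar_def plucker_nth axis_def)
  moreover have "X $ 3 = 0" using all[of "?e 0" "?e 3"] by (simp add: polar_def plucker_nth axis_def)
  moreover have "X $ 4 = 0" using all[of "?e 0" "?e 2"] by (simp add: polar_def plucker_nth axis_def)
  moreover have "X $ 5 = 0" using all[of "?e 0" "?e 1"] by (simp add: polar_def plucker_nth axis_def)
  ultimately have "X = 0" unfolding vec6_eq_iff by simp
  then show False using l(3) by simp
qed

lemma line_of_vector:
  fixes X :: "'a::field ^ 6"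
  assumes "X \<in> klein_quadric" "X \<noteq> 0"
  obtains l where "l \<in> proj_lines" "X \<in> klein l" "klein l = vec.span {X}"
proof -
  obtain i j c where "X = plucker (prow X i) (c *s prow X j)" using singular_plucker[OF assms] .
  then obtain u v where uv: "X = plucker u v" by blast
  have "vec.span {u, v} \<in> proj_lines" using span_pair_line assms(2) uv by blast
  moreover have "klein (vec.span {u, v}) = vec.span {X}" using klein_span uv by simp
  ultimately show ?thesis using that by (simp add: vec.span_base)
qed

text \<open>A basis of a generator consists of three pairwise meeting lines, which share a point or span a plane.\<close>
lemma generator_cases:
  fixes G :: "('a::{field,finite} ^ 6) set"
  assumes G: "G \<in> generators"
  shows "(\<exists>P\<in>proj_points. G = latin_plane P) \<or> (\<exists>E\<in>proj_planes. G = greek_plane E)"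
proof -
  have G': "vec.subspace G" "vec.dim G = 3" "G \<subseteq> klein_quadric"
    using G by (auto simp: generators_def proj_planes_def)
  obtain B where B: "B \<subseteq> G" "vec.independent B" "G \<subseteq> vec.span B" "card B = 3"
    using vec.basis_exists[of G] G'(2) by auto
  obtain X Y Z where XYZ: "B = {X, Y, Z}" "X \<noteq> Y" "X \<noteq> Z" "Y \<noteq> Z" using B(4) by (auto simp: card_3_iff)
  have nz: "X \<noteq> 0" "Y \<noteq> 0" "Z \<noteq> 0" using B(2) XYZ vec.dependent_zero[of B] by auto
  have inG: "X \<in> G" "Y \<in> G" "Z \<in> G" using B(1) XYZ(1) by auto
  have pol: "polar U V = 0" if "U \<in> G" "V \<in> G" for U V
  proof -
    have "U \<in> klein_quadric" "V \<in> klein_quadric" "U + V \<in> klein_quadric"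
      using that G' vec.subspace_add by blast+
    then show ?thesis unfolding klein_quadric_def polar_def mem_Collect_eq vector_add_component by algebra
  qed
  obtain l where l: "l \<in> proj_lines" "X \<in> klein l" "klein l = vec.span {X}" using line_of_vector[of X] inG nz G'(3) by blast
  obtain m where m: "m \<in> proj_lines" "Y \<in> klein m" "klein m = vec.span {Y}" using line_of_vector[of Y] inG nz G'(3) by blast
  obtain n where n: "n \<in> proj_lines" "Z \<in> klein n" "klein n = vec.span {Z}" using line_of_vector[of Z] inG nz G'(3) by blast
  have indep: "U \<notin> vec.span {V}" if "U \<in> B" "V \<in> B" "U \<noteq> V" for U V
  proof
    assume "U \<in> vec.span {V}"
    moreover have "{V} \<subseteq> B - {U}" using that by blast
    ultimately have "U \<in> vec.span (B - {U})" using vec.span_mono by blast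
    then show False using B(2) that(1) unfolding vec.dependent_def by blast
  qed
  have "X \<notin> klein m" "X \<notin> klein n" "Y \<notin> klein n"
    using indep XYZ m(3) n(3) by auto
  then have ne: "l \<noteq> m" "l \<noteq> n" "m \<noteq> n" using l(2) m(2) by blast+
  have meet: "U \<inter> V \<in> proj_points" if "U \<in> proj_lines" "V \<in> proj_lines" "U \<noteq> V" "U \<inter> V \<noteq> {0}" for U V :: "('a ^ 4) set"
  proof -
    note U = proj_linesD[OF that(1)] and V = proj_linesD[OF that(2)]
    have sub: "vec.subspace (U \<inter> V)" using U V by (simp add: vec.subspace_inter)
    have "\<not> U \<subseteq> V" using subspace_eqI[OF U(1) V(1)] U(2) V(2) that(3) by auto
    then have "vec.dim (U \<inter> V) < 2" using dim_Int_less[OF U(1) V(1)] U(2) by simp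
    moreover have "vec.dim (U \<inter> V) \<noteq> 0" using dim_eq_0_subspace[OF sub] that(4) by simp
    ultimately have "vec.dim (U \<inter> V) = 1" by linarith
    then show ?thesis using sub by (simp add: proj_points_def)
  qed
  have lm: "l \<inter> m \<in> proj_points" by (rule meet[OF l(1) m(1) ne(1) polar_meet[OF l(1,2) nz(1) m(1,2) nz(2) pol[OF inG(1,2)]]])
  have ln: "l \<inter> n \<in> proj_points" by (rule meet[OF l(1) n(1) ne(2) polar_meet[OF l(1,2) nz(1) n(1,2) nz(3) pol[OF inG(1,3)]]])
  have mn: "m \<inter> n \<in> proj_points" by (rule meet[OF m(1) n(1) ne(3) polar_meet[OF m(1,2) nz(2) n(1,2) nz(3) pol[OF inG(2,3)]]])
  have eqG: "G = H" if H: "H \<in> generators" "klein l \<subseteq> H" "klein m \<subseteq> H" "klein n \<subseteq> H" for H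
  proof (rule subspace_eqI)
    have H': "vec.subspace H" "vec.dim H = 3" using H(1) by (auto simp: generators_def proj_planes_def)
    have "B \<subseteq> H" using l(2) m(2) n(2) H(2-4) XYZ(1) by blast
    then have "vec.span B \<subseteq> H" using H'(1) by (rule vec.span_minimal)
    then show "G \<subseteq> H" using B(3) by blast
    show "vec.subspace H" "vec.dim H \<le> vec.dim G" using H' G'(2) by simp_all
  qed (rule G'(1))
  show ?thesis
  proof (cases "l \<inter> m \<subseteq> n")
    case True
    have "G = latin_plane (l \<inter> m)"
      by (rule eqG[OF latin_plane_generator[OF lm]])
        (use True in \<open>auto simp: latin_plane_iff[OF l(1)] latin_plane_iff[OF m(1)] latin_plane_iff[OF n(1)] simp del: Int_subset_iff intro: subsetD\<close>)
    then show ?thesis using lm by blast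
  next
    case False
    note l' = proj_linesD[OF l(1)] and m' = proj_linesD[OF m(1)] and n' = proj_linesD[OF n(1)]
    let ?E = "join l m"
    have "vec.dim ?E = 3" using dim_join[OF l'(1) m'(1)] l'(2) m'(2) proj_pointsD(2)[OF lm] by simp
    then have E: "?E \<in> proj_planes" by (simp add: proj_planes_def)
    have ne': "l \<inter> n \<noteq> m \<inter> n"
    proof
      assume e: "l \<inter> n = m \<inter> n"
      then have "l \<inter> n \<subseteq> l \<inter> m" by blast
      then have "l \<inter> n = l \<inter> m" using proj_point_subset_iff[OF ln lm] by blast
      then show False using False by blast
    qed
    have "vec.dim ((l \<inter> n) \<inter> (m \<inter> n)) = 0"
    proof -
      have "\<not> l \<inter> n \<subseteq> m \<inter> n" using ne' proj_point_subset_iff[OF ln mn] by blast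
      then show ?thesis using dim_Int_less[OF proj_pointsD(1)[OF ln] proj_pointsD(1)[OF mn]] proj_pointsD(2)[OF ln] by linarith
    qed
    then have "vec.dim (join (l \<inter> n) (m \<inter> n)) = 2"
      using dim_join[OF proj_pointsD(1)[OF ln] proj_pointsD(1)[OF mn]] proj_pointsD(2)[OF ln] proj_pointsD(2)[OF mn] by linarith
    then have "join (l \<inter> n) (m \<inter> n) = n"
      using n' by (intro subspace_eqI join_least) auto
    moreover have "join (l \<inter> n) (m \<inter> n) \<subseteq> ?E"
      using join_upper(1)[of l m] join_upper(2)[of m l] by (intro join_least) auto
    ultimately have nE: "n \<subseteq> ?E" by simp
    have "G = greek_plane ?E"
      by (rule eqG[OF greek_plane_generator[OF E]])
        (use nE join_upper(1)[of l m] join_upper(2)[of m l] in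
          \<open>simp_all add: greek_plane_iff[OF l(1)] greek_plane_iff[OF m(1)] greek_plane_iff[OF n(1)]\<close>)
    then show ?thesis using E by blast
  qed
qed

lemma inj_latin_plane: "inj_on latin_plane (proj_points :: ('a::{field,finite} ^ 4) set set)"
proof (rule inj_onI)
  fix P Q :: "('a ^ 4) set" assume P: "P \<in> proj_points" and Q: "Q \<in> proj_points" and eq: "latin_plane P = latin_plane Q"
  note P' = proj_pointsD[OF P]
  have iff: "P \<subseteq> l \<longleftrightarrow> Q \<subseteq> l" if "l \<in> proj_lines" for l
    using latin_plane_iff[OF that] eq by metis
  have cC: "card (covers P UNIV) = CARD('a) ^ 2 + CARD('a) + 1"
    by (rule card_covers(2)) (use P' dim_UNIV4[where 'a = 'a] in auto)
  have all: "{l \<in> covers P UNIV. Q \<subseteq> l} = covers P UNIV"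
    using iff covers_point[OF P'(2)] by auto
  have "Q \<subseteq> P"
  proof (rule ccontr)
    assume "\<not> Q \<subseteq> P"
    then have "covers P UNIV = {join P Q}"
      using covers_containing[OF P'(1) subset_UNIV vec.subspace_UNIV Q subset_UNIV] all by simp
    then have "card (covers P UNIV) = 1" by simp
    then show False using cC by simp
  qed
  then show "P = Q" using proj_point_subset_iff[OF Q P] by simp
qed

lemma inj_greek_plane: "inj_on greek_plane (proj_planes :: ('a::{field,finite} ^ 4) set set)"
proof (rule inj_onI)
  fix E F :: "('a ^ 4) set" assume E: "E \<in> proj_planes" and F: "F \<in> proj_planes" and eq: "greek_plane E = greek_plane F"
  have "pstar ` latin_plane (perp E) = pstar ` latin_plane (perp F)" using eq greek_plane_eq[OF E] greek_plane_eq[OF F] by simp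
  then have "latin_plane (perp E) = latin_plane (perp F)" by (simp add: inj_image_eq_iff[OF inj_pstar])
  then have "perp E = perp F" using inj_onD[OF inj_latin_plane _ perp_points_planes(2)[OF E] perp_points_planes(2)[OF F]] by blast
  then have "perp (perp E) = perp (perp F)" by simp
  then show "E = F" by (simp only: perp_perp[OF proj_planesD(1)[OF E]] perp_perp[OF proj_planesD(1)[OF F]])
qed

lemma latin_neq_greek:
  fixes P E :: "('a::{field,finite} ^ 4) set"
  assumes P: "P \<in> proj_points" and E: "E \<in> proj_planes"
  shows "latin_plane P \<noteq> greek_plane E"
proof
  assume eq: "latin_plane P = greek_plane E"
  note P' = proj_pointsD[OF P] and E' = proj_planesD[OF E]
  have iff: "P \<subseteq> l \<longleftrightarrow> l \<subseteq> E" if "l \<in> proj_lines" for l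
    using latin_plane_iff[OF that] greek_plane_iff[OF that] eq by metis
  have cC: "card (covers P UNIV) = CARD('a) ^ 2 + CARD('a) + 1"
    by (rule card_covers(2)) (use P' dim_UNIV4[where 'a = 'a] in auto)
  have sub: "covers P UNIV \<subseteq> covers P E"
    using iff covers_point[OF P'(2), of UNIV] covers_point[OF P'(2), of E] by auto
  have "covers P UNIV \<noteq> {}" using cC by (intro notI) simp
  then have "P \<subseteq> E" using sub by (auto simp: covers_def)
  then have "card (covers P E) = CARD('a) + 1" by (intro card_covers(1)) (use P' E' in auto)
  then show False using card_mono[OF finite sub] cC by simp
qed

section \<open>From generators to points and planes\<close>

definition generators_of :: "('a::field ^ 4) set set \<Rightarrow> ('a ^ 4) set set \<Rightarrow> ('a ^ 6) set set" where
  "generators_of S T = latin_plane ` S \<union> greek_plane ` T"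

lemma latin_greek_disjoint:
  fixes S :: "('a::{field,finite} ^ 4) set set"
  assumes "S \<subseteq> proj_points" "T \<subseteq> proj_planes"
  shows "latin_plane ` S \<inter> greek_plane ` T = {}"
proof -
  have "\<not> G \<in> greek_plane ` T" if G: "G \<in> latin_plane ` S" for G
  proof
    assume "G \<in> greek_plane ` T"
    then obtain E where "E \<in> T" "G = greek_plane E" by auto
    moreover obtain P where "P \<in> S" "G = latin_plane P" using G by auto
    ultimately show False using latin_neq_greek[of P E] assms by auto
  qed
  then show ?thesis by blast
qed

lemma generators_of_disjoint:
  fixes A A' :: "('a::{field,finite} ^ 4) set set"
  assumes "A \<subseteq> proj_points" "A' \<subseteq> proj_points" "B \<subseteq> proj_planes" "B' \<subseteq> proj_planes"
    "A \<inter> A' = {}" "B \<inter> B' = {}"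
  shows "generators_of A B \<inter> generators_of A' B' = {}"
proof -
  have 1: "latin_plane ` A \<inter> latin_plane ` A' = {}"
    using inj_on_image_Int[OF inj_latin_plane assms(1,2)] unfolding assms(5) by simp
  have 2: "greek_plane ` B \<inter> greek_plane ` B' = {}"
    using inj_on_image_Int[OF inj_greek_plane assms(3,4)] unfolding assms(6) by simp
  show ?thesis
    unfolding generators_of_def Int_Un_distrib Int_Un_distrib2 1 2 latin_greek_disjoint[OF assms(1,4)]
      Int_commute[of "greek_plane ` B" "latin_plane ` A'"] latin_greek_disjoint[OF assms(2,3)] by simp
qed

lemma card_generators_of:
  fixes S :: "('a::{field,finite} ^ 4) set set"
  assumes "S \<subseteq> proj_points" "T \<subseteq> proj_planes"
  shows "card (generators_of S T) = card S + card T"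
proof -
  have "card (generators_of S T) = card (latin_plane ` S) + card (greek_plane ` T)"
    unfolding generators_of_def by (rule card_Un_disjoint[OF finite finite latin_greek_disjoint[OF assms]])
  then show ?thesis
    using card_image[OF inj_on_subset[OF inj_latin_plane assms(1)]]
      card_image[OF inj_on_subset[OF inj_greek_plane assms(2)]] by simp
qed

lemma generators_of_line:
  fixes l :: "('a::{field,finite} ^ 4) set"
  assumes l: "l \<in> proj_lines"
  shows "generators_of (pts l) {E \<in> proj_planes. l \<subseteq> E} = point_pencil (klein l)"
proof
  show "generators_of (pts l) {E \<in> proj_planes. l \<subseteq> E} \<subseteq> point_pencil (klein l)"
  proof
    fix G assume "G \<in> generators_of (pts l) {E \<in> proj_planes. l \<subseteq> E}"
    then consider P where "P \<in> pts l" "G = latin_plane P"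
      | E where "E \<in> proj_planes" "l \<subseteq> E" "G = greek_plane E"
      unfolding generators_of_def by auto
    then show "G \<in> point_pencil (klein l)"
    proof cases
      case (1 P)
      then show ?thesis
        using latin_plane_generator[of P] latin_plane_iff[OF l, of P] by (simp add: point_pencil_def)
    next
      case (2 E)
      then show ?thesis
        using greek_plane_generator[of E] greek_plane_iff[OF l, of E] by (simp add: point_pencil_def)
    qed
  qed
  show "point_pencil (klein l) \<subseteq> generators_of (pts l) {E \<in> proj_planes. l \<subseteq> E}"
  proof
    fix G assume "G \<in> point_pencil (klein l)"
    then have G: "G \<in> generators" "klein l \<subseteq> G" by (auto simp: point_pencil_def)
    from generator_cases[OF G(1)] show "G \<in> generators_of (pts l) {E \<in> proj_planes. l \<subseteq> E}"
    proof (elim disjE bexE)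
      fix P assume "P \<in> proj_points" "G = latin_plane P"
      then show ?thesis using G(2) latin_plane_iff[OF l, of P] by (auto simp: generators_of_def)
    next
      fix E assume "E \<in> proj_planes" "G = greek_plane E"
      then show ?thesis using G(2) greek_plane_iff[OF l, of E] by (auto simp: generators_of_def)
    qed
  qed
qed

text \<open>
  Counting points separates the planes: a Baer subplane has \<open>s\<^sup>2 + s + 1\<close> points, whereas every other plane
  meets the Baer subgeometry in s + 1 points.
\<close>
lemma generators_of_baer:
  fixes W :: "('a::{field,finite} ^ 4) set"
  assumes K: "subfield_set K" "(card K)\<^sup>2 = CARD('a)" and W: "kform K W UNIV"
  shows "baer_type (generators_of (rat_points W) {E \<in> proj_planes. vec.dim (W \<inter> E) = 3})"
proof -
  have iff: "baer_subplane_of E {P \<in> rat_points W. P \<subseteq> E} \<longleftrightarrow> vec.dim (W \<inter> E) = 3"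
    if E: "E \<in> proj_planes" for E
  proof
    note E' = proj_planesD[OF E]
    have eq: "{P \<in> rat_points W. P \<subseteq> E} = rat_points (W \<inter> E)" by (rule rat_points_Int[OF E'(1), symmetric])
    {
      assume "baer_subplane_of E {P \<in> rat_points W. P \<subseteq> E}"
      then obtain K' W' where K': "subfield_set K'" "(card K')\<^sup>2 = CARD('a)" "kform K' W' E"
          "{P \<in> rat_points W. P \<subseteq> E} = rat_points W'"
        by (rule baer_subplane_ofD)
      have "card K' = card K" using K'(2) K(2) power2_eq_imp_eq[of "card K'" "card K"] by simp
      then have "card (rat_points (W \<inter> E)) = card K ^ 2 + card K + 1"
        using card_rat_points(4)[OF K'(1,3) E'(2)] K'(4) eq by simp
      then have "vec.dim (W \<inter> E) \<noteq> 2"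
        using card_rat_points(3)[OF K(1) kform_Int[OF K(1) W E'(1)]] subfield_card_ge_2[OF K(1)] by auto
      then show "vec.dim (W \<inter> E) = 3" using baer_plane_dim[OF K W E] by blast
    next
      assume "vec.dim (W \<inter> E) = 3"
      then have "kform K (W \<inter> E) E" using kform_full_dim[OF K(1) W E'(1)] E'(2) by simp
      then show "baer_subplane_of E {P \<in> rat_points W. P \<subseteq> E}"
        unfolding eq by (rule baer_subplane_ofI[OF K _ E'(2)])
    }
  qed
  have "{E \<in> proj_planes. vec.dim (W \<inter> E) = 3} = {E \<in> proj_planes. baer_subplane_of E {P \<in> rat_points W. P \<subseteq> E}}"
    using iff by blast
  then show ?thesis unfolding baer_type_def generators_of_def using baer_subgeometryI[OF K W] by blast
qed

lemma generators_of_component: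
  fixes A B :: "('a::{field,finite} ^ 4) set set"
  assumes "component A B y"
  shows "is_point_pencil (generators_of A B) \<or> baer_type (generators_of A B)"
  using assms unfolding component_def
proof (elim disjE bexE exE conjE)
  fix l assume "l \<in> proj_lines" "A = pts l" "B = {E \<in> proj_planes. l \<subseteq> E}"
  then show ?thesis using generators_of_line[of l] klein_point[of l] unfolding is_point_pencil_def by blast
next
  fix K W assume "subfield_set K" "(card K)\<^sup>2 = CARD('a)" "kform K W UNIV"
    "A = rat_points W" "B = {E \<in> proj_planes. vec.dim (W \<inter> E) = 3}"
  then show ?thesis using generators_of_baer[of K W] by simp
qed

text \<open>
  What remains after the removal of a component is again of the same type with a smaller
  parameter, so the hypotheses on x are inherited.
\<close>
lemma cl_pair_decomposition:
  fixes S :: "('a::{field,finite} ^ 4) set set"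
  assumes "cl_pair S T x" "x \<le> CARD('a)" "blocking_bound TYPE('a) (x + CARD('a))"
  shows "\<exists>F. generators_of S T = \<Union> F \<and> pairwise disjnt F \<and> (\<forall>M\<in>F. is_point_pencil M \<or> baer_type M)"
  using assms
proof (induction x arbitrary: S T rule: less_induct)
  case (less x)
  note c = less.prems(1) and D = cl_pairD[OF less.prems(1)]
  show ?case
  proof (cases "x = 0")
    case True
    then have "S = {}" "T = {}" using D(3,4) by auto
    then show ?thesis by (intro exI[where x = "{}"]) (simp add: generators_of_def)
  next
    case False
    obtain A B y where C: "component A B y" "A \<subseteq> S" "B \<subseteq> T"
      using exists_component[OF c False less.prems(2,3)] .
    note d = component_cl_pair[OF C(1)]
    note diff = cl_pair_diff[OF c d C(2,3)]
    have 1: "x - y < x" using component_pos[OF C(1)] False by simp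
    have 2: "x - y \<le> CARD('a)" using less.prems(2) by simp
    have 3: "blocking_bound TYPE('a) (x - y + CARD('a))"
      unfolding blocking_bound_def
    proof (intro allI impI)
      fix B :: "('a ^ 3) set set" assume "blocking_set B \<and> card B \<le> x - y + CARD('a)"
      then have "blocking_set B \<and> card B \<le> x + CARD('a)" by linarith
      then show "(\<exists>l\<in>proj_lines. pts l \<subseteq> B) \<or> contains_baer_subplane B"
        using less.prems(3) unfolding blocking_bound_def by blast
    qed
    from less.IH[OF 1 diff(2) 2 3] obtain F where F: "generators_of (S - A) (T - B) = \<Union> F" "pairwise disjnt F"
      "\<forall>M\<in>F. is_point_pencil M \<or> baer_type M" by (elim exE conjE)
    have dis: "generators_of A B \<inter> generators_of (S - A) (T - B) = {}"
      by (rule generators_of_disjoint) (use D(1,2) C(2,3) in auto)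
    have "generators_of S T = generators_of A B \<union> generators_of (S - A) (T - B)" using C(2,3) by (auto simp: generators_of_def)
    then have "generators_of S T = \<Union> (insert (generators_of A B) F)" using F(1) by simp
    moreover have "disjnt (generators_of A B) M" if "M \<in> F" for M
      using dis F(1) that unfolding disjnt_def by blast
    then have "pairwise disjnt (insert (generators_of A B) F)"
      using F(2) by (simp add: pairwise_insert disjnt_sym)
    moreover have "\<forall>M\<in>insert (generators_of A B) F. is_point_pencil M \<or> baer_type M"
      using F(3) generators_of_component[OF C(1)] by blast
    ultimately show ?thesis by blast
  qed
qed

text \<open>
  A weight on the points of the quadric is a weight on the lines of the three-dimensional space, and the points of a
  Latin or Greek plane are the lines through a point or in a plane.
\<close>
lemma cameron_liebler_cl_pair:
  fixes L :: "('a::{field,finite} ^ 6) set set"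
  assumes L: "cameron_liebler L"
  obtains S T :: "('a ^ 4) set set" and n where "cl_pair S T n" "L = generators_of S T"
proof -
  obtain w :: "('a ^ 6) set \<Rightarrow> real" where w: "\<forall>G\<in>generators. indicator L G = (\<Sum>P\<in>klein_points. incidence P G * w P)"
    and LG: "L \<subseteq> generators" using L unfolding cameron_liebler_def by blast
  define S where "S = {P \<in> proj_points. latin_plane P \<in> L}"
  define T where "T = {E \<in> proj_planes. greek_plane E \<in> L}"
  have weight: "indicator L G = (\<Sum>l\<in>{l \<in> proj_lines. klein l \<subseteq> G}. w (klein l))" if G: "G \<in> generators" for G
  proof -
    have "indicator L G = (\<Sum>P\<in>klein_points. if P \<subseteq> G then w P else 0)"
      using w G by (auto simp: incidence_def intro!: sum.cong)
    also have "\<dots> = (\<Sum>l\<in>proj_lines. if klein l \<subseteq> G then w (klein l) else 0)"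
      by (rule sum.reindex_bij_betw[OF bij_klein, symmetric])
    also have "\<dots> = (\<Sum>l\<in>{l \<in> proj_lines. klein l \<subseteq> G}. w (klein l))" by (simp add: sum.inter_filter)
    finally show ?thesis .
  qed
  obtain n where n: "cl_pair S T n"
  proof (rule cl_pair_of_weights[of S T "\<lambda>l. w (klein l)"])
    show "S \<subseteq> proj_points" "T \<subseteq> proj_planes" by (auto simp: S_def T_def)
    show "indicator S P = (\<Sum>l\<in>{l \<in> proj_lines. P \<subseteq> l}. w (klein l))" if P: "P \<in> proj_points" for P
    proof -
      have "{l \<in> proj_lines. klein l \<subseteq> latin_plane P} = {l \<in> proj_lines. P \<subseteq> l}" using latin_plane_iff by blast
      then show ?thesis using weight[OF latin_plane_generator[OF P]] P by (simp add: S_def indicator_def)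
    qed
    show "indicator T E = (\<Sum>l\<in>{l \<in> proj_lines. l \<subseteq> E}. w (klein l))" if E: "E \<in> proj_planes" for E
    proof -
      have "{l \<in> proj_lines. klein l \<subseteq> greek_plane E} = {l \<in> proj_lines. l \<subseteq> E}" using greek_plane_iff by blast
      then show ?thesis using weight[OF greek_plane_generator[OF E]] E by (simp add: T_def indicator_def)
    qed
  qed
  moreover have "L = generators_of S T"
  proof
    show "L \<subseteq> generators_of S T"
    proof
      fix G assume G: "G \<in> L"
      then have "G \<in> generators" using LG by blast
      from generator_cases[OF this] G show "G \<in> generators_of S T" by (auto simp: generators_of_def S_def T_def)
    qed
  qed (auto simp: generators_of_def S_def T_def)
  ultimately show ?thesis by (rule that)
qed

theorem theorem3p17:
  fixes L :: "('a::{field,finite} ^ 6) set set"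
    and q \<delta> :: nat and x :: real
  assumes "q = CARD('a)"
    and "\<exists>r::nat. q = r\<^sup>2"
    and "\<exists>B :: ('a ^ 3) set set.
           is_arg_min card (\<lambda>B. nontrivial_blocking_set B \<and> \<not> contains_baer_subplane B) B \<and>
           card B = q + \<delta>"
    and "cameron_liebler L"
    and "has_parameter L x"
    and "x < real \<delta>"
  shows "\<exists>F. L = \<Union> F \<and> pairwise disjnt F \<and> (\<forall>M\<in>F. is_point_pencil M \<or> baer_type M)"
proof -
  let ?ok = "\<lambda>B :: ('a ^ 3) set set. nontrivial_blocking_set B \<and> \<not> contains_baer_subplane B"
  obtain B1 :: "('a ^ 3) set set" where B1: "is_arg_min card ?ok B1" "card B1 = q + \<delta>"
    using assms(3) by blast
  have min: "q + \<delta> \<le> card B" if "?ok B" for B :: "('a ^ 3) set set"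
  proof -
    have "\<not> card B < card B1" using B1(1) that unfolding is_arg_min_def by blast
    then show ?thesis using B1(2) by simp
  qed
  (* An explicit blocking set bounds \<delta>, so that the parameter is at most q. *)
  obtain r where "CARD('a) = r\<^sup>2" using assms(1,2) by blast
  then obtain B0 :: "('a ^ 3) set set" where "?ok B0" "card B0 \<le> 2 * CARD('a) + 1"
    using exists_small_blocking_set by blast
  then have \<delta>: "\<delta> \<le> CARD('a) + 1" using min[of B0] assms(1) by simp
  obtain S T :: "('a ^ 4) set set" and n where c: "cl_pair S T n" and L: "L = generators_of S T"
    using cameron_liebler_cl_pair[OF assms(4)] .
  note D = cl_pairD[OF c]
  have "card L = 2 * n * (CARD('a) + 1)" unfolding L card_generators_of[OF D(1,2)] D(3,4) by simp
  (* In particular the parameter is an integer. *)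
  then have "(2 * (real CARD('a) + 1)) * x = (2 * (real CARD('a) + 1)) * real n"
    using assms(5) unfolding has_parameter_def by (simp add: algebra_simps)
  moreover have "2 * (real CARD('a) + 1) \<noteq> 0"
  proof -
    have "0 \<le> real CARD('a)" by simp
    then have "0 < 2 * (real CARD('a) + 1)" by (intro mult_pos_pos add_nonneg_pos) simp_all
    then show ?thesis by (rule less_imp_neq[THEN not_sym])
  qed
  ultimately have "x = real n" by (simp only: mult_cancel_left) simp
  then have n: "n < \<delta>" using assms(6) by simp
  have "blocking_bound TYPE('a) (n + CARD('a))"
    unfolding blocking_bound_def
  proof (intro allI impI)
    fix B :: "('a ^ 3) set set" assume B: "blocking_set B \<and> card B \<le> n + CARD('a)"
    then have "\<not> ?ok B" using min[of B] n assms(1) by linarith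
    then show "(\<exists>l\<in>proj_lines. pts l \<subseteq> B) \<or> contains_baer_subplane B"
      using B unfolding nontrivial_blocking_set_def by blast
  qed
  then show ?thesis unfolding L using cl_pair_decomposition[OF c] n \<delta> by simp
qed

end
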